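(* Let $p>2$, let $X\subseteq\mathbf{C}$ be a discrete set, and let $z_0\in\mathbf{C}$. Suppose there are five points $a_1,\dots,a_5\in X$ such that, among the five rays which are the fibers over $z_0$ of $M_{a_1},\dots,M_{a_5}$, every ray lies between two of the other rays, on the side where those two rays make an angle less than $\pi$. Then there exist $\epsilon>0$, $R>0$, and constants $C_z$ depending continuously on $z$ for $|z-z_0|<\epsilon$, such that for all $f\in\mathcal{A}_X$ and all $z$ with $|z-z_0|<\epsilon$, $$|f(z)|\le C_z\left(\int_{|\zeta-z_0|<R}|f(\zeta)|^p\,dA(\zeta)\right)^{1/p}.$$
   Context: $dA$ is Lebesgue area measure on $\mathbf{C}$. For a discrete set $X\subseteq\mathbf{C}$, $\mathcal{A}_X$ is the set of all continuous functions $f:\mathbf{C}\to\mathbf{C}$ such that for every $a\in X$ and every $r>0$, the restriction $f|_{\{|z-a|=r\}}$ extends continuously to $\{|z-a|\le r\}$ with the extension holomorphic in $\{|z-a|<r\}$. For $a\in\mathbf{C}$, $M_a=\{(z,w)\in\mathbf{C}^2: w=\frac{t}{z-a}+\overline a,\ t\ge|z-a|^2\}$. For $z_0\ne a$, the fiber of $M_a$ over $z_0$ is the set of $w$ with $(z_0,w)\in M_a$; it is the closed ray in the $w$-plane starting at $\overline{z_0}$ with direction $\overline{z_0-a}$. "Ray $i$ lies between rays $j$ and $k$ on the side with angle less than $\pi$" means that rays $j,k$ (with $i,j,k$ distinct) are non-parallel and ray $i$ (minus its origin) lies in the open convex sector of angle less than $\pi$ bounded by rays $j$ and $k$. (In particular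 $z_0\ne a_i$ for all $i$.) *)

theory Defs
  imports "HOL-Analysis.Analysis"
begin

definition hol_ext_on_circle :: "(complex \<Rightarrow> complex) \<Rightarrow> complex \<Rightarrow> real \<Rightarrow> bool" where
  "hol_ext_on_circle f a r \<longleftrightarrow>
     (\<exists>g. continuous_on (cball a r) g \<and> g holomorphic_on ball a r \<and> (\<forall>z\<in>sphere a r. g z = f z))"

definition circle_ext_funs :: "complex set \<Rightarrow> (complex \<Rightarrow> complex) set" where
  "circle_ext_funs X =
     {f. continuous_on UNIV f \<and> (\<forall>a\<in>X. \<forall>r>0. hol_ext_on_circle f a r)}"

(* The guard z \<noteq> a excludes the meaningless quotient t / 0, which HOL evaluates to 0. *)
definition M_surf :: "complex \<Rightarrow> (complex \<times> complex) set" where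
  "M_surf a =
     {(z, w). z \<noteq> a \<and> (\<exists>t::real. t \<ge> (cmod (z - a))\<^sup>2 \<and> w = complex_of_real t / (z - a) + cnj a)}"

definition fiber_over :: "complex \<Rightarrow> (complex \<times> complex) set \<Rightarrow> complex set" where
  "fiber_over z M = {w. (z, w) \<in> M}"

definition closed_ray :: "complex \<Rightarrow> complex \<Rightarrow> complex set" where
  "closed_ray c u = {c + complex_of_real t * u | t. t \<ge> 0}"

(* For u, v linearly independent over the reals, this is the convex sector of angle
   less than pi bounded by closed_ray c u and closed_ray c v. *)
definition open_sector :: "complex \<Rightarrow> complex \<Rightarrow> complex \<Rightarrow> complex set" where
  "open_sector c u v = {c + complex_of_real s * u + complex_of_real t * v | s t. s > 0 \<and> t > 0}"

(* A, B, C are rays with origin c.  Non-collinearity of 0, v, w excludes both equal and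
   opposite directions of B and C.  The directions are determined by the rays up to positive
   factors, which do not affect the sector. *)
definition ray_between :: "complex \<Rightarrow> complex set \<Rightarrow> complex set \<Rightarrow> complex set \<Rightarrow> bool" where
  "ray_between c A B C \<longleftrightarrow>
     (\<exists>u v w. u \<noteq> 0 \<and> A = closed_ray c u \<and> B = closed_ray c v \<and> C = closed_ray c w \<and>
        \<not> collinear {0, v, w} \<and> A - {c} \<subseteq> open_sector c v w)"

lemma fiber_over_M_surf:
  assumes "z \<noteq> a"
  shows "fiber_over z (M_surf a) = closed_ray (cnj z) (cnj (z - a))"
proof -
  define d where "d = z - a"
  have d: "d \<noteq> 0" using assms by (simp add: d_def)
  define n where "n = (cmod d)\<^sup>2"
  have n: "n > 0" using d by (simp add: n_def)
  have div: "complex_of_real t / d = complex_of_real (t / n) * cnj d" for t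
    unfolding n_def using d by (simp add: complex_div_cnj[of _ d])
  have cz: "cnj z = cnj d + cnj a" by (simp add: d_def)
  have "w \<in> fiber_over z (M_surf a) \<longleftrightarrow> w \<in> closed_ray (cnj z) (cnj d)" for w
  proof
    assume "w \<in> fiber_over z (M_surf a)"
    then obtain t where t: "t \<ge> n" "w = complex_of_real t / d + cnj a"
      by (auto simp: fiber_over_def M_surf_def d_def n_def)
    have "w = cnj z + complex_of_real (t / n - 1) * cnj d"
      unfolding t(2) div cz by (simp add: algebra_simps)
    moreover have "t / n - 1 \<ge> 0" using t(1) n by simp
    ultimately show "w \<in> closed_ray (cnj z) (cnj d)"
      unfolding closed_ray_def by blast
  next
    assume "w \<in> closed_ray (cnj z) (cnj d)"
    then obtain s where s: "s \<ge> 0" "w = cnj z + complex_of_real s * cnj d"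
      by (auto simp: closed_ray_def)
    have "w = complex_of_real ((s + 1) * n) / d + cnj a"
      unfolding s(2) div cz using n by (simp add: field_simps)
    moreover have "(s + 1) * n \<ge> n" using s(1) n by (simp add: algebra_simps)
    ultimately show "w \<in> fiber_over z (M_surf a)"
      using assms unfolding fiber_over_def M_surf_def n_def d_def by blast
  qed
  then show ?thesis by (auto simp: d_def)
qed

end

theory Submission
  imports Defs "HOL-Complex_Analysis.Conformal_Mappings"
begin

text \<open>
  Write \<open>F\<^sub>a t z\<close> for the value at \<open>z\<close> of the holomorphic extension of \<open>f\<close> from the circle of
  radius \<open>sqrt t\<close> about \<open>a\<close>.  With \<open>w = t / (z - a) + cnj a\<close> the parameter \<open>t \<ge> |z - a|\<^sup>2\<close>
  runs along the ray of \<open>M\<^sub>a\<close> over \<open>z\<close>, whose origin carries the value \<open>f z\<close>.  The integral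
  \<open>B\<^sub>a\<close> of \<open>F\<^sub>a dw / (w - \<eta> z)\<close> over the ray, cut off at a fixed \<open>t = T\<close>, satisfies
  \<open>\<partial>B\<^sub>a / \<partial>(cnj z) = - f z / (cnj z - \<eta> z)\<close> for holomorphic \<open>\<eta>\<close>.  The right-hand side does not
  depend on \<open>a\<close>, so \<open>B\<^sub>a - B\<^sub>b\<close> is holomorphic as long as \<open>\<eta> z\<close> avoids both rays.

  If \<open>u\<close> lies in the sector of angle less than \<open>\<pi>\<close> between the rays of \<open>a\<close> and \<open>b\<close>, then the point
  \<open>\<eta> = cnj z - \<delta> u\<close> behind the corner is the centre of a parabolic disc \<open>z \<mapsto> (z, \<eta> z)\<close> which
  avoids both rays and whose boundary stays away from them uniformly in \<open>\<delta>\<close>.  By the maximum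
  principle \<open>B\<^sub>a - B\<^sub>b\<close> at \<open>(z, cnj z - \<delta> u)\<close> is bounded, uniformly in \<open>\<delta>\<close>, by the integrals of
  \<open>|F\<^sub>a|\<close> and \<open>|F\<^sub>b|\<close> over single rays.  Cauchy's formula and Young's inequality bound these by the
  \<open>L\<^sup>p\<close> norm of \<open>f\<close>, because \<open>1 / |\<zeta> - z|\<close> is locally in \<open>L\<^sup>q\<close> for the conjugate exponent \<open>q\<close>
  exactly when \<open>p > 2\<close>.

  The ray condition yields three rays whose directions have \<open>0\<close> in the interior of their convex hull.
  Summing the three differences around the cycle regroups the terms into the jumps of the
  Cauchy integrals \<open>B\<^sub>a\<close> at the origins of the rays; as \<open>\<delta>\<close> tends to \<open>0\<close> the sum tends to \<open>f z\<close> times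
  a nonzero multiple of \<open>2 \<pi> i\<close>.
\<close>

section \<open>Wirtinger derivatives and an approximate maximum principle\<close>

text \<open>\<open>q\<close> is the derivative of \<open>h\<close> with respect to \<open>cnj z\<close>.\<close>

definition wirtinger_on :: "complex set \<Rightarrow> (complex \<Rightarrow> complex) \<Rightarrow> (complex \<Rightarrow> complex) \<Rightarrow> bool" where
  "wirtinger_on S h q \<longleftrightarrow> continuous_on S q \<and>
     (\<exists>p. continuous_on S p \<and>
        (\<forall>z\<in>S. (h has_derivative (\<lambda>v. p z * v + q z * cnj v)) (at z)))"

section \<open>Calculus rules for the derivative in the conjugate variable\<close>

lemma wirtinger_on_imp_continuous_on:
  "wirtinger_on S h q \<Longrightarrow> continuous_on S h"
  unfolding wirtinger_on_def
  by (meson has_derivative_continuous continuous_at_imp_continuous_on)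

lemma wirtinger_on_cong:
  assumes "wirtinger_on S h q" "open S" "\<And>z. z \<in> S \<Longrightarrow> h z = h' z" "\<And>z. z \<in> S \<Longrightarrow> q z = q' z"
  shows "wirtinger_on S h' q'"
proof -
  obtain p where p: "continuous_on S p"
    "\<And>z. z \<in> S \<Longrightarrow> (h has_derivative (\<lambda>v. p z * v + q z * cnj v)) (at z)"
    using assms(1) unfolding wirtinger_on_def by blast
  have "(h' has_derivative (\<lambda>v. p z * v + q' z * cnj v)) (at z)" if "z \<in> S" for z
    using has_derivative_transform_within_open[OF p(2)[OF that] assms(2) that] assms(3,4) that
    by simp
  moreover have "continuous_on S q'"
    using assms(1,4) unfolding wirtinger_on_def by (metis continuous_on_cong)
  ultimately show ?thesis using p(1) unfolding wirtinger_on_def by blast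
qed

lemma wirtinger_on_const: "wirtinger_on S (\<lambda>z. c) (\<lambda>z. 0)"
  unfolding wirtinger_on_def by (intro conjI exI[of _ "\<lambda>z. 0"]) auto

lemma wirtinger_on_add:
  assumes "wirtinger_on S h1 q1" "wirtinger_on S h2 q2"
  shows "wirtinger_on S (\<lambda>z. h1 z + h2 z) (\<lambda>z. q1 z + q2 z)"
proof -
  obtain p1 p2 where p: "continuous_on S p1" "continuous_on S p2"
    "\<And>z. z \<in> S \<Longrightarrow> (h1 has_derivative (\<lambda>v. p1 z * v + q1 z * cnj v)) (at z)"
    "\<And>z. z \<in> S \<Longrightarrow> (h2 has_derivative (\<lambda>v. p2 z * v + q2 z * cnj v)) (at z)"
    and q: "continuous_on S q1" "continuous_on S q2"
    using assms unfolding wirtinger_on_def by blast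
  have "((\<lambda>z. h1 z + h2 z) has_derivative (\<lambda>v. (p1 z + p2 z) * v + (q1 z + q2 z) * cnj v)) (at z)"
    if "z \<in> S" for z
    by (rule has_derivative_eq_rhs[OF has_derivative_add[OF p(3,4)[OF that]]])
      (simp add: algebra_simps)
  then show ?thesis
    unfolding wirtinger_on_def using p(1,2) q
    by (intro conjI exI[of _ "\<lambda>z. p1 z + p2 z"] continuous_intros ballI) auto
qed

lemma wirtinger_on_mult:
  assumes "wirtinger_on S h1 q1" "wirtinger_on S h2 q2"
  shows "wirtinger_on S (\<lambda>z. h1 z * h2 z) (\<lambda>z. h1 z * q2 z + q1 z * h2 z)"
proof -
  obtain p1 p2 where p: "continuous_on S p1" "continuous_on S p2"
    "\<And>z. z \<in> S \<Longrightarrow> (h1 has_derivative (\<lambda>v. p1 z * v + q1 z * cnj v)) (at z)"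
    "\<And>z. z \<in> S \<Longrightarrow> (h2 has_derivative (\<lambda>v. p2 z * v + q2 z * cnj v)) (at z)"
    and q: "continuous_on S q1" "continuous_on S q2"
    using assms unfolding wirtinger_on_def by blast
  have h: "continuous_on S h1" "continuous_on S h2"
    using assms by (auto intro: wirtinger_on_imp_continuous_on)
  have "((\<lambda>z. h1 z * h2 z) has_derivative
      (\<lambda>v. (h1 z * p2 z + p1 z * h2 z) * v + (h1 z * q2 z + q1 z * h2 z) * cnj v)) (at z)"
    if "z \<in> S" for z
    by (rule has_derivative_eq_rhs[OF has_derivative_mult[OF p(3,4)[OF that]]])
      (simp add: algebra_simps)
  then show ?thesis
    unfolding wirtinger_on_def using p(1,2) q h
    by (intro conjI exI[of _ "\<lambda>z. h1 z * p2 z + p1 z * h2 z"] continuous_intros ballI) auto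
qed

lemma wirtinger_on_compose_holomorphic:
  assumes h: "wirtinger_on S h q" and U: "open U" "g holomorphic_on U" "h ` S \<subseteq> U"
  shows "wirtinger_on S (\<lambda>z. g (h z)) (\<lambda>z. deriv g (h z) * q z)"
proof -
  obtain p where p: "continuous_on S p"
    "\<And>z. z \<in> S \<Longrightarrow> (h has_derivative (\<lambda>v. p z * v + q z * cnj v)) (at z)"
    and q: "continuous_on S q"
    using h unfolding wirtinger_on_def by blast
  have "continuous_on U (deriv g)"
    using U holomorphic_deriv holomorphic_on_imp_continuous_on by blast
  then have c: "continuous_on S (\<lambda>z. deriv g (h z))"
    using U(3) wirtinger_on_imp_continuous_on[OF h] by (metis continuous_on_compose2)
  have "((\<lambda>z. g (h z)) has_derivative
      (\<lambda>v. (deriv g (h z) * p z) * v + (deriv g (h z) * q z) * cnj v)) (at z)"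
    if "z \<in> S" for z
  proof -
    have "(g has_field_derivative deriv g (h z)) (at (h z))"
      using U that by (meson holomorphic_derivI image_subset_iff)
    then have "(g has_derivative (*) (deriv g (h z))) (at (h z))"
      by (simp add: has_field_derivative_def)
    from has_derivative_compose[OF p(2)[OF that] this] show ?thesis
      by (rule has_derivative_eq_rhs) (simp add: algebra_simps)
  qed
  then show ?thesis
    unfolding wirtinger_on_def using p(1) q c
    by (intro conjI exI[of _ "\<lambda>z. deriv g (h z) * p z"] continuous_intros ballI) auto
qed

lemma wirtinger_on_holomorphic:
  assumes "open S" "g holomorphic_on S"
  shows "wirtinger_on S g (\<lambda>z. 0)"
proof -
  have "continuous_on S (deriv g)"
    using assms holomorphic_deriv holomorphic_on_imp_continuous_on by blast
  then show ?thesis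
    unfolding wirtinger_on_def using holomorphic_derivI[OF assms(2,1)]
    by (auto simp: has_field_derivative_def intro!: exI[of _ "deriv g"])
qed

lemma wirtinger_on_cnj: "wirtinger_on S cnj (\<lambda>z. 1)"
  unfolding wirtinger_on_def by (auto intro!: exI[of _ "\<lambda>z. 0"] derivative_eq_intros)

lemma wirtinger_on_mult_holomorphic:
  assumes "open S" "g holomorphic_on S" "wirtinger_on S h q"
  shows "wirtinger_on S (\<lambda>z. g z * h z) (\<lambda>z. g z * q z)"
  using wirtinger_on_mult[OF wirtinger_on_holomorphic[OF assms(1,2)] assms(3)] by simp

lemma wirtinger_on_uminus:
  assumes "wirtinger_on S h q"
  shows "wirtinger_on S (\<lambda>z. - h z) (\<lambda>z. - q z)"
  using wirtinger_on_mult[OF wirtinger_on_const[of S "-1"] assms] by simp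

lemma wirtinger_on_diff:
  assumes "wirtinger_on S h1 q1" "wirtinger_on S h2 q2"
  shows "wirtinger_on S (\<lambda>z. h1 z - h2 z) (\<lambda>z. q1 z - q2 z)"
  using wirtinger_on_add[OF assms(1) wirtinger_on_uminus[OF assms(2)]] by simp

lemma wirtinger_on_sum:
  assumes "\<And>i. i \<in> I \<Longrightarrow> wirtinger_on S (h i) (q i)"
  shows "wirtinger_on S (\<lambda>z. \<Sum>i\<in>I. h i z) (\<lambda>z. \<Sum>i\<in>I. q i z)"
  using assms
  by (induction I rule: infinite_finite_induct)
    (auto intro: wirtinger_on_const wirtinger_on_add)

text \<open>On the circle of radius \<open>s\<close> the angular derivative has mean zero, so the radial derivative of the
  circle mean of \<open>h\<close> involves only \<open>q\<close>.\<close>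

lemma approx_maximum_principle:
  fixes h q :: "complex \<Rightarrow> complex"
  assumes h: "wirtinger_on S h q" and S: "cball z' \<rho> \<subseteq> S" and \<rho>: "\<rho> > 0"
    and q: "\<And>z. z \<in> cball z' \<rho> \<Longrightarrow> cmod (q z) \<le> \<delta>"
    and B: "\<And>z. z \<in> sphere z' \<rho> \<Longrightarrow> cmod (h z) \<le> B"
  shows "cmod (h z') \<le> B + 2 * \<rho> * \<delta>"
proof -
  obtain p where cp: "continuous_on S p" and
    D: "\<And>z. z \<in> S \<Longrightarrow> (h has_derivative (\<lambda>v. p z * v + q z * cnj v)) (at z)"
    and cq: "continuous_on S q"
    using h unfolding wirtinger_on_def by blast
  have ch: "continuous_on S h" by (rule wirtinger_on_imp_continuous_on[OF h])
  define c where "c = (\<lambda>s \<theta>::real. z' + complex_of_real s * cis \<theta>)"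
  have c_in: "c s \<theta> \<in> S" if "s \<in> {0..\<rho>}" for s \<theta>
    using that S by (auto simp: c_def dist_norm norm_mult subset_iff)
  \<comment> \<open>\<open>\<Phi>s s \<theta>\<close> is the radial derivative of
    \<open>h (c s \<theta>)\<close>, and \<open>\<psi> s\<close> is 2 pi times the mean of
    \<open>h\<close> over the circle of radius \<open>s\<close>.\<close>
  define \<Phi>s where "\<Phi>s = (\<lambda>s \<theta>. p (c s \<theta>) * cis \<theta> + q (c s \<theta>) * cnj (cis \<theta>))"
  define \<psi> where "\<psi> = (\<lambda>s. integral (cbox 0 (2*pi)) (\<lambda>\<theta>. h (c s \<theta>)))"
  have contc: "continuous_on A (\<lambda>(s,\<theta>). c s \<theta>)" for A
    unfolding c_def split_beta by (intro continuous_intros)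
  have contc2: "continuous_on A (\<lambda>\<theta>. c s \<theta>)" for A s
    unfolding c_def by (intro continuous_intros)
  have int_h: "(\<lambda>\<theta>. g (c s \<theta>)) integrable_on cbox 0 (2*pi)"
    if "s \<in> {0..\<rho>}" "continuous_on S g" for s and g :: "complex \<Rightarrow> complex"
    by (rule integrable_continuous, rule continuous_on_compose2[OF that(2) contc2])
      (use c_in that in auto)
  have int_e: "(\<lambda>\<theta>. g (c s \<theta>) * cis \<theta>) integrable_on cbox 0 (2*pi)"
       "(\<lambda>\<theta>. g (c s \<theta>) * cnj (cis \<theta>)) integrable_on cbox 0 (2*pi)"
    if "s \<in> {0..\<rho>}" "continuous_on S g" for s and g :: "complex \<Rightarrow> complex"
    by (intro integrable_continuous continuous_intros continuous_on_compose2[OF that(2) contc2];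
        use c_in that in auto)+
  have der_s: "((\<lambda>s. h (c s \<theta>)) has_vector_derivative \<Phi>s s \<theta>) (at s within {0..\<rho>})"
    if "s \<in> {0..\<rho>}" for s \<theta>
  proof -
    have "((\<lambda>s. c s \<theta>) has_derivative (\<lambda>x. of_real x * cis \<theta>)) (at s within {0..\<rho>})"
      unfolding c_def by (auto intro!: derivative_eq_intros)
    from has_derivative_compose[OF this D[OF c_in[OF that]]] show ?thesis
      unfolding has_vector_derivative_def \<Phi>s_def
      by (rule has_derivative_eq_rhs) (auto simp: scaleR_conv_of_real algebra_simps)
  qed
  have cis_der: "(cis has_derivative (\<lambda>x. of_real x * (\<i> * cis \<theta>))) (at \<theta> within A)" for \<theta> A
  proof -
    have "(cis has_vector_derivative (\<i> * cis \<theta>)) (at \<theta> within A)"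
      unfolding cis_conv_exp
      by (auto intro!: derivative_eq_intros has_vector_derivative_real_field simp: algebra_simps)
    then show ?thesis by (simp add: has_vector_derivative_def scaleR_conv_of_real)
  qed
  have der_th: "((\<lambda>\<theta>. h (c s \<theta>)) has_vector_derivative
       \<i> * of_real s * (p (c s \<theta>) * cis \<theta> - q (c s \<theta>) * cnj (cis \<theta>))) (at \<theta> within A)"
    if "s \<in> {0..\<rho>}" for s \<theta> A
  proof -
    have "((\<lambda>\<theta>. c s \<theta>) has_derivative (\<lambda>x. of_real s * (of_real x * (\<i> * cis \<theta>)))) (at \<theta> within A)"
      unfolding c_def using cis_der[of \<theta> A]
      by (auto intro!: derivative_eq_intros simp: scaleR_conv_of_real algebra_simps)
    from has_derivative_compose[OF this D[OF c_in[OF that]]] show ?thesis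
      unfolding has_vector_derivative_def
      by (rule has_derivative_eq_rhs) (auto simp: scaleR_conv_of_real algebra_simps)
  qed
  have key: "norm (integral (cbox 0 (2*pi)) (\<Phi>s s)) \<le> 4 * pi * \<delta>" if s: "s \<in> {0..\<rho>}" for s
  proof -
    let ?I = "integral (cbox 0 (2*pi))"
    define Ip where "Ip = ?I (\<lambda>\<theta>. p (c s \<theta>) * cis \<theta>)"
    define Iq where "Iq = ?I (\<lambda>\<theta>. q (c s \<theta>) * cnj (cis \<theta>))"
    have sum: "?I (\<Phi>s s) = Ip + Iq"
      unfolding \<Phi>s_def Ip_def Iq_def using int_e[OF s] cp cq by (intro integral_add) auto
    have Iq: "norm Iq \<le> \<delta> * (2 * pi)"
    proof -
      have "norm Iq \<le> \<delta> * measure lborel (cbox 0 (2*pi))"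
        unfolding Iq_def
      proof (rule integrable_bound)
        show "0 \<le> \<delta>" using q[of z'] \<rho> norm_ge_zero order_trans by (metis centre_in_cball less_le)
        show "(\<lambda>\<theta>. q (c s \<theta>) * cnj (cis \<theta>)) integrable_on cbox 0 (2*pi)"
          using int_e[OF s] cq by auto
        show "norm (q (c s x) * cnj (cis x)) \<le> \<delta>" for x
          using q[of "c s x"] s by (simp add: norm_mult c_def dist_norm)
      qed
      then show ?thesis by simp
    qed
    \<comment> \<open>For \<open>s\<close> nonzero, periodicity of \<open>h (c s \<theta>)\<close>
      in the angle makes the integral of its angular derivative, which is
      \<open>\<i> * s * (Ip - Iq)\<close>, vanish. At \<open>s = 0\<close> the factor
      \<open>s\<close> loses this information, but there \<open>p\<close> and \<open>q\<close> do
      not depend on the angle and \<open>cis\<close> has mean zero, so both integrals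
      vanish.\<close>
    have "Ip = Iq"
    proof (cases "s = 0")
      case True
      have "((\<lambda>x. cis x) has_integral (cis (2*pi) / \<i> - cis 0 / \<i>)) {0..2*pi}"
        by (rule fundamental_theorem_of_calculus)
          (auto simp: has_vector_derivative_def scaleR_conv_of_real mult.left_commute
             simp flip: mult.assoc intro!: derivative_eq_intros cis_der)
      then have 1: "?I cis = 0" by (simp add: integral_unique)
      have "continuous_on (cbox 0 (2*pi)) cis"
        by (intro continuous_intros)
      then have "(cis has_integral 0) (cbox 0 (2*pi))"
        using 1 integrable_continuous integrable_integral by metis
      then have "((cnj \<circ> cis) has_integral (cnj 0)) (cbox 0 (2*pi))"
        by (simp only: has_integral_cnj)
      then have "((\<lambda>x. cnj (cis x)) has_integral 0) (cbox 0 (2*pi))"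
        by (simp only: comp_def complex_cnj_zero)
      then have "?I (\<lambda>x. cnj (cis x)) = 0" by (simp add: integral_unique)
      then show ?thesis using 1 True by (simp add: Ip_def Iq_def c_def)
    next
      case False
      have "((\<lambda>\<theta>. \<i> * of_real s * (p (c s \<theta>) * cis \<theta> - q (c s \<theta>) * cnj (cis \<theta>))) has_integral
          (h (c s (2*pi)) - h (c s 0))) {0..2*pi}"
        by (rule fundamental_theorem_of_calculus) (auto intro: der_th[OF s])
      moreover have "((\<lambda>\<theta>. \<i> * of_real s * (p (c s \<theta>) * cis \<theta> - q (c s \<theta>) * cnj (cis \<theta>))) has_integral
          (\<i> * of_real s * (Ip - Iq))) (cbox 0 (2*pi))"
        unfolding Ip_def Iq_def
        using int_e(1)[OF s cp] int_e(2)[OF s cq]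
        by (intro has_integral_mult_right has_integral_diff) (simp_all only: integrable_integral)
      ultimately have "\<i> * of_real s * (Ip - Iq) = h (c s (2*pi)) - h (c s 0)"
        unfolding cbox_interval by (rule has_integral_unique[rotated])
      then have "\<i> * of_real s * (Ip - Iq) = 0"
        by (simp add: c_def)
      then show ?thesis using False by simp
    qed
    then have "norm (?I (\<Phi>s s)) = 2 * norm Iq"
      unfolding sum by (metis mult_2 norm_mult norm_numeral)
    then show ?thesis using Iq by (simp add: mult_ac)
  qed
  have der\<psi>: "(\<psi> has_vector_derivative integral (cbox 0 (2*pi)) (\<Phi>s s)) (at s within {0..\<rho>})"
    if "s \<in> {0..\<rho>}" for s
    unfolding \<psi>_def
  proof (rule leibniz_rule_vector_derivative)
    show "continuous_on ({0..\<rho>} \<times> cbox 0 (2*pi)) (\<lambda>(s,\<theta>). \<Phi>s s \<theta>)"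
      unfolding \<Phi>s_def split_beta using contc[unfolded split_beta]
      by (intro continuous_intros continuous_on_compose2[OF cp] continuous_on_compose2[OF cq])
        (auto simp: c_in)
  qed (use that der_s int_h[OF _ ch] in auto)
  have "norm (\<psi> \<rho> - \<psi> 0) \<le> 4 * pi * \<delta> * norm (\<rho> - 0)"
  proof (rule differentiable_bound)
    show "convex {0..\<rho>}" by simp
    show "(\<psi> has_derivative (\<lambda>x. x *\<^sub>R integral (cbox 0 (2*pi)) (\<Phi>s s))) (at s within {0..\<rho>})"
      if "s \<in> {0..\<rho>}" for s
      using der\<psi>[OF that] by (simp add: has_vector_derivative_def)
    show "onorm (\<lambda>x. x *\<^sub>R integral (cbox 0 (2*pi)) (\<Phi>s s)) \<le> 4 * pi * \<delta>"
      if "s \<in> {0..\<rho>}" for s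
      using key[OF that] by (intro onorm_le) (auto simp: mult_left_mono mult.commute)
  qed (use \<rho> in auto)
  moreover have "norm (\<psi> \<rho>) \<le> B * (2 * pi)"
  proof -
    have "norm (\<psi> \<rho>) \<le> B * measure lborel (cbox 0 (2*pi))"
      unfolding \<psi>_def
    proof (rule integrable_bound)
      have "z' + of_real \<rho> \<in> sphere z' \<rho>" using \<rho> by (simp add: dist_norm)
      from order_trans[OF norm_ge_zero B[OF this]] show "0 \<le> B" .
      show "norm (h (c \<rho> x)) \<le> B" for x
        using B \<rho> by (simp add: c_def dist_norm norm_mult)
      show "(\<lambda>\<theta>. h (c \<rho> \<theta>)) integrable_on cbox 0 (2*pi)"
        by (rule int_h[OF _ ch]) (use \<rho> in auto)
    qed
    then show ?thesis by simp
  qed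
  moreover have "norm (\<psi> 0) = 2 * pi * norm (h z')"
    by (simp add: \<psi>_def c_def)
  moreover have "norm (\<psi> 0) \<le> norm (\<psi> \<rho>) + norm (\<psi> \<rho> - \<psi> 0)"
    by (metis norm_minus_commute norm_triangle_sub)
  ultimately have "2 * pi * norm (h z') \<le> 2 * pi * (B + 2 * \<rho> * \<delta>)"
    using \<rho> by (simp add: algebra_simps)
  then show ?thesis by simp
qed

section \<open>Cauchy transforms along rays\<close>

lemma wirtinger_on_norm_square:
  "wirtinger_on S (\<lambda>z. of_real ((cmod (z - a))\<^sup>2)) (\<lambda>z. z - a)"
proof -
  have "wirtinger_on UNIV (\<lambda>z. (z - a) * (cnj z - cnj a)) (\<lambda>z. (z - a) * (1 - 0))"
    by (intro wirtinger_on_mult_holomorphic wirtinger_on_diff wirtinger_on_cnj wirtinger_on_const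
        holomorphic_intros) auto
  moreover have "(z - a) * (cnj z - cnj a) = of_real ((cmod (z - a))\<^sup>2)" for z
    by (simp only: complex_norm_square complex_cnj_diff)
  ultimately have "wirtinger_on UNIV (\<lambda>z. of_real ((cmod (z - a))\<^sup>2)) (\<lambda>z. z - a)"
    by simp
  then show ?thesis
    unfolding wirtinger_on_def by (meson continuous_on_subset subset_UNIV UNIV_I)
qed

text \<open>If the quotient were a nonpositive real \<open>r\<close>, then \<open>N\<close> would be
  a convex combination of \<open>t\<close> and \<open>x\<close>, although it misses the segment. So
  the principal \<open>Ln\<close> of \<open>(t - N) / (x - N)\<close> is a primitive along the whole
  path, and the normalization by \<open>x - N\<close> makes it vanish at the start.\<close>

lemma integral_inverse_linear_eq_Ln:
  assumes "x \<le> T" "\<And>t. t \<in> {x..T} \<Longrightarrow> of_real t \<noteq> N"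
  shows "((\<lambda>t. 1 / (of_real t - N)) has_integral Ln ((of_real T - N) / (of_real x - N))) {x..T}"
    and "(of_real T - N) / (of_real x - N) \<notin> \<real>\<^sub>\<le>\<^sub>0"
proof -
  have xN: "of_real x - N \<noteq> 0" using assms by auto
  have nonpos: "(of_real t - N) / (of_real x - N) \<notin> \<real>\<^sub>\<le>\<^sub>0" if t: "t \<in> {x..T}" for t
  proof
    assume "(of_real t - N) / (of_real x - N) \<in> \<real>\<^sub>\<le>\<^sub>0"
    then obtain r where r: "r \<le> 0" "(of_real t - N) / (of_real x - N) = of_real r"
      by (auto elim!: nonpos_Reals_cases)
    then have eq: "of_real t - N = of_real r * (of_real x - N)"
      using xN by (simp add: field_simps)
    define s where "s = (t - r * x) / (1 - r)"
    have r1: "1 - r > 0" using r by simp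
    have "N * of_real (1 - r) = of_real (t - r * x)"
      using eq by (simp add: algebra_simps)
    then have "N = of_real s"
      using r1 unfolding s_def of_real_divide by (subst eq_divide_eq) (auto simp: complex_eq_iff)
    moreover have "s \<in> {x..T}"
    proof -
      have "r * T \<le> r * x" using r(1) assms(1) by (simp add: mult_left_mono_neg)
      moreover have "x \<le> t" "t \<le> T" using t by auto
      ultimately have "x * (1 - r) \<le> t - r * x" "t - r * x \<le> T * (1 - r)"
        by (simp_all add: algebra_simps)
      then show ?thesis
        using r1 by (simp add: s_def pos_le_divide_eq pos_divide_le_eq)
    qed
    ultimately show False using assms(2) by blast
  qed
  then show "(of_real T - N) / (of_real x - N) \<notin> \<real>\<^sub>\<le>\<^sub>0" using assms(1) by simp
  have "((\<lambda>t. 1 / (of_real t - N)) has_integral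
     Ln ((of_real T - N) / (of_real x - N)) - Ln ((of_real x - N) / (of_real x - N))) {x..T}"
  proof (rule fundamental_theorem_of_calculus)
    fix t assume t: "t \<in> {x..T}"
    have tN: "of_real t - N \<noteq> 0" using assms t by auto
    show "((\<lambda>t. Ln ((of_real t - N) / (of_real x - N))) has_vector_derivative 1 / (of_real t - N))
       (at t within {x..T})"
      using nonpos[OF t] xN tN
      by (intro has_vector_derivative_real_field) (auto intro!: derivative_eq_intros)
  qed (use assms in auto)
  then show "((\<lambda>t. 1 / (of_real t - N)) has_integral Ln ((of_real T - N) / (of_real x - N))) {x..T}"
    using xN by simp
qed

text \<open>For \<open>N z = (\<eta> - cnj a) * (z - a)\<close> and \<open>w = t / (z - a) + cnj a\<close> the kernel \<open>dt / (t - N z)\<close>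
  is \<open>dw / (w - \<eta>)\<close>.\<close>

definition cauchy_transform ::
  "complex \<Rightarrow> real \<Rightarrow> (real \<Rightarrow> complex \<Rightarrow> complex) \<Rightarrow> (complex \<Rightarrow> complex) \<Rightarrow> complex \<Rightarrow> complex" where
  "cauchy_transform a T P N z =
     integral {(cmod (z - a))\<^sup>2..T} (\<lambda>t. P t z / (of_real t - N z))"

section \<open>Transforms of polynomials\<close>

lemma DERIV_power_Suc_div:
  "((\<lambda>w::complex. w ^ Suc k / of_nat (Suc k)) has_field_derivative w ^ k) (at w within A)"
  using DERIV_cdivide[OF DERIV_power[OF DERIV_ident, of "Suc k" w A], of "of_nat (Suc k)"]
  by (simp del: of_nat_Suc power_Suc)

text \<open>For fixed \<open>t\<close> the integrand is holomorphic in \<open>z\<close>, so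
  \<open>cnj z\<close> enters only through the lower limit: the derivative is minus the integrand
  there times the derivative \<open>z - a\<close> of the limit. Induction on \<open>m\<close>
  replaces differentiation under the integral:
  \<open>t ^ Suc m / (t - N) = t ^ m + N * t ^ m / (t - N)\<close> leads down to an explicit
  logarithm.\<close>

lemma wirtinger_on_cauchy_transform_power:
  assumes S: "open S" and N: "N holomorphic_on S"
    and T: "\<And>z. z \<in> S \<Longrightarrow> (cmod (z - a))\<^sup>2 \<le> T"
    and ne: "\<And>z t. z \<in> S \<Longrightarrow> t \<in> {(cmod (z - a))\<^sup>2..T} \<Longrightarrow> of_real t \<noteq> N z"
  shows "wirtinger_on S (cauchy_transform a T (\<lambda>t z. of_real t ^ m) N)
     (\<lambda>z. - (of_real ((cmod (z - a))\<^sup>2) ^ m * (z - a) / (of_real ((cmod (z - a))\<^sup>2) - N z)))"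
proof -
  define x where "x = (\<lambda>z::complex. complex_of_real ((cmod (z - a))\<^sup>2))"
  have wx: "wirtinger_on S x (\<lambda>z. z - a)"
    unfolding x_def by (rule wirtinger_on_norm_square)
  have xN: "x z - N z \<noteq> 0" if "z \<in> S" for z
    using ne[OF that, of "(cmod (z - a))\<^sup>2"] T[OF that] by (auto simp: x_def)
  have wpow: "wirtinger_on S (\<lambda>z. x z ^ Suc k / of_nat (Suc k)) (\<lambda>z. x z ^ k * (z - a))" for k
  proof -
    have "(\<lambda>w::complex. w ^ Suc k / of_nat (Suc k)) holomorphic_on UNIV"
      by (intro holomorphic_intros) auto
    moreover have "deriv (\<lambda>w::complex. w ^ Suc k / of_nat (Suc k)) w = w ^ k" for w
      by (rule DERIV_imp_deriv) (rule DERIV_power_Suc_div)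
    ultimately show ?thesis
      using wirtinger_on_compose_holomorphic[OF wx, of UNIV "\<lambda>w. w ^ Suc k / of_nat (Suc k)"]
      by simp
  qed
  have "wirtinger_on S (cauchy_transform a T (\<lambda>t z. of_real t ^ m) N)
      (\<lambda>z. - (x z ^ m * (z - a) / (x z - N z)))"
  proof (induction m)
    case 0
    have w1: "wirtinger_on S (\<lambda>z. x z - N z) (\<lambda>z. (z - a) - 0)"
      by (intro wirtinger_on_diff wx wirtinger_on_holomorphic S N)
    have "wirtinger_on S (\<lambda>z. inverse (x z - N z))
        (\<lambda>z. deriv inverse (x z - N z) * ((z - a) - 0))"
      by (rule wirtinger_on_compose_holomorphic[OF w1, where U = "-{0}"])
        (use xN in \<open>auto intro!: holomorphic_intros\<close>)
    then have "wirtinger_on S (\<lambda>z. (of_real T - N z) * inverse (x z - N z))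
        (\<lambda>z. (of_real T - N z) * (deriv inverse (x z - N z) * ((z - a) - 0)))"
      by (intro wirtinger_on_mult_holomorphic S holomorphic_intros N)
    then have "wirtinger_on S (\<lambda>z. Ln ((of_real T - N z) * inverse (x z - N z)))
        (\<lambda>z. deriv Ln ((of_real T - N z) * inverse (x z - N z)) *
            ((of_real T - N z) * (deriv inverse (x z - N z) * ((z - a) - 0))))"
    proof (rule wirtinger_on_compose_holomorphic)
      show "open (- \<real>\<^sub>\<le>\<^sub>0 :: complex set)" by (simp add: open_Compl)
      show "Ln holomorphic_on (- \<real>\<^sub>\<le>\<^sub>0)" by (intro holomorphic_intros) auto
      show "(\<lambda>z. (of_real T - N z) * inverse (x z - N z)) ` S \<subseteq> - \<real>\<^sub>\<le>\<^sub>0"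
        using integral_inverse_linear_eq_Ln(2)[OF T ne] by (auto simp: x_def divide_inverse)
    qed
    then show ?case
    proof (rule wirtinger_on_cong[OF _ S])
      fix z assume z: "z \<in> S"
      show "Ln ((of_real T - N z) * inverse (x z - N z)) = cauchy_transform a T (\<lambda>t z. of_real t ^ 0) N z"
        using integral_unique[OF integral_inverse_linear_eq_Ln(1)[OF T[OF z] ne[OF z]]]
        by (simp add: cauchy_transform_def x_def divide_inverse)
      have TN: "of_real T - N z \<noteq> 0" using ne[OF z, of T] T[OF z] by auto
      have np: "(of_real T - N z) * inverse (x z - N z) \<notin> \<real>\<^sub>\<le>\<^sub>0"
        using integral_inverse_linear_eq_Ln(2)[OF T ne] z by (auto simp: x_def divide_inverse)
      have dL: "deriv Ln ((of_real T - N z) * inverse (x z - N z)) =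
          inverse ((of_real T - N z) * inverse (x z - N z))"
        using np by (intro DERIV_imp_deriv has_field_derivative_Ln)
      have dI: "deriv inverse (x z - N z) = - (inverse (x z - N z) ^ Suc (Suc 0))"
        using xN[OF z] by (intro DERIV_imp_deriv DERIV_inverse)
      show "deriv Ln ((of_real T - N z) * inverse (x z - N z)) *
            ((of_real T - N z) * (deriv inverse (x z - N z) * ((z - a) - 0)))
          = - (x z ^ 0 * (z - a) / (x z - N z))"
        unfolding dL dI using TN xN[OF z] by (simp add: divide_simps)
    qed
  next
    case (Suc m)
    have w: "wirtinger_on S
       (\<lambda>z. (of_real T ^ Suc m / of_nat (Suc m) - x z ^ Suc m / of_nat (Suc m))
          + N z * cauchy_transform a T (\<lambda>t z. of_real t ^ m) N z)
       (\<lambda>z. (0 - x z ^ m * (z - a)) + N z * (- (x z ^ m * (z - a) / (x z - N z))))"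
      by (intro wirtinger_on_add wirtinger_on_diff wirtinger_on_const wpow
          wirtinger_on_mult_holomorphic S N Suc)
    show ?case
    proof (rule wirtinger_on_cong[OF w S])
      fix z assume z: "z \<in> S"
      let ?I = "{(cmod (z - a))\<^sup>2..T}"
      have "((\<lambda>t. complex_of_real t ^ m) has_integral
           of_real T ^ Suc m / of_nat (Suc m) - x z ^ Suc m / of_nat (Suc m)) ?I"
        unfolding x_def
      proof (rule fundamental_theorem_of_calculus[OF T[OF z]])
        fix t assume "t \<in> ?I"
        show "((\<lambda>t. complex_of_real t ^ Suc m / of_nat (Suc m)) has_vector_derivative of_real t ^ m) (at t within ?I)"
          using has_vector_derivative_real_field[OF DERIV_power_Suc_div, of m t ?I] .
      qed
      moreover have "((\<lambda>t. of_real t ^ m / (of_real t - N z)) has_integral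
          cauchy_transform a T (\<lambda>t z. of_real t ^ m) N z) ?I"
        unfolding cauchy_transform_def using ne[OF z]
        by (intro integrable_integral integrable_continuous_interval continuous_intros) auto
      ultimately have "((\<lambda>t. of_real t ^ m + N z * (of_real t ^ m / (of_real t - N z))) has_integral
          (of_real T ^ Suc m / of_nat (Suc m) - x z ^ Suc m / of_nat (Suc m))
            + N z * cauchy_transform a T (\<lambda>t z. of_real t ^ m) N z) ?I"
        by (intro has_integral_add has_integral_mult_right)
      moreover have "of_real t ^ m + N z * (of_real t ^ m / (of_real t - N z))
            = of_real t ^ Suc m / (of_real t - N z)" if "t \<in> ?I" for t
        using ne[OF z that] by (simp add: divide_simps) (simp add: algebra_simps)
      ultimately have "((\<lambda>t. of_real t ^ Suc m / (of_real t - N z)) has_integral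
          (of_real T ^ Suc m / of_nat (Suc m) - x z ^ Suc m / of_nat (Suc m))
            + N z * cauchy_transform a T (\<lambda>t z. of_real t ^ m) N z) ?I"
        by (rule has_integral_eq[rotated])
      then show "(of_real T ^ Suc m / of_nat (Suc m) - x z ^ Suc m / of_nat (Suc m))
            + N z * cauchy_transform a T (\<lambda>t z. of_real t ^ m) N z
          = cauchy_transform a T (\<lambda>t z. of_real t ^ Suc m) N z"
        unfolding cauchy_transform_def[of a T "\<lambda>t z. of_real t ^ Suc m"] by (simp add: integral_unique)
      show "(0 - x z ^ m * (z - a)) + N z * (- (x z ^ m * (z - a) / (x z - N z)))
          = - (x z ^ Suc m * (z - a) / (x z - N z))"
        using xN[OF z] by (simp add: divide_simps) (simp add: algebra_simps)
    qed
  qed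
  then show ?thesis by (simp add: x_def)
qed

text \<open>These are models for the extensions \<open>circle_ext\<close>, holomorphic in
  \<open>z\<close> and smooth in \<open>t\<close>. The extensions themselves are only shown to be
  continuous in \<open>t\<close>, so their transforms are reached by uniform approximation. The
  degree \<open>m i\<close> in \<open>t\<close> varies with \<open>i\<close> because the
  coefficients of \<open>(z - a) ^ i\<close> are approximated one at a time.\<close>

definition bipoly :: "complex \<Rightarrow> (real \<Rightarrow> complex \<Rightarrow> complex) \<Rightarrow> bool" where
  "bipoly a P \<longleftrightarrow> (\<exists>c n m. P = (\<lambda>t z. \<Sum>i<n. \<Sum>j\<le>m i. c i j * of_real t ^ j * (z - a) ^ i))"

lemma wirtinger_on_cauchy_transform_bipoly:
  assumes P: "bipoly a P" and S: "open S" and N: "N holomorphic_on S"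
    and T: "\<And>z. z \<in> S \<Longrightarrow> (cmod (z - a))\<^sup>2 \<le> T"
    and ne: "\<And>z t. z \<in> S \<Longrightarrow> t \<in> {(cmod (z - a))\<^sup>2..T} \<Longrightarrow> of_real t \<noteq> N z"
  shows "wirtinger_on S (cauchy_transform a T P N)
     (\<lambda>z. - (P ((cmod (z - a))\<^sup>2) z * (z - a) / (of_real ((cmod (z - a))\<^sup>2) - N z)))"
proof -
  obtain c n and m :: "nat \<Rightarrow> nat" where
    P: "P = (\<lambda>t z. \<Sum>i<n. \<Sum>j\<le>m i. c i j * of_real t ^ j * (z - a) ^ i)"
    using P unfolding bipoly_def by blast
  define x where "x = (\<lambda>z::complex. complex_of_real ((cmod (z - a))\<^sup>2))"
  have "wirtinger_on S
      (\<lambda>z. \<Sum>i<n. \<Sum>j\<le>m i. (c i j * (z - a) ^ i) * cauchy_transform a T (\<lambda>t z. of_real t ^ j) N z)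
      (\<lambda>z. \<Sum>i<n. \<Sum>j\<le>m i. (c i j * (z - a) ^ i) * (- (x z ^ j * (z - a) / (x z - N z))))"
    unfolding x_def
    by (intro wirtinger_on_sum wirtinger_on_mult_holomorphic S holomorphic_intros
        wirtinger_on_cauchy_transform_power N T ne)
  then show ?thesis
  proof (rule wirtinger_on_cong[OF _ S])
    fix z assume z: "z \<in> S"
    let ?I = "{(cmod (z - a))\<^sup>2..T}"
    have "((\<lambda>t. of_real t ^ j / (of_real t - N z)) has_integral
          cauchy_transform a T (\<lambda>t z. of_real t ^ j) N z) ?I" for j
      unfolding cauchy_transform_def using ne[OF z]
      by (intro integrable_integral integrable_continuous_interval continuous_intros) auto
    then have "((\<lambda>t. \<Sum>i<n. \<Sum>j\<le>m i. (c i j * (z - a) ^ i) * (of_real t ^ j / (of_real t - N z)))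
       has_integral
       (\<Sum>i<n. \<Sum>j\<le>m i. (c i j * (z - a) ^ i) * cauchy_transform a T (\<lambda>t z. of_real t ^ j) N z)) ?I"
      by (intro has_integral_sum has_integral_mult_right) auto
    moreover have "(\<Sum>i<n. \<Sum>j\<le>m i. (c i j * (z - a) ^ i) * (of_real t ^ j / (of_real t - N z)))
        = P t z / (of_real t - N z)" for t
      unfolding P sum_divide_distrib by (intro sum.cong refl) (simp add: mult_ac)
    ultimately show "(\<Sum>i<n. \<Sum>j\<le>m i. (c i j * (z - a) ^ i) *
        cauchy_transform a T (\<lambda>t z. of_real t ^ j) N z) = cauchy_transform a T P N z"
      by (simp add: cauchy_transform_def integral_unique)
    show "(\<Sum>i<n. \<Sum>j\<le>m i. (c i j * (z - a) ^ i) * (- (x z ^ j * (z - a) / (x z - N z))))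
      = - (P ((cmod (z - a))\<^sup>2) z * (z - a) / (of_real ((cmod (z - a))\<^sup>2) - N z))"
      unfolding P x_def sum_divide_distrib sum_distrib_right sum_negf[symmetric]
      by (intro sum.cong refl) (simp add: mult_ac)
  qed
qed

section \<open>Holomorphic extensions from circles\<close>

lemma polynomial_function_real_complex_eq_sum:
  fixes g :: "real \<Rightarrow> complex"
  assumes "polynomial_function g"
  shows "\<exists>c m. \<forall>t. g t = (\<Sum>j\<le>m. c j * of_real t ^ j)"
proof -
  have pr: "real_polynomial_function (\<lambda>t. Re (g t))" "real_polynomial_function (\<lambda>t. Im (g t))"
    using assms bounded_linear_Re bounded_linear_Im
    unfolding polynomial_function_def comp_def by blast+
  obtain c1 m1 c2 m2 where c: "\<And>t. Re (g t) = (\<Sum>j\<le>(m1::nat). c1 j * t ^ j)"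
      "\<And>t. Im (g t) = (\<Sum>j\<le>(m2::nat). c2 j * t ^ j)"
    using pr unfolding real_polynomial_function_iff_sum fun_eq_iff by metis
  define d1 where "d1 = (\<lambda>j. if j \<le> m1 then c1 j else 0)"
  define d2 where "d2 = (\<lambda>j. if j \<le> m2 then c2 j else 0)"
  have "Re (g t) = (\<Sum>j\<le>max m1 m2. d1 j * t ^ j)" for t
    unfolding c d1_def by (intro sum.mono_neutral_cong_left) auto
  moreover have "Im (g t) = (\<Sum>j\<le>max m1 m2. d2 j * t ^ j)" for t
    unfolding c d2_def by (intro sum.mono_neutral_cong_left) auto
  moreover have "g t = of_real (Re (g t)) + \<i> * of_real (Im (g t))" for t
    by (simp add: complex_eq_iff)
  ultimately have "g t = (\<Sum>j\<le>max m1 m2. (of_real (d1 j) + \<i> * of_real (d2 j)) * of_real t ^ j)" for t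
    by (simp add: sum.distrib sum_distrib_left algebra_simps)
  then show ?thesis
    by (intro exI[of _ "\<lambda>j. of_real (d1 j) + \<i> * of_real (d2 j)"] exI[of _ "max m1 m2"] allI)
qed

text \<open>The Taylor polynomials of \<open>Q r\<close> need not converge up to the unit circle, so
  \<open>Q r \<xi>\<close> is first replaced by \<open>Q r (\<sigma> * \<xi>)\<close> with
  \<open>\<sigma> < 1\<close>. Uniform continuity makes this dilation harmless, and Cauchy's bound
  \<open>M\<close> on all coefficients gives geometric convergence after it, at the same rate for
  every \<open>r\<close>.\<close>

lemma holomorphic_family_taylor_approx:
  fixes Q :: "real \<Rightarrow> complex \<Rightarrow> complex"
  assumes K: "compact K" and cont: "continuous_on (K \<times> cball 0 1) (\<lambda>(r, \<xi>). Q r \<xi>)"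
    and hol: "\<And>r. r \<in> K \<Longrightarrow> Q r holomorphic_on ball 0 1" and e: "e > 0"
  shows "\<exists>c n. (\<forall>i. continuous_on K (c i)) \<and>
    (\<forall>r\<in>K. \<forall>\<xi>\<in>cball 0 1. cmod (Q r \<xi> - (\<Sum>i<(n::nat). c i r * \<xi> ^ i)) < e)"
proof -
  have cK: "compact (K \<times> cball (0::complex) 1)"
    using K by (intro compact_Times) auto
  have uc: "uniformly_continuous_on (K \<times> cball 0 1) (\<lambda>(r, \<xi>). Q r \<xi>)"
    by (rule compact_uniformly_continuous[OF cont cK])
  have "bounded ((\<lambda>(r, \<xi>). Q r \<xi>) ` (K \<times> cball 0 1))"
    using compact_continuous_image[OF cont cK] by (rule compact_imp_bounded)
  then obtain M where M: "M > 0" "\<And>r \<xi>. r \<in> K \<Longrightarrow> \<xi> \<in> cball 0 1 \<Longrightarrow> cmod (Q r \<xi>) \<le> M"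
    unfolding bounded_pos by fastforce
  have contQ: "continuous_on (cball 0 1) (Q r)" if "r \<in> K" for r
  proof -
    have "continuous_on (cball 0 1) (\<lambda>\<xi>::complex. (r, \<xi>))"
      by (intro continuous_intros)
    from continuous_on_compose2[OF cont this] that show ?thesis by auto
  qed
  define q where "q = (\<lambda>n r. (deriv ^^ n) (Q r) 0 / fact n)"
  have q_le: "cmod (q n r) \<le> M" if "r \<in> K" for n r
    using Cauchy_inequality[OF hol[OF that] contQ[OF that], of M n] M(2)[OF that]
    by (simp add: q_def norm_divide pos_divide_le_eq mult.commute)
  have q_cont: "continuous_on K (q n)" for n
    unfolding continuous_on_iff
  proof (intro ballI allI impI)
    fix r and e :: real assume r: "r \<in> K" and e: "e > 0"
    obtain d where d: "d > 0" and dd: "\<And>x x'. x \<in> K \<times> cball 0 1 \<Longrightarrow> x' \<in> K \<times> cball (0::complex) 1 \<Longrightarrow>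
        dist x' x < d \<Longrightarrow> dist ((\<lambda>(r, \<xi>). Q r \<xi>) x') ((\<lambda>(r, \<xi>). Q r \<xi>) x) < e / 2"
      using uc e unfolding uniformly_continuous_on_def by (meson half_gt_zero)
    have "dist (q n r') (q n r) < e" if r': "r' \<in> K" "dist r' r < d" for r'
    proof -
      have "(deriv ^^ n) (\<lambda>w. Q r' w - Q r w) 0 = (deriv ^^ n) (Q r') 0 - (deriv ^^ n) (Q r) 0"
        by (rule higher_deriv_diff[OF hol[OF r'(1)] hol[OF r]]) auto
      moreover have "cmod ((deriv ^^ n) (\<lambda>w. Q r' w - Q r w) 0) \<le> fact n * (e/2) / 1 ^ n"
      proof (rule Cauchy_inequality)
        show "(\<lambda>w. Q r' w - Q r w) holomorphic_on ball 0 1"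
          by (intro holomorphic_intros hol r r')
        show "continuous_on (cball 0 1) (\<lambda>w. Q r' w - Q r w)"
          by (intro continuous_intros contQ r r')
        show "cmod (Q r' x - Q r x) \<le> e/2" if "cmod (0 - x) = 1" for x
          using dd[of "(r, x)" "(r', x)"] r r' that by (simp add: dist_Pair_Pair dist_norm)
      qed auto
      ultimately have "cmod (q n r' - q n r) \<le> e/2"
        by (simp add: q_def norm_divide pos_divide_le_eq mult.commute flip: diff_divide_distrib)
      then show ?thesis using e by (simp add: dist_norm)
    qed
    then show "\<exists>d>0. \<forall>r'\<in>K. dist r' r < d \<longrightarrow> dist (q n r') (q n r) < e"
      using d by blast
  qed
  obtain d where d: "d > 0" and dd: "\<And>x x'. x \<in> K \<times> cball 0 1 \<Longrightarrow> x' \<in> K \<times> cball (0::complex) 1 \<Longrightarrow>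
        dist x' x < d \<Longrightarrow> dist ((\<lambda>(r, \<xi>). Q r \<xi>) x') ((\<lambda>(r, \<xi>). Q r \<xi>) x) < e / 2"
    using uc e unfolding uniformly_continuous_on_def by (meson half_gt_zero)
  \<comment> \<open>Then \<open>\<xi>\<close> and \<open>\<sigma> * \<xi>\<close> are at distance at
    most \<open>1 - \<sigma> < d\<close>, while the lower bound 1/2 keeps \<open>\<sigma>\<close>
    positive.\<close>
  define \<sigma> where "\<sigma> = max (1/2) (1 - d/2)"
  have \<sigma>: "0 < \<sigma>" "\<sigma> < 1" "1 - \<sigma> < d" using d by (auto simp: \<sigma>_def)
  have "(\<lambda>n. M / (1 - \<sigma>) * \<sigma> ^ n) \<longlonglongrightarrow> M / (1 - \<sigma>) * 0"
    using \<sigma> by (intro tendsto_mult tendsto_const LIMSEQ_power_zero) auto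
  then have "eventually (\<lambda>n. M / (1 - \<sigma>) * \<sigma> ^ n < e / 2) sequentially"
    using e by (intro order_tendstoD) auto
  then obtain n where n: "M / (1 - \<sigma>) * \<sigma> ^ n < e / 2"
    by (auto simp: eventually_sequentially)
  have "cmod (Q r \<xi> - (\<Sum>i<n. (q i r * of_real \<sigma> ^ i) * \<xi> ^ i)) < e"
    if r: "r \<in> K" and \<xi>: "\<xi> \<in> cball 0 1" for r \<xi>
  proof -
    let ?w = "of_real \<sigma> * \<xi>"
    have nw: "cmod ?w \<le> \<sigma>" using \<xi> \<sigma> by (simp add: norm_mult mult_left_le)
    have "dist \<xi> ?w = cmod (of_real (1 - \<sigma>) * \<xi>)"
      by (simp add: dist_norm algebra_simps)
    also have "\<dots> \<le> 1 - \<sigma>" using \<xi> \<sigma> by (simp only: norm_mult norm_of_real) (simp add: mult_left_le)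
    finally have "dist \<xi> ?w < d" using \<sigma> by simp
    then have 1: "cmod (Q r \<xi> - Q r ?w) < e / 2"
      using dd[of "(r, ?w)" "(r, \<xi>)"] r \<xi> nw \<sigma> by (simp add: dist_Pair_Pair dist_norm)
    have "(\<lambda>i. (deriv ^^ i) (Q r) 0 / fact i * (?w - 0) ^ i) sums Q r ?w"
      by (rule holomorphic_power_series[OF hol[OF r]]) (use nw \<sigma> in auto)
    then have "(\<lambda>i. q i r * ?w ^ i) sums Q r ?w" by (simp add: q_def)
    then have s1: "(\<lambda>i. q (i + n) r * ?w ^ (i + n)) sums (Q r ?w - (\<Sum>i<n. q i r * ?w ^ i))"
      by (rule sums_split_initial_segment)
    have s2: "(\<lambda>i. M * \<sigma> ^ n * \<sigma> ^ i) sums (M * \<sigma> ^ n * (1 / (1 - \<sigma>)))"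
      using \<sigma> by (intro sums_mult geometric_sums) auto
    have "cmod (Q r ?w - (\<Sum>i<n. q i r * ?w ^ i)) \<le> M * \<sigma> ^ n * (1 / (1 - \<sigma>))"
    proof (rule norm_sums_le[OF s1 s2])
      fix i
      have "cmod (q (i + n) r * ?w ^ (i + n)) \<le> M * \<sigma> ^ (i + n)"
        unfolding norm_mult norm_power
        using q_le[OF r] nw M \<sigma> by (intro mult_mono power_mono) (auto simp: norm_mult)
      then show "cmod (q (i + n) r * ?w ^ (i + n)) \<le> M * \<sigma> ^ n * \<sigma> ^ i"
        by (simp add: power_add mult_ac)
    qed
    also have "\<dots> < e / 2" using n by simp
    finally have "cmod (Q r ?w - (\<Sum>i<n. q i r * ?w ^ i)) < e / 2" .
    moreover have "(\<Sum>i<n. q i r * ?w ^ i) = (\<Sum>i<n. (q i r * of_real \<sigma> ^ i) * \<xi> ^ i)"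
      by (simp add: power_mult_distrib mult_ac)
    ultimately show ?thesis
      using 1 norm_triangle_lt[of "Q r \<xi> - Q r ?w" "Q r ?w - (\<Sum>i<n. q i r * ?w ^ i)" e] by simp
  qed
  moreover have "continuous_on K (\<lambda>r. q i r * of_real \<sigma> ^ i)" for i
    by (intro continuous_intros q_cont)
  ultimately show ?thesis
    by (intro exI[of _ "\<lambda>i r. q i r * of_real \<sigma> ^ i"] exI[of _ n]) blast
qed

text \<open>The parameter \<open>t\<close> is the squared radius, which is also the parameter of the
  ray in \<open>M_surf\<close>: on the circle where \<open>|z - a|\<close> has square
  \<open>t\<close>, the point \<open>t / (z - a) + cnj a\<close> is \<open>cnj z\<close>.\<close>

definition circle_ext :: "(complex \<Rightarrow> complex) \<Rightarrow> complex \<Rightarrow> real \<Rightarrow> complex \<Rightarrow> complex" where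
  "circle_ext f a t = (SOME g. continuous_on (cball a (sqrt t)) g \<and> g holomorphic_on ball a (sqrt t) \<and>
     (\<forall>z\<in>sphere a (sqrt t). g z = f z))"

lemma circle_ext:
  assumes "f \<in> circle_ext_funs X" "a \<in> X" "t > 0"
  shows "continuous_on (cball a (sqrt t)) (circle_ext f a t)"
    "circle_ext f a t holomorphic_on ball a (sqrt t)"
    "z \<in> sphere a (sqrt t) \<Longrightarrow> circle_ext f a t z = f z"
proof -
  have "hol_ext_on_circle f a (sqrt t)"
    using assms unfolding circle_ext_funs_def by auto
  then have "\<exists>g. continuous_on (cball a (sqrt t)) g \<and> g holomorphic_on ball a (sqrt t) \<and>
     (\<forall>z\<in>sphere a (sqrt t). g z = f z)"
    unfolding hol_ext_on_circle_def .
  from someI_ex[OF this] show "continuous_on (cball a (sqrt t)) (circle_ext f a t)"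
    "circle_ext f a t holomorphic_on ball a (sqrt t)"
    "z \<in> sphere a (sqrt t) \<Longrightarrow> circle_ext f a t z = f z"
    unfolding circle_ext_def by auto
qed

text \<open>Rescaled to the unit disc, the extensions for all radii share one domain. Here
  \<open>r\<close> is the radius itself.\<close>

definition disc_ext :: "(complex \<Rightarrow> complex) \<Rightarrow> complex \<Rightarrow> real \<Rightarrow> complex \<Rightarrow> complex" where
  "disc_ext f a r \<xi> = circle_ext f a (r\<^sup>2) (a + of_real r * \<xi>)"

lemma circle_ext_eq_disc_ext:
  assumes "t > 0"
  shows "circle_ext f a t z = disc_ext f a (sqrt t) ((z - a) / of_real (sqrt t))"
  using assms by (simp add: disc_ext_def)

lemma disc_ext:
  assumes "f \<in> circle_ext_funs X" "a \<in> X" "r > 0"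
  shows "continuous_on (cball 0 1) (disc_ext f a r)"
    "disc_ext f a r holomorphic_on ball 0 1"
    "\<xi> \<in> sphere 0 1 \<Longrightarrow> disc_ext f a r \<xi> = f (a + of_real r * \<xi>)"
proof -
  have r2: "r\<^sup>2 > 0" "sqrt (r\<^sup>2) = r" using assms(3) by auto
  note ce = circle_ext[OF assms(1,2) r2(1), unfolded r2(2)]
  show "continuous_on (cball 0 1) (disc_ext f a r)"
    unfolding disc_ext_def
    by (rule continuous_on_compose2[OF ce(1)])
      (use assms in \<open>auto intro!: continuous_intros simp: dist_norm norm_mult mult_left_le\<close>)
  have "circle_ext f a (r\<^sup>2) \<circ> (\<lambda>\<xi>. a + of_real r * \<xi>) holomorphic_on ball 0 1"
    by (rule holomorphic_on_compose_gen[OF _ ce(2)])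
      (use assms in \<open>auto intro!: holomorphic_intros simp: dist_norm norm_mult\<close>)
  then show "disc_ext f a r holomorphic_on ball 0 1"
    unfolding disc_ext_def comp_def .
  show "\<xi> \<in> sphere 0 1 \<Longrightarrow> disc_ext f a r \<xi> = f (a + of_real r * \<xi>)"
    unfolding disc_ext_def using assms by (intro ce(3)) (auto simp: dist_norm norm_mult)
qed

text \<open>The boundary values \<open>f (a + r * \<xi>)\<close> are uniformly continuous in both
  variables. For two nearby radii the difference of the extensions is holomorphic, so the maximum
  modulus principle carries its smallness from the circle into the disc; what remains is the
  continuity of a single extension.\<close>

lemma continuous_on_disc_ext:
  assumes f: "f \<in> circle_ext_funs X" and a: "a \<in> X" and r1: "r1 > 0"
  shows "continuous_on ({r1..r2} \<times> cball 0 1) (\<lambda>(r, \<xi>). disc_ext f a r \<xi>)"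
proof -
  have fc: "continuous_on UNIV f" using f by (simp add: circle_ext_funs_def)
  note de = disc_ext[OF f a]
  have "continuous_on ({r1..r2} \<times> sphere 0 1) (\<lambda>(r, \<xi>). f (a + of_real r * \<xi>))"
    unfolding split_beta by (intro continuous_on_compose2[OF fc] continuous_intros) auto
  then have uc: "uniformly_continuous_on ({r1..r2} \<times> sphere 0 1) (\<lambda>(r, \<xi>). f (a + of_real r * \<xi>))"
    by (rule compact_uniformly_continuous) (intro compact_Times compact_Icc compact_sphere)
  show ?thesis
    unfolding continuous_on_iff
  proof (intro ballI allI impI)
    fix x and e :: real assume x: "x \<in> {r1..r2} \<times> cball (0::complex) 1" and e: "e > 0"
    obtain r \<xi> where rx: "x = (r, \<xi>)" "r \<in> {r1..r2}" "\<xi> \<in> cball 0 1" using x by auto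
    obtain d where d: "d > 0" and dd: "\<And>x x'. x \<in> {r1..r2} \<times> sphere 0 1 \<Longrightarrow> x' \<in> {r1..r2} \<times> sphere 0 1 \<Longrightarrow>
        dist x' x < d \<Longrightarrow> dist ((\<lambda>(r, \<xi>). f (a + of_real r * \<xi>)) x') ((\<lambda>(r, \<xi>). f (a + of_real r * \<xi>)) x) < e / 2"
      using uc e unfolding uniformly_continuous_on_def by (meson half_gt_zero)
    have r0: "r > 0" using rx r1 by auto
    obtain d' where d': "d' > 0" and dd': "\<And>\<xi>'. \<xi>' \<in> cball 0 1 \<Longrightarrow> dist \<xi>' \<xi> < d' \<Longrightarrow>
        dist (disc_ext f a r \<xi>') (disc_ext f a r \<xi>) < e / 2"
      using de(1)[OF r0] rx(3) e unfolding continuous_on_iff by (meson half_gt_zero)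
    have "dist (disc_ext f a r' \<xi>') (disc_ext f a r \<xi>) < e"
      if r': "r' \<in> {r1..r2}" "\<xi>' \<in> cball 0 1" and dist: "dist (r', \<xi>') (r, \<xi>) < min d d'" for r' \<xi>'
    proof -
      have r'0: "r' > 0" using r' r1 by auto
      have dr: "dist r' r < d" "dist \<xi>' \<xi> < d'"
        using dist by (auto intro: le_less_trans[OF dist_fst_le] le_less_trans[OF dist_snd_le]
             dest: le_less_trans[OF dist_fst_le[of "(r', \<xi>')" "(r, \<xi>)", simplified]]
              le_less_trans[OF dist_snd_le[of "(r', \<xi>')" "(r, \<xi>)", simplified]])
      have "cmod (disc_ext f a r' \<xi>' - disc_ext f a r \<xi>') \<le> e / 2"
      proof (rule maximum_modulus_frontier[where S = "cball 0 1" and f = "\<lambda>w. disc_ext f a r' w - disc_ext f a r w"])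
        show "(\<lambda>w. disc_ext f a r' w - disc_ext f a r w) holomorphic_on interior (cball 0 1)"
          using de(2)[OF r0] de(2)[OF r'0] by (auto intro!: holomorphic_intros)
        show "continuous_on (closure (cball 0 1)) (\<lambda>w. disc_ext f a r' w - disc_ext f a r w)"
          using de(1)[OF r0] de(1)[OF r'0] by (auto intro!: continuous_intros)
        show "cmod (disc_ext f a r' w - disc_ext f a r w) \<le> e / 2" if "w \<in> frontier (cball 0 1)" for w
          using dd[of "(r, w)" "(r', w)"] rx r' that dr de(3)[OF r0, of w] de(3)[OF r'0, of w]
          by (simp add: dist_Pair_Pair dist_norm)
      qed (use r' in auto)
      moreover have "cmod (disc_ext f a r \<xi>' - disc_ext f a r \<xi>) < e / 2"
        using dd'[OF r'(2) dr(2)] by (simp add: dist_norm)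
      ultimately show ?thesis
        using norm_triangle_lt[of "disc_ext f a r' \<xi>' - disc_ext f a r \<xi>'" "disc_ext f a r \<xi>' - disc_ext f a r \<xi>" e]
        by (simp add: dist_norm)
    qed
    then show "\<exists>d>0. \<forall>x'\<in>{r1..r2} \<times> cball 0 1. dist x' x < d \<longrightarrow>
        dist ((\<lambda>(r, \<xi>). disc_ext f a r \<xi>) x') ((\<lambda>(r, \<xi>). disc_ext f a r \<xi>) x) < e"
      using d d' rx by (intro exI[of _ "min d d'"]) auto
  qed
qed

lemma continuous_on_circle_ext:
  assumes f: "f \<in> circle_ext_funs X" and a: "a \<in> X" and z: "z \<noteq> a"
  shows "continuous_on {(cmod (z - a))\<^sup>2..T} (\<lambda>t. circle_ext f a t z)"
proof -
  let ?I = "{(cmod (z - a))\<^sup>2..T}"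
  have pos: "t > 0" if "t \<in> ?I" for t
    using that z by (smt (verit) atLeastAtMost_iff right_minus_eq zero_less_norm_iff zero_less_power)
  have sq: "cmod (z - a) \<le> sqrt t" "sqrt t \<le> sqrt T" if "t \<in> ?I" for t
    using that by (auto simp: real_le_rsqrt)
  have "continuous_on ?I (\<lambda>t. (sqrt t, (z - a) / of_real (sqrt t)))"
    using pos by (intro continuous_intros) fastforce
  from continuous_on_compose2[OF continuous_on_disc_ext[OF f a, of "cmod (z - a)" "sqrt T"] this]
  have "continuous_on ?I (\<lambda>t. (\<lambda>(r, \<xi>). disc_ext f a r \<xi>) (sqrt t, (z - a) / of_real (sqrt t)))"
    using z sq pos by (force simp: norm_divide divide_le_eq)
  moreover have "(\<lambda>(r, \<xi>). disc_ext f a r \<xi>) (sqrt t, (z - a) / of_real (sqrt t)) = circle_ext f a t z"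
    if "t \<in> ?I" for t
    using circle_ext_eq_disc_ext[OF pos[OF that]] by simp
  ultimately show ?thesis by (metis (no_types, lifting) continuous_on_cong)
qed

text \<open>Taylor approximation in \<open>\<xi> = (z - a) / sqrt t\<close> gives
  \<open>(z - a) ^ i\<close> the coefficient \<open>c i (sqrt t) / sqrt t ^ i\<close>, continuous in
  \<open>t\<close> away from 0. Weierstrass approximation turns these coefficients into polynomials
  in \<open>t\<close>.\<close>

lemma circle_ext_bipoly_approx:
  assumes f: "f \<in> circle_ext_funs X" and a: "a \<in> X" and t1: "t1 > 0" and e: "e > 0"
  shows "\<exists>P. bipoly a P \<and> (\<forall>t\<in>{t1..T}. \<forall>z. cmod (z - a) \<le> sqrt t \<longrightarrow> cmod (circle_ext f a t z - P t z) < e)"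
proof -
  define r1 where "r1 = sqrt t1"
  have r1: "r1 > 0" using t1 by (simp add: r1_def)
  have hol: "disc_ext f a r holomorphic_on ball 0 1" if "r \<in> {r1..sqrt T}" for r
    using disc_ext(2)[OF f a, of r] that r1 by auto
  have e2: "e / 2 > 0" using e by simp
  obtain c n where cc: "\<forall>i. continuous_on {r1..sqrt T} (c i)"
    and ccn: "\<forall>r\<in>{r1..sqrt T}. \<forall>\<xi>\<in>cball 0 1.
      cmod (disc_ext f a r \<xi> - (\<Sum>i<(n::nat). c i r * \<xi> ^ i)) < e / 2"
    using holomorphic_family_taylor_approx[OF compact_Icc continuous_on_disc_ext[OF f a r1]
        hol e2, of "sqrt T"] by blast
  have c: "continuous_on {r1..sqrt T} (c i)" for i using cc by blast
  have cn: "cmod (disc_ext f a r \<xi> - (\<Sum>i<n. c i r * \<xi> ^ i)) < e / 2"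
    if "r \<in> {r1..sqrt T}" "\<xi> \<in> cball 0 1" for r \<xi> using ccn that by blast
  define R where "R = max 1 (sqrt T)"
  have R: "R \<ge> 1" by (simp add: R_def)
  define e' where "e' = e / (2 * (real n + 1) * R ^ n)"
  have Rn: "R ^ n > 0" using R by simp
  have e': "e' > 0" using e Rn by (simp add: e'_def)
  have "\<forall>i. \<exists>g d m. (\<forall>t\<in>{t1..T}. cmod (c i (sqrt t) / of_real (sqrt t) ^ i - g t) < e') \<and>
      (\<forall>t. g t = (\<Sum>j\<le>(m::nat). d j * complex_of_real t ^ j))"
  proof
    fix i
    have "continuous_on {t1..T} (\<lambda>t. c i (sqrt t) / of_real (sqrt t) ^ i)"
      using t1 by (intro continuous_intros continuous_on_compose2[OF c]) (auto simp: r1_def)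
    from Stone_Weierstrass_polynomial_function[OF compact_Icc this e']
    obtain g where g: "polynomial_function g"
        "\<forall>t\<in>{t1..T}. cmod (c i (sqrt t) / of_real (sqrt t) ^ i - g t) < e'" by blast
    with polynomial_function_real_complex_eq_sum[OF g(1)] show "\<exists>g d m.
      (\<forall>t\<in>{t1..T}. cmod (c i (sqrt t) / of_real (sqrt t) ^ i - g t) < e') \<and>
      (\<forall>t. g t = (\<Sum>j\<le>(m::nat). d j * complex_of_real t ^ j))" by blast
  qed
  then obtain g d m where g: "\<And>i t. t \<in> {t1..T} \<Longrightarrow> cmod (c i (sqrt t) / of_real (sqrt t) ^ i - g i t) < e'"
     and d: "\<And>i t. g i t = (\<Sum>j\<le>(m i::nat). d i j * complex_of_real t ^ j)" by metis
  define P where "P = (\<lambda>t z. \<Sum>i<n. \<Sum>j\<le>m i. d i j * complex_of_real t ^ j * (z - a) ^ i)"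
  have Pg: "P t z = (\<Sum>i<n. g i t * (z - a) ^ i)" for t z
    by (simp add: P_def d sum_distrib_right)
  have "cmod (circle_ext f a t z - P t z) < e" if t: "t \<in> {t1..T}" and z: "cmod (z - a) \<le> sqrt t" for t z
  proof -
    have t0: "t > 0" and st: "sqrt t > 0" "sqrt t \<in> {r1..sqrt T}" using t t1 by (auto simp: r1_def)
    let ?\<xi> = "(z - a) / of_real (sqrt t)"
    have "cmod (circle_ext f a t z - (\<Sum>i<n. c i (sqrt t) * ?\<xi> ^ i)) < e / 2"
      unfolding circle_ext_eq_disc_ext[OF t0]
      by (rule cn) (use st z in \<open>auto simp: norm_divide divide_le_eq\<close>)
    moreover have "cmod ((\<Sum>i<n. c i (sqrt t) * ?\<xi> ^ i) - P t z) \<le> e / 2"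
    proof -
      have "(\<Sum>i<n. c i (sqrt t) * ?\<xi> ^ i) - P t z =
          (\<Sum>i<n. (c i (sqrt t) / of_real (sqrt t) ^ i - g i t) * (z - a) ^ i)"
        by (simp add: Pg sum_subtractf power_divide algebra_simps)
      also have "cmod \<dots> \<le> (\<Sum>i<n. e' * R ^ n)"
      proof (rule sum_norm_le)
        fix i assume i: "i \<in> {..<n}"
        have "sqrt t \<le> R" using t by (auto simp: R_def intro: max.coboundedI2)
        then have "cmod (z - a) \<le> R" using z by simp
        then have "cmod (z - a) ^ i \<le> R ^ i" by (intro power_mono) auto
        also have "\<dots> \<le> R ^ n" using i R by (intro power_increasing) auto
        finally show "cmod ((c i (sqrt t) / of_real (sqrt t) ^ i - g i t) * (z - a) ^ i) \<le> e' * R ^ n"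
          unfolding norm_mult norm_power using g[OF t, of i] e'
          by (intro mult_mono) auto
      qed
      also have "\<dots> = real n * (e' * R ^ n)" by simp
      also have "e' * R ^ n = e / (2 * (real n + 1))" using Rn R by (simp add: e'_def)
      also have "real n * (e / (2 * (real n + 1))) \<le> e / 2" using e by (simp add: field_simps)
      finally show ?thesis .
    qed
    ultimately show ?thesis
      using norm_triangle_lt[of "circle_ext f a t z - (\<Sum>i<n. c i (sqrt t) * ?\<xi> ^ i)"
          "(\<Sum>i<n. c i (sqrt t) * ?\<xi> ^ i) - P t z" e] by simp
  qed
  moreover have "bipoly a P" unfolding bipoly_def P_def by blast
  ultimately show ?thesis by blast
qed

section \<open>Cauchy transforms of the extensions\<close>

lemma circle_ext_norm_square:
  assumes "f \<in> circle_ext_funs X" "a \<in> X" "z \<noteq> a"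
  shows "circle_ext f a ((cmod (z - a))\<^sup>2) z = f z"
  using circle_ext(3)[OF assms(1,2), of "(cmod (z - a))\<^sup>2" z] assms(3)
  by (simp add: dist_norm norm_minus_commute)

text \<open>Over the compact set \<open>D\<close> the kernel is bounded, so a uniform error
  \<open>e\<close> in the extension costs at most a fixed multiple of \<open>e\<close> in the
  transform. The constant is chosen before \<open>e\<close>, which later allows \<open>e\<close> to
  tend to 0.\<close>

lemma cauchy_transform_circle_ext_approx:
  assumes f: "f \<in> circle_ext_funs X" and a: "a \<in> X" and D: "compact D" "D \<noteq> {}"
    and N: "continuous_on D N"
    and za: "\<And>z. z \<in> D \<Longrightarrow> z \<noteq> a" and T: "\<And>z. z \<in> D \<Longrightarrow> (cmod (z - a))\<^sup>2 \<le> T"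
    and ne: "\<And>z t. z \<in> D \<Longrightarrow> t \<in> {(cmod (z - a))\<^sup>2..T} \<Longrightarrow> of_real t \<noteq> N z"
  shows "\<exists>C\<ge>0. \<forall>e>0. \<exists>P. bipoly a P \<and> (\<forall>z\<in>D.
     cmod (cauchy_transform a T (circle_ext f a) N z - cauchy_transform a T P N z) \<le> C * e \<and>
     cmod (f z - P ((cmod (z - a))\<^sup>2) z) \<le> e)"
proof -
  have cx: "continuous_on D (\<lambda>z. (cmod (z - a))\<^sup>2)" by (intro continuous_intros)
  obtain z1 where z1: "z1 \<in> D" "\<And>z. z \<in> D \<Longrightarrow> (cmod (z1 - a))\<^sup>2 \<le> (cmod (z - a))\<^sup>2"
    using continuous_attains_inf[OF D cx] by blast
  define t1 where "t1 = (cmod (z1 - a))\<^sup>2"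
  have t1: "t1 > 0" using za[OF z1(1)] by (simp add: t1_def)
  have t1le: "t1 \<le> (cmod (z - a))\<^sup>2" if "z \<in> D" for z using z1(2)[OF that] by (simp add: t1_def)
  have T0: "T > 0" using T[OF z1(1)] t1 unfolding t1_def by linarith
  \<comment> \<open>The pairs \<open>(t, z)\<close> at which the kernel is evaluated. They form a
    compact set, so the denominator has a positive minimum \<open>m\<close> on it.\<close>
  define E where "E = ({t1..T} \<times> D) \<inter> {p. (cmod (snd p - a))\<^sup>2 \<le> fst p}"
  have "(t1, z1) \<in> E" using z1(1) T[OF z1(1)] by (simp add: E_def t1_def)
  then have "E \<noteq> {}" by blast
  moreover have "compact E" unfolding E_def
    by (intro compact_Int_closed compact_Times compact_Icc D closed_Collect_le continuous_intros)
  moreover have "continuous_on E (\<lambda>p. cmod (of_real (fst p) - N (snd p)))"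
    by (intro continuous_intros continuous_on_compose2[OF N]) (auto simp: E_def)
  ultimately obtain p where p: "p \<in> E" "\<And>p'. p' \<in> E \<Longrightarrow>
      cmod (of_real (fst p) - N (snd p)) \<le> cmod (of_real (fst p') - N (snd p'))"
    using continuous_attains_inf by meson
  define m where "m = cmod (of_real (fst p) - N (snd p))"
  have m: "m > 0" using p(1) ne[of "snd p" "fst p"] by (auto simp: m_def E_def)
  have mle: "m \<le> cmod (of_real t - N z)" if "z \<in> D" "t \<in> {(cmod (z - a))\<^sup>2..T}" for z t
    using p(2)[of "(t, z)"] that t1le[OF that(1)] by (auto simp: m_def E_def)
  have main: "\<exists>P. bipoly a P \<and> (\<forall>z\<in>D.
     cmod (cauchy_transform a T (circle_ext f a) N z - cauchy_transform a T P N z) \<le> T / m * e \<and>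
     cmod (f z - P ((cmod (z - a))\<^sup>2) z) \<le> e)" if e: "e > 0" for e
  proof -
    obtain P where P: "bipoly a P"
      "\<And>t z. t \<in> {t1..T} \<Longrightarrow> cmod (z - a) \<le> sqrt t \<Longrightarrow> cmod (circle_ext f a t z - P t z) < e"
      using circle_ext_bipoly_approx[OF f a t1 e, of T] by blast
    have "cmod (cauchy_transform a T (circle_ext f a) N z - cauchy_transform a T P N z) \<le> T / m * e \<and>
     cmod (f z - P ((cmod (z - a))\<^sup>2) z) \<le> e" if z: "z \<in> D" for z
    proof -
      let ?x = "(cmod (z - a))\<^sup>2"
      have lt: "cmod (circle_ext f a t z - P t z) < e" if "t \<in> {?x..T}" for t
        using that t1le[OF z] by (intro P(2)) (auto simp: real_le_rsqrt)
      have 2: "cmod (f z - P ?x z) \<le> e"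
        using lt[of ?x] T[OF z] circle_ext_norm_square[OF f a za[OF z]] by simp
      have iP: "(\<lambda>t. P t z / (of_real t - N z)) integrable_on {?x..T}"
      proof -
        obtain c n and l :: "nat \<Rightarrow> nat" where
          Pe: "P = (\<lambda>t z. \<Sum>i<n. \<Sum>j\<le>l i. c i j * of_real t ^ j * (z - a) ^ i)"
          using P(1) unfolding bipoly_def by blast
        show ?thesis unfolding Pe using ne[OF z]
          by (intro integrable_continuous_interval continuous_intros) auto
      qed
      have iF: "(\<lambda>t. circle_ext f a t z / (of_real t - N z)) integrable_on {?x..T}"
        using ne[OF z] by (intro integrable_continuous_interval continuous_intros
            continuous_on_circle_ext[OF f a za[OF z]]) auto
      have "cmod (integral {?x..T} (\<lambda>t. circle_ext f a t z / (of_real t - N z) - P t z / (of_real t - N z)))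
          \<le> e / m * measure lborel (cbox ?x T)"
        unfolding cbox_interval[symmetric]
      proof (rule integrable_bound)
        show "0 \<le> e / m" using e m by simp
        show "(\<lambda>t. circle_ext f a t z / (of_real t - N z) - P t z / (of_real t - N z)) integrable_on cbox ?x T"
          unfolding cbox_interval by (intro integrable_diff iF iP)
        show "cmod (circle_ext f a t z / (of_real t - N z) - P t z / (of_real t - N z)) \<le> e / m"
          if "t \<in> cbox ?x T" for t
          unfolding diff_divide_distrib[symmetric] norm_divide
          using lt[of t] mle[OF z, of t] that m e by (intro frac_le) auto
      qed
      also have "\<dots> \<le> e / m * T" using T[OF z] e m T0 by (intro mult_left_mono) auto
      finally show ?thesis using 2
        unfolding cauchy_transform_def integral_diff[OF iF iP, symmetric] by (simp add: mult_ac)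
    qed
    then show ?thesis using P(1) by blast
  qed
  show ?thesis using main T0 m by (intro exI[of _ "T / m"]) auto
qed

text \<open>For polynomial models \<open>P\<close> and \<open>Q\<close> the difference of the
  transforms has conjugate derivative \<open>(Q - P) / (cnj z - \<eta> z)\<close>, with
  \<open>P\<close> and \<open>Q\<close> taken at the origins of the rays. Both approximate
  \<open>f z\<close> there, so the derivative is small and the approximate maximum principle
  applies; then the approximation error tends to 0.\<close>

lemma cauchy_transform_diff_max_principle:
  assumes f: "f \<in> circle_ext_funs X" and a: "a \<in> X" and b: "b \<in> X"
    and S: "open S" "cball z' \<rho> \<subseteq> S" and \<rho>: "\<rho> > 0" and \<eta>: "\<eta> holomorphic_on S"
    and za: "\<And>z. z \<in> S \<Longrightarrow> z \<noteq> a" and Ta: "\<And>z. z \<in> S \<Longrightarrow> (cmod (z - a))\<^sup>2 \<le> Ta"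
    and nea: "\<And>z t. z \<in> S \<Longrightarrow> t \<in> {(cmod (z - a))\<^sup>2..Ta} \<Longrightarrow> of_real t \<noteq> (\<eta> z - cnj a) * (z - a)"
    and zb: "\<And>z. z \<in> S \<Longrightarrow> z \<noteq> b" and Tb: "\<And>z. z \<in> S \<Longrightarrow> (cmod (z - b))\<^sup>2 \<le> Tb"
    and neb: "\<And>z t. z \<in> S \<Longrightarrow> t \<in> {(cmod (z - b))\<^sup>2..Tb} \<Longrightarrow> of_real t \<noteq> (\<eta> z - cnj b) * (z - b)"
    and B: "\<And>z. z \<in> sphere z' \<rho> \<Longrightarrow>
      cmod (cauchy_transform a Ta (circle_ext f a) (\<lambda>z. (\<eta> z - cnj a) * (z - a)) z -
            cauchy_transform b Tb (circle_ext f b) (\<lambda>z. (\<eta> z - cnj b) * (z - b)) z) \<le> B"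
  shows "cmod (cauchy_transform a Ta (circle_ext f a) (\<lambda>z. (\<eta> z - cnj a) * (z - a)) z' -
            cauchy_transform b Tb (circle_ext f b) (\<lambda>z. (\<eta> z - cnj b) * (z - b)) z') \<le> B"
proof -
  define D where "D = cball z' \<rho>"
  have D: "compact D" "D \<noteq> {}" "D \<subseteq> S" using \<rho> S by (auto simp: D_def)
  define Na where "Na = (\<lambda>z. (\<eta> z - cnj a) * (z - a))"
  define Nb where "Nb = (\<lambda>z. (\<eta> z - cnj b) * (z - b))"
  have hN: "Na holomorphic_on S" "Nb holomorphic_on S"
    unfolding Na_def Nb_def by (intro holomorphic_intros \<eta>)+
  then have cN: "continuous_on D Na" "continuous_on D Nb"
    using D(3) by (auto intro: holomorphic_on_imp_continuous_on holomorphic_on_subset)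
  \<comment> \<open>At the origin of the ray the denominator has the factor \<open>z - a\<close>,
    which cancels the \<open>z - a\<close> coming from the derivative of the lower limit. The
    quotient that remains no longer contains the centre.\<close>
  have xNa: "of_real ((cmod (z - a))\<^sup>2) - Na z = (z - a) * (cnj z - \<eta> z)" for z
    unfolding Na_def complex_norm_square by (simp add: algebra_simps)
  have xNb: "of_real ((cmod (z - b))\<^sup>2) - Nb z = (z - b) * (cnj z - \<eta> z)" for z
    unfolding Nb_def complex_norm_square by (simp add: algebra_simps)
  have \<eta>ne: "cnj z - \<eta> z \<noteq> 0" if "z \<in> S" for z
    using nea[OF that, of "(cmod (z - a))\<^sup>2"] Ta[OF that] xNa[of z] by (auto simp: Na_def)
  have "continuous_on D (\<lambda>z. cmod (cnj z - \<eta> z))"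
    using \<eta> D(3) by (intro continuous_intros holomorphic_on_imp_continuous_on)
      (auto intro: holomorphic_on_subset)
  from continuous_attains_inf[OF D(1,2) this] obtain z2 where
    z2: "z2 \<in> D" "\<And>z. z \<in> D \<Longrightarrow> cmod (cnj z2 - \<eta> z2) \<le> cmod (cnj z - \<eta> z)" by blast
  define m where "m = cmod (cnj z2 - \<eta> z2)"
  have m: "m > 0" using \<eta>ne z2(1) D(3) by (auto simp: m_def)
  have mle: "m \<le> cmod (cnj z - \<eta> z)" if "z \<in> D" for z using z2(2)[OF that] by (simp add: m_def)
  let ?Fa = "cauchy_transform a Ta (circle_ext f a) Na"
  let ?Fb = "cauchy_transform b Tb (circle_ext f b) Nb"
  obtain Ca where Ca: "Ca \<ge> 0" "\<And>e. e > 0 \<Longrightarrow> \<exists>P. bipoly a P \<and> (\<forall>z\<in>D.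
     cmod (?Fa z - cauchy_transform a Ta P Na z) \<le> Ca * e \<and> cmod (f z - P ((cmod (z - a))\<^sup>2) z) \<le> e)"
    using cauchy_transform_circle_ext_approx[OF f a D(1,2) cN(1), of Ta] za Ta nea D(3)
    unfolding Na_def by blast
  obtain Cb where Cb: "Cb \<ge> 0" "\<And>e. e > 0 \<Longrightarrow> \<exists>P. bipoly b P \<and> (\<forall>z\<in>D.
     cmod (?Fb z - cauchy_transform b Tb P Nb z) \<le> Cb * e \<and> cmod (f z - P ((cmod (z - b))\<^sup>2) z) \<le> e)"
    using cauchy_transform_circle_ext_approx[OF f b D(1,2) cN(2), of Tb] zb Tb neb D(3)
    unfolding Nb_def by blast
  \<comment> \<open>In units of \<open>e\<close>: the distance \<open>Ca + Cb\<close> to the models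
    is paid once on the boundary and once at \<open>z'\<close>, and the last summand is the loss in
    the approximate maximum principle.\<close>
  define K where "K = 2 * Ca + 2 * Cb + 2 * \<rho> * (2 / m)"
  have K: "K > 0" using Ca Cb m \<rho> by (auto simp: K_def intro!: add_nonneg_pos)
  have bound: "cmod (?Fa z' - ?Fb z') \<le> B + K * e" if e: "e > 0" for e
  proof -
    obtain P where P: "bipoly a P" "\<And>z. z \<in> D \<Longrightarrow> cmod (?Fa z - cauchy_transform a Ta P Na z) \<le> Ca * e"
       "\<And>z. z \<in> D \<Longrightarrow> cmod (f z - P ((cmod (z - a))\<^sup>2) z) \<le> e" using Ca(2)[OF e] by blast
    obtain Q where Q: "bipoly b Q" "\<And>z. z \<in> D \<Longrightarrow> cmod (?Fb z - cauchy_transform b Tb Q Nb z) \<le> Cb * e"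
       "\<And>z. z \<in> D \<Longrightarrow> cmod (f z - Q ((cmod (z - b))\<^sup>2) z) \<le> e" using Cb(2)[OF e] by blast
    define h where "h = (\<lambda>z. cauchy_transform a Ta P Na z - cauchy_transform b Tb Q Nb z)"
    have "wirtinger_on S h (\<lambda>z.
        - (P ((cmod (z - a))\<^sup>2) z * (z - a) / (of_real ((cmod (z - a))\<^sup>2) - Na z))
        - (- (Q ((cmod (z - b))\<^sup>2) z * (z - b) / (of_real ((cmod (z - b))\<^sup>2) - Nb z))))"
      unfolding h_def
      by (intro wirtinger_on_diff wirtinger_on_cauchy_transform_bipoly P(1) Q(1) S(1) hN Ta Tb)
        (auto simp: Na_def Nb_def nea neb)
    then have w: "wirtinger_on S h (\<lambda>z. (Q ((cmod (z - b))\<^sup>2) z - P ((cmod (z - a))\<^sup>2) z) / (cnj z - \<eta> z))"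
    proof (rule wirtinger_on_cong[OF _ S(1) refl])
      fix z assume z: "z \<in> S"
      show "- (P ((cmod (z - a))\<^sup>2) z * (z - a) / (of_real ((cmod (z - a))\<^sup>2) - Na z))
        - (- (Q ((cmod (z - b))\<^sup>2) z * (z - b) / (of_real ((cmod (z - b))\<^sup>2) - Nb z)))
        = (Q ((cmod (z - b))\<^sup>2) z - P ((cmod (z - a))\<^sup>2) z) / (cnj z - \<eta> z)"
        unfolding xNa xNb using \<eta>ne[OF z] za[OF z] zb[OF z] by (simp add: divide_simps)
    qed
    have near: "cmod ((?Fa z - ?Fb z) - h z) \<le> (Ca + Cb) * e" if "z \<in> D" for z
      using norm_triangle_ineq4[of "?Fa z - cauchy_transform a Ta P Na z" "?Fb z - cauchy_transform b Tb Q Nb z"]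
        P(2)[OF that] Q(2)[OF that] by (simp add: h_def algebra_simps)
    have "cmod (h z') \<le> (B + (Ca + Cb) * e) + 2 * \<rho> * (2 * e / m)"
    proof (rule approx_maximum_principle[OF w S(2) \<rho>])
      fix z assume "z \<in> cball z' \<rho>"
      then have z: "z \<in> D" by (simp add: D_def)
      have "cmod (Q ((cmod (z - b))\<^sup>2) z - P ((cmod (z - a))\<^sup>2) z) \<le> 2 * e"
        using norm_triangle_ineq4[of "f z - P ((cmod (z - a))\<^sup>2) z" "f z - Q ((cmod (z - b))\<^sup>2) z"]
          P(3)[OF z] Q(3)[OF z] by simp
      then show "cmod ((Q ((cmod (z - b))\<^sup>2) z - P ((cmod (z - a))\<^sup>2) z) / (cnj z - \<eta> z)) \<le> 2 * e / m"
        unfolding norm_divide using mle[OF z] m e by (intro frac_le) auto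
    next
      fix z assume z: "z \<in> sphere z' \<rho>"
      then have "z \<in> D" by (auto simp: D_def)
      from near[OF this] B[OF z] show "cmod (h z) \<le> B + (Ca + Cb) * e"
        using norm_triangle_sub[of "h z" "?Fa z - ?Fb z"]
        unfolding Na_def[symmetric] Nb_def[symmetric] by (simp add: norm_minus_commute)
    qed
    moreover have "z' \<in> D" using \<rho> by (simp add: D_def)
    ultimately show ?thesis
      using norm_triangle_sub[of "?Fa z' - ?Fb z'" "h z'"] near[of z']
      by (simp add: K_def algebra_simps)
  qed
  have "cmod (?Fa z' - ?Fb z') \<le> B"
  proof (rule field_le_epsilon)
    fix e :: real assume "e > 0"
    then show "cmod (?Fa z' - ?Fb z') \<le> B + e"
      using bound[of "e / K"] K by simp
  qed
  then show ?thesis by (simp add: Na_def Nb_def)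
qed

section \<open>Parabolic discs behind a corner\<close>

text \<open>For \<open>\<xi> = u * (w - z)\<close> the expression is the position of the parabolic
  disc at \<open>w\<close> relative to the corner \<open>cnj w\<close>, in units of
  \<open>u\<close>; in these units the rays lie in the cone \<open>c * cmod Y \<le> Re Y\<close>.
  With \<open>x\<close> and \<open>y\<close> the parts of \<open>\<xi>\<close>, the real part is
  \<open>y^2 - x^2 - \<delta>\<close>, and the imaginary part \<open>2 * y * (1 - x)\<close> has
  modulus at least \<open>|y|\<close>; as \<open>|y| \<le> c / 2\<close>, the term
  \<open>y^2\<close> is too small for the cone. At \<open>\<delta> = 0\<close> the linear part alone
  would sit at the apex for every real \<open>\<xi>\<close>; the square moves these points behind
  it.\<close>

lemma parabolic_disc_avoids_cone:
  assumes c: "0 < c" "c \<le> 1" and \<xi>: "cmod \<xi> \<le> c / 2" and \<delta>: "\<delta> \<ge> 0" "\<delta> > 0 \<or> \<xi> \<noteq> 0"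
  shows "Re (\<xi> - \<xi>\<^sup>2 - cnj \<xi> - of_real \<delta>) < c * cmod (\<xi> - \<xi>\<^sup>2 - cnj \<xi> - of_real \<delta>)"
proof (rule ccontr)
  define x y where "x = Re \<xi>" and "y = Im \<xi>"
  define w where "w = \<xi> - \<xi>\<^sup>2 - cnj \<xi> - of_real \<delta>"
  have xy: "\<bar>x\<bar> \<le> c / 2" "\<bar>y\<bar> \<le> c / 2"
    using \<xi> abs_Re_le_cmod[of \<xi>] abs_Im_le_cmod[of \<xi>] by (auto simp: x_def y_def)
  have Rew: "Re w = y\<^sup>2 - x\<^sup>2 - \<delta>" by (simp add: w_def x_def y_def Re_power2)
  have Imw: "Im w = 2 * y * (1 - x)" by (simp add: w_def x_def y_def Im_power2 algebra_simps)
  assume "\<not> ?thesis"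
  then have "c * cmod w \<le> Re w" by (simp add: w_def)
  moreover have "\<bar>y\<bar> \<le> cmod w"
  proof -
    have "\<bar>y\<bar> * 1 \<le> \<bar>y\<bar> * (2 * (1 - x))" using xy c by (intro mult_left_mono) auto
    also have "\<dots> = \<bar>Im w\<bar>" using xy c by (simp add: Imw abs_mult)
    also have "\<dots> \<le> cmod w" by (rule abs_Im_le_cmod)
    finally show ?thesis by simp
  qed
  ultimately have "c * \<bar>y\<bar> \<le> y\<^sup>2 - x\<^sup>2 - \<delta>"
    using c Rew by (smt (verit) mult_left_mono)
  moreover have "y\<^sup>2 \<le> \<bar>y\<bar> * (c / 2)"
    using mult_left_mono[OF xy(2), of "\<bar>y\<bar>"] by (simp add: power2_eq_square abs_mult_self_eq)
  ultimately have *: "c * \<bar>y\<bar> / 2 + x\<^sup>2 + \<delta> \<le> 0" by (simp add: algebra_simps)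
  have "c * \<bar>y\<bar> / 2 \<ge> 0" "x\<^sup>2 \<ge> 0" using c by auto
  with * \<delta>(1) have "c * \<bar>y\<bar> / 2 = 0" "x\<^sup>2 = 0" "\<delta> = 0" by linarith+
  then show False using \<delta>(2) c by (auto simp: x_def y_def complex_eq_iff)
qed

text \<open>At \<open>\<delta> = 0\<close> the boundary of the disc is compact and disjoint from the
  closed cone. The factor 2 leaves room for a shift by \<open>\<delta> < \<kappa>\<close>.\<close>

lemma parabolic_disc_boundary_gap:
  assumes c: "0 < c" "c \<le> 1" and \<rho>: "0 < \<rho>" "\<rho> \<le> c / 2"
  shows "\<exists>\<kappa>>0. \<forall>\<xi> Y. cmod \<xi> = \<rho> \<longrightarrow> c * cmod Y \<le> Re Y \<longrightarrow> 2 * \<kappa> \<le> cmod (Y - (\<xi> - \<xi>\<^sup>2 - cnj \<xi>))"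
proof -
  have "compact ((\<lambda>\<xi>. \<xi> - \<xi>\<^sup>2 - cnj \<xi>) ` sphere 0 \<rho>)"
    by (intro compact_continuous_image continuous_intros) auto
  moreover have "closed {Y. c * cmod Y \<le> Re Y}"
    by (intro closed_Collect_le continuous_intros)
  moreover have "(\<lambda>\<xi>. \<xi> - \<xi>\<^sup>2 - cnj \<xi>) ` sphere 0 \<rho> \<inter> {Y. c * cmod Y \<le> Re Y} = {}"
    using parabolic_disc_avoids_cone[OF c, of _ 0] \<rho> by (force simp: dist_norm)
  ultimately obtain d where d: "d > 0"
    "\<forall>x\<in>(\<lambda>\<xi>. \<xi> - \<xi>\<^sup>2 - cnj \<xi>) ` sphere 0 \<rho>. \<forall>y\<in>{Y. c * cmod Y \<le> Re Y}. d \<le> dist x y"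
    using separate_compact_closed by metis
  then show ?thesis
    by (intro exI[of _ "d / 2"]) (auto simp: dist_norm norm_minus_commute)
qed

text \<open>For \<open>v = z - a\<close>, \<open>Y\<close> is the position of the ray point
  \<open>t / v + cnj a\<close> relative to the corner \<open>cnj z\<close>, in units of
  \<open>u\<close>. It is a nonnegative multiple of \<open>cnj (u * v)\<close>, so the cone
  condition passes from \<open>u * v\<close> to \<open>Y\<close>.\<close>

lemma kernel_denominator_factorization:
  fixes u v Z :: complex
  assumes u: "cmod u = 1" and cone: "c * cmod v \<le> Re (u * v)" and v: "v \<noteq> 0" and t: "(cmod v)\<^sup>2 \<le> t"
    and c: "c > 0"
  obtains Y where "c * cmod Y \<le> Re Y" "of_real t - (cnj v + u * Z) * v = u * v * (Y - Z)"
proof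
  define p where "p = u * v"
  have p: "cmod p = cmod v" "p \<noteq> 0" using u v by (auto simp: p_def norm_mult)
  define s where "s = (t - (cmod v)\<^sup>2) / (cmod p)\<^sup>2"
  have s: "s \<ge> 0" using t by (simp add: s_def)
  have "s * (c * cmod v) \<le> s * Re p" using cone s unfolding p_def by (rule mult_left_mono)
  then show "c * cmod (of_real s * cnj p) \<le> Re (of_real s * cnj p)"
    using s p by (simp add: norm_mult mult_ac)
  have "p * (of_real s * cnj p) = of_real s * of_real ((cmod p)\<^sup>2)"
    by (simp add: complex_norm_square mult_ac del: of_real_power)
  also have "\<dots> = of_real (t - (cmod v)\<^sup>2)" using p v by (simp add: s_def)
  also have "\<dots> = of_real t - v * cnj v" by (simp add: complex_norm_square del: of_real_power)
  finally show "of_real t - (cnj v + u * Z) * v = u * v * (of_real s * cnj p - Z)"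
    by (simp add: p_def algebra_simps)
qed

section \<open>Uniform bounds for differences of transforms\<close>

lemma cauchy_transform_norm_le:
  assumes f: "f \<in> circle_ext_funs X" and a: "a \<in> X" and z: "z \<noteq> a" and m: "m > 0"
    and N: "\<And>t. t \<in> {(cmod (z - a))\<^sup>2..T} \<Longrightarrow> m \<le> cmod (of_real t - N z)"
    and M: "integral {(cmod (z - a))\<^sup>2..T} (\<lambda>t. cmod (circle_ext f a t z)) \<le> M"
  shows "cmod (cauchy_transform a T (circle_ext f a) N z) \<le> M / m"
proof -
  let ?I = "{(cmod (z - a))\<^sup>2..T}"
  have ne: "of_real t - N z \<noteq> 0" if "t \<in> ?I" for t using N[OF that] m by auto
  have "cmod (cauchy_transform a T (circle_ext f a) N z) \<le> integral ?I (\<lambda>t. cmod (circle_ext f a t z) / m)"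
    unfolding cauchy_transform_def
  proof (rule integral_norm_bound_integral)
    show "(\<lambda>t. circle_ext f a t z / (of_real t - N z)) integrable_on ?I"
      using ne by (intro integrable_continuous_interval continuous_intros
            continuous_on_circle_ext[OF f a z]) auto
    show "(\<lambda>t. cmod (circle_ext f a t z) / m) integrable_on ?I"
      using m by (intro integrable_continuous_interval continuous_intros
            continuous_on_circle_ext[OF f a z]) auto
    show "cmod (circle_ext f a t z / (of_real t - N z)) \<le> cmod (circle_ext f a t z) / m"
      if "t \<in> ?I" for t
      unfolding norm_divide using N[OF that] m ne[OF that] by (intro divide_left_mono mult_pos_pos) auto
  qed
  also have "\<dots> = integral ?I (\<lambda>t. cmod (circle_ext f a t z)) / m" by simp
  also have "\<dots> \<le> M / m" using M m by (intro divide_right_mono) auto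
  finally show ?thesis .
qed

text \<open>The difference is taken at the centre of a parabolic disc, so the maximum principle
  bounds it by its size on the boundary, where both kernels are bounded independently of
  \<open>\<delta>\<close>. The constants are fixed before \<open>X\<close>, \<open>f\<close>,
  \<open>z\<close> and \<open>\<delta>\<close>; \<open>M\<close> bounds the integrals over single
  rays.\<close>

lemma cauchy_transform_pair_bound:
  assumes u: "cmod u = 1" and a0: "Re (u * (z0 - a)) > 0" and b0: "Re (u * (z0 - b)) > 0"
    and Ta: "(cmod (z0 - a))\<^sup>2 < Ta" and Tb: "(cmod (z0 - b))\<^sup>2 < Tb"
  shows "\<exists>\<epsilon>>0. \<exists>\<kappa>>0. \<exists>C\<ge>0. \<forall>X f z \<delta> M. f \<in> circle_ext_funs X \<longrightarrow> a \<in> X \<longrightarrow> b \<in> X \<longrightarrow>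
     z \<in> ball z0 \<epsilon> \<longrightarrow> 0 < \<delta> \<longrightarrow> \<delta> < \<kappa> \<longrightarrow>
     (\<forall>z. cmod (z0 - a) / 2 \<le> cmod (z - a) \<longrightarrow> (cmod (z - a))\<^sup>2 \<le> Ta \<longrightarrow>
        integral {(cmod (z - a))\<^sup>2..Ta} (\<lambda>t. cmod (circle_ext f a t z)) \<le> M) \<longrightarrow>
     (\<forall>z. cmod (z0 - b) / 2 \<le> cmod (z - b) \<longrightarrow> (cmod (z - b))\<^sup>2 \<le> Tb \<longrightarrow>
        integral {(cmod (z - b))\<^sup>2..Tb} (\<lambda>t. cmod (circle_ext f b t z)) \<le> M) \<longrightarrow>
     cmod (cauchy_transform a Ta (circle_ext f a) (\<lambda>w. (cnj w - of_real \<delta> * u - cnj a) * (w - a)) z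
         - cauchy_transform b Tb (circle_ext f b) (\<lambda>w. (cnj w - of_real \<delta> * u - cnj b) * (w - b)) z) \<le> C * M"
proof -
  have nz: "z0 \<noteq> a" "z0 \<noteq> b" using a0 b0 by auto
  \<comment> \<open>Half the smaller cosine of the angles between \<open>u\<close> and the two ray
    directions; the halving makes the cone condition strict at \<open>z0\<close>, so that it
    persists nearby.\<close>
  define c where "c = min (Re (u * (z0 - a)) / (2 * cmod (z0 - a))) (min (Re (u * (z0 - b)) / (2 * cmod (z0 - b))) 1)"
  have c: "0 < c" "c \<le> 1" using a0 b0 nz by (auto simp: c_def)
  have "c \<le> Re (u * (z0 - a)) / (2 * cmod (z0 - a))" "c \<le> Re (u * (z0 - b)) / (2 * cmod (z0 - b))"
    unfolding c_def by linarith+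
  then have "c * (2 * cmod (z0 - a)) \<le> Re (u * (z0 - a))" "c * (2 * cmod (z0 - b)) \<le> Re (u * (z0 - b))"
    using nz by (simp_all add: pos_le_divide_eq)
  moreover have "c * cmod (z0 - a) > 0" "c * cmod (z0 - b) > 0" using c nz by auto
  ultimately have c0: "c * cmod (z0 - a) < Re (u * (z0 - a))" "c * cmod (z0 - b) < Re (u * (z0 - b))"
    by linarith+
  define da db where "da = cmod (z0 - a) / 2" and "db = cmod (z0 - b) / 2"
  have d: "da > 0" "db > 0" using nz by (auto simp: da_def db_def)
  define U where "U = {z. c * cmod (z - a) < Re (u * (z - a))} \<inter> {z. c * cmod (z - b) < Re (u * (z - b))}
     \<inter> {z. (cmod (z - a))\<^sup>2 < Ta} \<inter> {z. (cmod (z - b))\<^sup>2 < Tb} \<inter> {z. da < cmod (z - a)} \<inter> {z. db < cmod (z - b)}"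
  have "open U" unfolding U_def
    by (intro open_Int open_Collect_less continuous_intros)
  moreover have "z0 \<in> U" using c0 Ta Tb nz by (auto simp: U_def da_def db_def)
  ultimately obtain r where r: "r > 0" "ball z0 r \<subseteq> U" by (meson open_contains_ball)
  \<comment> \<open>The disc of radius \<open>2 * \<rho>\<close> about a point of
    \<open>ball z0 (r / 2)\<close> stays in \<open>ball z0 r\<close>, and
    \<open>2 * \<rho> \<le> c / 2\<close> is what \<open>parabolic_disc_avoids_cone\<close> requires
    on it.\<close>
  define \<rho> where "\<rho> = min (r / 4) (c / 4)"
  have \<rho>: "\<rho> > 0" "\<rho> \<le> r / 4" "2 * \<rho> \<le> c / 2" "\<rho> \<le> c / 2" using r c by (auto simp: \<rho>_def)
  obtain \<kappa> where \<kappa>: "\<kappa> > 0" "\<And>\<xi> Y. cmod \<xi> = \<rho> \<Longrightarrow> c * cmod Y \<le> Re Y \<Longrightarrow> 2 * \<kappa> \<le> cmod (Y - (\<xi> - \<xi>\<^sup>2 - cnj \<xi>))"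
    using parabolic_disc_boundary_gap[OF c \<rho>(1,4)] by blast
  have main: "cmod (cauchy_transform a Ta (circle_ext f a) (\<lambda>w. (cnj w - of_real \<delta> * u - cnj a) * (w - a)) z
         - cauchy_transform b Tb (circle_ext f b) (\<lambda>w. (cnj w - of_real \<delta> * u - cnj b) * (w - b)) z)
         \<le> (1 / (da * \<kappa>) + 1 / (db * \<kappa>)) * M"
    if f: "f \<in> circle_ext_funs X" and a: "a \<in> X" and b: "b \<in> X" and z: "z \<in> ball z0 (r / 2)"
      and \<delta>: "0 < \<delta>" "\<delta> < \<kappa>"
      and M: "\<And>z. da \<le> cmod (z - a) \<Longrightarrow> (cmod (z - a))\<^sup>2 \<le> Ta \<Longrightarrow>
          integral {(cmod (z - a))\<^sup>2..Ta} (\<lambda>t. cmod (circle_ext f a t z)) \<le> M"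
        "\<And>z. db \<le> cmod (z - b) \<Longrightarrow> (cmod (z - b))\<^sup>2 \<le> Tb \<Longrightarrow>
          integral {(cmod (z - b))\<^sup>2..Tb} (\<lambda>t. cmod (circle_ext f b t z)) \<le> M"
    for X f z \<delta> M
  proof -
    \<comment> \<open>The parabolic disc: holomorphic in \<open>w\<close>, with
      \<open>\<eta> z = cnj z - \<delta> * u\<close>. \<open>Z w\<close> is its offset
      \<open>\<eta> w - cnj w\<close> divided by \<open>u\<close>.\<close>
    define \<eta> where "\<eta> = (\<lambda>w. cnj z - of_real \<delta> * u + u * (u * (w - z) - (u * (w - z))\<^sup>2))"
    define Z where "Z = (\<lambda>w. (u * (w - z) - (u * (w - z))\<^sup>2 - cnj (u * (w - z))) - of_real \<delta>)"
    have uu: "u * cnj u = 1" using u complex_norm_square[of u] by simp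
    have uu': "u * (cnj u * x) = x" for x using uu by (metis mult.assoc mult_1)
    have \<eta>Z: "\<eta> w - cnj d = cnj (w - d) + u * Z w" for w d
      unfolding \<eta>_def Z_def by (simp add: algebra_simps uu')
    have S: "ball z (2 * \<rho>) \<subseteq> U"
    proof
      fix w assume "w \<in> ball z (2 * \<rho>)"
      then have "dist z0 w < r" using z \<rho>(2) dist_triangle[of z0 w z] by auto
      then show "w \<in> U" using r by auto
    qed
    have cone: "c * cmod (w - a) \<le> Re (u * (w - a))" "w - a \<noteq> 0" "(cmod (w - a))\<^sup>2 \<le> Ta" "da < cmod (w - a)"
      "c * cmod (w - b) \<le> Re (u * (w - b))" "w - b \<noteq> 0" "(cmod (w - b))\<^sup>2 \<le> Tb" "db < cmod (w - b)"
      if "w \<in> ball z (2 * \<rho>)" for w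
      using S that by (auto simp: U_def)
    have ne: "of_real t \<noteq> (\<eta> w - cnj d) * (w - d)"
      if w: "w \<in> ball z (2 * \<rho>)" and t: "(cmod (w - d))\<^sup>2 \<le> t"
        and d: "c * cmod (w - d) \<le> Re (u * (w - d))" "w - d \<noteq> 0" for w t d
    proof -
      obtain Y where Y: "c * cmod Y \<le> Re Y"
        "of_real t - (cnj (w - d) + u * Z w) * (w - d) = u * (w - d) * (Y - Z w)"
        using kernel_denominator_factorization[OF u d t c(1)] by blast
      have "cmod (u * (w - z)) \<le> c / 2"
        using w \<rho>(3) u by (simp add: norm_mult dist_norm norm_minus_commute)
      from parabolic_disc_avoids_cone[OF c this, of \<delta>] \<delta>(1)
      have "Re (Z w) < c * cmod (Z w)" by (simp add: Z_def)
      then have "Y \<noteq> Z w" using Y(1) by auto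
      then have "u * (w - d) * (Y - Z w) \<noteq> 0" using d u by auto
      then show ?thesis unfolding \<eta>Z by (metis Y(2) right_minus_eq)
    qed
    have gap: "e * \<kappa> \<le> cmod (of_real t - (\<eta> w - cnj d) * (w - d))"
      if w: "w \<in> sphere z \<rho>" and t: "(cmod (w - d))\<^sup>2 \<le> t" and e: "e < cmod (w - d)" "e > 0"
        and d: "c * cmod (w - d) \<le> Re (u * (w - d))" "w - d \<noteq> 0" for w t d e
    proof -
      obtain Y where Y: "c * cmod Y \<le> Re Y"
        "of_real t - (cnj (w - d) + u * Z w) * (w - d) = u * (w - d) * (Y - Z w)"
        using kernel_denominator_factorization[OF u d t c(1)] by blast
      have "cmod (u * (w - z)) = \<rho>"
        using w u by (simp add: norm_mult dist_norm norm_minus_commute)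
      from \<kappa>(2)[OF this Y(1)] have "2 * \<kappa> \<le> cmod ((Y - Z w) - of_real \<delta>)"
        by (simp add: Z_def algebra_simps)
      also have "\<dots> \<le> cmod (Y - Z w) + \<delta>"
        using norm_triangle_ineq4[of "Y - Z w" "of_real \<delta>"] \<delta> by simp
      finally have k: "\<kappa> \<le> cmod (Y - Z w)" using \<delta> by simp
      have "e * \<kappa> \<le> cmod (w - d) * cmod (Y - Z w)" using e k \<kappa>(1) by (intro mult_mono) auto
      then show ?thesis unfolding \<eta>Z Y(2) using u by (simp add: norm_mult)
    qed
    have sph: "w \<in> ball z (2 * \<rho>)" if "w \<in> sphere z \<rho>" for w using that \<rho> by auto
    have "cmod (cauchy_transform a Ta (circle_ext f a) (\<lambda>w. (\<eta> w - cnj a) * (w - a)) z -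
            cauchy_transform b Tb (circle_ext f b) (\<lambda>w. (\<eta> w - cnj b) * (w - b)) z) \<le> M / (da * \<kappa>) + M / (db * \<kappa>)"
    proof (rule cauchy_transform_diff_max_principle[OF f a b open_ball])
      show "cball z \<rho> \<subseteq> ball z (2 * \<rho>)" "\<rho> > 0" using \<rho>(1) by auto
      show "\<eta> holomorphic_on ball z (2 * \<rho>)" unfolding \<eta>_def by (intro holomorphic_intros)
      fix w assume w: "w \<in> sphere z \<rho>"
      have "cmod (cauchy_transform a Ta (circle_ext f a) (\<lambda>w. (\<eta> w - cnj a) * (w - a)) w) \<le> M / (da * \<kappa>)"
        using cone[OF sph[OF w]] \<kappa>(1) d
        by (intro cauchy_transform_norm_le[OF f a] M(1) w gap) auto
      moreover have "cmod (cauchy_transform b Tb (circle_ext f b) (\<lambda>w. (\<eta> w - cnj b) * (w - b)) w) \<le> M / (db * \<kappa>)"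
        using cone[OF sph[OF w]] \<kappa>(1) d
        by (intro cauchy_transform_norm_le[OF f b] M(2) w gap) auto
      ultimately show "cmod (cauchy_transform a Ta (circle_ext f a) (\<lambda>w. (\<eta> w - cnj a) * (w - a)) w -
            cauchy_transform b Tb (circle_ext f b) (\<lambda>w. (\<eta> w - cnj b) * (w - b)) w) \<le> M / (da * \<kappa>) + M / (db * \<kappa>)"
        using norm_triangle_ineq4 order_trans add_mono by meson
    qed (use cone ne in auto)
    \<comment> \<open>A transform at \<open>z\<close> uses \<open>N\<close> only at
      \<open>z\<close>, so \<open>\<eta>\<close> may be exchanged for the non-holomorphic
      \<open>cnj w - \<delta> * u\<close>, which has the same value there.\<close>
    moreover have "\<eta> z = cnj z - of_real \<delta> * u" by (simp add: \<eta>_def)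
    ultimately show ?thesis
      unfolding cauchy_transform_def by (simp add: algebra_simps)
  qed
  show ?thesis
  proof (rule exI[of _ "r / 2"], intro conjI, goal_cases)
    case 2
    show ?case
    proof (rule exI[of _ \<kappa>], intro conjI exI[of _ "1 / (da * \<kappa>) + 1 / (db * \<kappa>)"], goal_cases)
      case 3
      show ?case using main unfolding da_def db_def by blast
    qed (use \<kappa>(1) d in auto)
  qed (use r in auto)
qed

section \<open>The jump at the origin of a ray\<close>

text \<open>Writing \<open>g t = g x + (g t - g x)\<close> splits the difference. The constant part
  is an explicit logarithm in which the divergent \<open>ln \<delta>\<close> is common to both terms
  and cancels. In the other part the difference of the kernels is at most a multiple of
  \<open>\<delta> / (t - x + \<delta> * c)^2\<close>, which concentrates at \<open>x\<close>, where
  \<open>g t - g x\<close> vanishes.\<close>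

lemma cauchy_kernel_difference_tendsto:
  fixes g :: "real \<Rightarrow> complex"
  assumes xT: "x < T" and g: "continuous_on {x..T} g" and p: "Re p1 > 0" "Re p2 > 0"
  shows "((\<lambda>\<delta>. integral {x..T} (\<lambda>t. g t / (of_real t - of_real x + of_real \<delta> * p1))
            - integral {x..T} (\<lambda>t. g t / (of_real t - of_real x + of_real \<delta> * p2)))
      \<longlongrightarrow> g x * (Ln p2 - Ln p1)) (at_right 0)"
proof -
  define c where "c = min (Re p1) (Re p2)"
  have c: "c > 0" using p by (simp add: c_def)
  define k where "k = (\<lambda>p \<delta> t. complex_of_real t - of_real x + of_real \<delta> * p)"
  have kle: "t - x + \<delta> * c \<le> cmod (k q \<delta> t)" if "\<delta> > 0" "t \<ge> x" "q = p1 \<or> q = p2" for q \<delta> t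
  proof -
    have "t - x + \<delta> * c \<le> t - x + \<delta> * Re q"
      using that by (auto simp: c_def)
    also have "\<dots> = Re (k q \<delta> t)" by (simp add: k_def)
    also have "\<dots> \<le> cmod (k q \<delta> t)" by (rule complex_Re_le_cmod)
    finally show ?thesis .
  qed
  have kne: "k q \<delta> t \<noteq> 0" if "\<delta> > 0" "t \<ge> x" "q = p1 \<or> q = p2" for q \<delta> t
  proof -
    have "t - x + \<delta> * c > 0" using that c by (intro add_nonneg_pos) auto
    then show ?thesis using kle[OF that] by auto
  qed
  have int: "(\<lambda>t. h t / k q \<delta> t) integrable_on {x..T}"
    if "\<delta> > 0" "q = p1 \<or> q = p2" "continuous_on {x..T} h" for q \<delta> and h :: "real \<Rightarrow> complex"
  proof (rule integrable_continuous_interval)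
    have "continuous_on {x..T} (k q \<delta>)" unfolding k_def by (intro continuous_intros)
    then show "continuous_on {x..T} (\<lambda>t. h t / k q \<delta> t)"
      using kne[OF that(1) _ that(2)] that(3) by (intro continuous_on_divide) auto
  qed
  have Lnint: "((\<lambda>t. 1 / k q \<delta> t) has_integral Ln (of_real (T - x) + of_real \<delta> * q) - (of_real (ln \<delta>) + Ln q)) {x..T}"
    if \<delta>: "\<delta> > 0" and q: "q = p1 \<or> q = p2" for q \<delta>
  proof -
    have Req: "Re q > 0" using q p by auto
    have "((\<lambda>t. 1 / k q \<delta> t) has_integral Ln (k q \<delta> T) - Ln (k q \<delta> x)) {x..T}"
    proof (rule fundamental_theorem_of_calculus)
      fix t assume t: "t \<in> {x..T}"
      have "Re (k q \<delta> t) > 0" using t \<delta> Req by (auto simp: k_def intro!: add_nonneg_pos)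
      then have np: "complex_of_real t - of_real x + of_real \<delta> * q \<notin> \<real>\<^sub>\<le>\<^sub>0"
        by (auto simp: k_def complex_nonpos_Reals_iff)
      show "((\<lambda>t. Ln (k q \<delta> t)) has_vector_derivative 1 / k q \<delta> t) (at t within {x..T})"
        unfolding k_def using np by (intro has_vector_derivative_real_field)
          (auto intro!: derivative_eq_intros simp: inverse_eq_divide)
    qed (use xT in auto)
    moreover have "Ln (k q \<delta> x) = of_real (ln \<delta>) + Ln q"
    proof -
      have "q \<noteq> 0" using Req by auto
      from Ln_times_of_real[OF \<delta> this] show ?thesis using \<delta> by (simp add: k_def Ln_of_real)
    qed
    ultimately show ?thesis by (simp add: k_def)
  qed
  have L1: "((\<lambda>\<delta>. integral {x..T} (\<lambda>t. 1 / k p1 \<delta> t) - integral {x..T} (\<lambda>t. 1 / k p2 \<delta> t))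
      \<longlongrightarrow> Ln p2 - Ln p1) (at_right 0)"
  proof -
    have "((\<lambda>\<delta>. (Ln (of_real (T - x) + of_real \<delta> * p1) - Ln (of_real (T - x) + of_real \<delta> * p2)) + (Ln p2 - Ln p1))
      \<longlongrightarrow> (Ln (of_real (T - x) + of_real 0 * p1) - Ln (of_real (T - x) + of_real 0 * p2)) + (Ln p2 - Ln p1)) (at_right 0)"
      using xT by (intro tendsto_intros tendsto_ident_at) (auto simp: complex_nonpos_Reals_iff)
    then have "((\<lambda>\<delta>. (Ln (of_real (T - x) + of_real \<delta> * p1) - Ln (of_real (T - x) + of_real \<delta> * p2)) + (Ln p2 - Ln p1))
      \<longlongrightarrow> Ln p2 - Ln p1) (at_right 0)" by simp
    then show ?thesis
    proof (rule Lim_transform_eventually)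
      show "\<forall>\<^sub>F \<delta> in at_right 0. (Ln (of_real (T - x) + of_real \<delta> * p1) - Ln (of_real (T - x) + of_real \<delta> * p2)) + (Ln p2 - Ln p1)
        = integral {x..T} (\<lambda>t. 1 / k p1 \<delta> t) - integral {x..T} (\<lambda>t. 1 / k p2 \<delta> t)"
        using eventually_at_right_less[of 0]
        by eventually_elim (simp add: integral_unique[OF Lnint])
    qed
  qed
  have L2: "((\<lambda>\<delta>. integral {x..T} (\<lambda>t. (g t - g x) / k p1 \<delta> t) - integral {x..T} (\<lambda>t. (g t - g x) / k p2 \<delta> t))
      \<longlongrightarrow> 0) (at_right 0)"
    unfolding tendsto_iff
  proof (intro allI impI)
    fix e :: real assume e: "e > 0"
    define A where "A = cmod (p2 - p1) + 1"
    have A: "A > 0" by (simp add: A_def add_nonneg_pos)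
    \<comment> \<open>Chosen such that \<open>A * e' / c = e / 2\<close>, the limit of the final
      bound as \<open>\<delta>\<close> tends to 0.\<close>
    define e' where "e' = e * c / (2 * A)"
    have e': "e' > 0" using e c A by (simp add: e'_def)
    have cg: "continuous_on {x..T} (\<lambda>t. g t - g x)" using g by (intro continuous_intros)
    obtain \<eta> where \<eta>: "\<eta> > 0" "\<And>t. t \<in> {x..T} \<Longrightarrow> dist t x < \<eta> \<Longrightarrow> dist (g t) (g x) < e'"
      using g e' xT unfolding continuous_on_iff by (metis atLeastAtMost_iff less_le order_refl)
    have "bounded ((\<lambda>t. g t - g x) ` {x..T})"
      using compact_continuous_image[OF cg compact_Icc] by (rule compact_imp_bounded)
    then obtain M where M: "M > 0" "\<And>t. t \<in> {x..T} \<Longrightarrow> cmod (g t - g x) \<le> M"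
      unfolding bounded_pos by blast
    \<comment> \<open>\<open>K * (t - x)^2\<close> is at least \<open>M\<close> outside the
      \<open>\<eta>\<close>-neighbourhood of \<open>x\<close>, so \<open>e' + K * (t - x)^2\<close>
      majorizes the modulus of \<open>g t - g x\<close> everywhere. Against the kernel the quadratic
      term contributes only a multiple of \<open>\<delta> * K\<close>.\<close>
    define K where "K = M / \<eta>\<^sup>2"
    have K: "K > 0" using M \<eta> by (simp add: K_def)
    have gb: "cmod (g t - g x) \<le> e' + K * (t - x)\<^sup>2" if t: "t \<in> {x..T}" for t
    proof (cases "dist t x < \<eta>")
      case True
      then show ?thesis using \<eta>(2)[OF t] K by (smt (verit) dist_norm mult_nonneg_nonneg zero_le_power2)
    next
      case False
      then have "\<eta>\<^sup>2 \<le> (t - x)\<^sup>2" using \<eta>(1) t by (intro power_mono) (auto simp: dist_real_def)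
      then have "K * \<eta>\<^sup>2 \<le> K * (t - x)\<^sup>2" using K by simp
      then have "M \<le> K * (t - x)\<^sup>2" using \<eta> by (simp add: K_def)
      then show ?thesis using M(2)[OF t] e' by simp
    qed
    have bnd: "cmod (integral {x..T} (\<lambda>t. (g t - g x) / k p1 \<delta> t) - integral {x..T} (\<lambda>t. (g t - g x) / k p2 \<delta> t))
       \<le> A * (e' / c + \<delta> * K * (T - x))" if \<delta>: "\<delta> > 0" for \<delta>
    proof -
      \<comment> \<open>The concentrating kernel has total mass at most \<open>1 / c\<close>,
        whatever \<open>\<delta>\<close> is.\<close>
      have hi: "((\<lambda>t. \<delta> / (t - x + \<delta> * c)\<^sup>2) has_integral (- \<delta> / (T - x + \<delta> * c) - - \<delta> / (x - x + \<delta> * c))) {x..T}"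
      proof (rule fundamental_theorem_of_calculus)
        fix t assume "t \<in> {x..T}"
        then have "t - x + \<delta> * c > 0" using \<delta> c by (intro add_nonneg_pos) auto
        then show "((\<lambda>t. - \<delta> / (t - x + \<delta> * c)) has_vector_derivative \<delta> / (t - x + \<delta> * c)\<^sup>2) (at t within {x..T})"
          unfolding has_real_derivative_iff_has_vector_derivative[symmetric]
          by (auto intro!: derivative_eq_intros simp: power2_eq_square)
      qed (use xT in auto)
      have "((\<lambda>t. A * (e' * (\<delta> / (t - x + \<delta> * c)\<^sup>2) + \<delta> * K)) has_integral
         A * (e' * (- \<delta> / (T - x + \<delta> * c) - - \<delta> / (x - x + \<delta> * c)) + \<delta> * K * (T - x))) {x..T}"
        using has_integral_const_real[of "\<delta> * K" x T] xT
        by (intro has_integral_mult_right has_integral_add hi) (simp add: mult.commute)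
      note dom = this
      have "cmod (integral {x..T} (\<lambda>t. (g t - g x) / k p1 \<delta> t) - integral {x..T} (\<lambda>t. (g t - g x) / k p2 \<delta> t))
         = cmod (integral {x..T} (\<lambda>t. (g t - g x) / k p1 \<delta> t - (g t - g x) / k p2 \<delta> t))"
        using \<delta> cg by (subst integral_diff) (auto intro: int)
      also have "\<dots> \<le> integral {x..T} (\<lambda>t. A * (e' * (\<delta> / (t - x + \<delta> * c)\<^sup>2) + \<delta> * K))"
      proof (rule integral_norm_bound_integral)
        show "(\<lambda>t. (g t - g x) / k p1 \<delta> t - (g t - g x) / k p2 \<delta> t) integrable_on {x..T}"
          using \<delta> cg by (intro integrable_diff int) auto
        show "(\<lambda>t. A * (e' * (\<delta> / (t - x + \<delta> * c)\<^sup>2) + \<delta> * K)) integrable_on {x..T}"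
          using dom by blast
        fix t assume t: "t \<in> {x..T}"
        then have k1: "k p1 \<delta> t \<noteq> 0" and k2: "k p2 \<delta> t \<noteq> 0"
          using kne[OF \<delta>, of t p1] kne[OF \<delta>, of t p2] by auto
        define s where "s = t - x + \<delta> * c"
        have s: "s > 0" "s \<ge> t - x" using t \<delta> c by (auto simp: s_def intro!: add_nonneg_pos)
        have "(g t - g x) / k p1 \<delta> t - (g t - g x) / k p2 \<delta> t
            = (g t - g x) * (of_real \<delta> * (p2 - p1)) / (k p1 \<delta> t * k p2 \<delta> t)"
          using k1 k2 by (simp add: divide_simps) (simp add: k_def algebra_simps)
        also have "cmod \<dots> \<le> (e' + K * (t - x)\<^sup>2) * (\<delta> * A) / (s * s)"
          unfolding norm_divide norm_mult
          using s \<delta> gb[OF t] kle[OF \<delta>, of t p1] kle[OF \<delta>, of t p2] t A e' K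
          by (intro frac_le mult_mono mult_nonneg_nonneg add_nonneg_nonneg mult_pos_pos)
             (auto simp: s_def A_def)
        also have "\<dots> = A * (e' * (\<delta> / s\<^sup>2)) + A * \<delta> * K * ((t - x)\<^sup>2 / s\<^sup>2)"
          using s(1) by (simp add: power2_eq_square field_simps)
        also have "\<dots> \<le> A * (e' * (\<delta> / s\<^sup>2)) + A * \<delta> * K * 1"
        proof (intro add_left_mono mult_left_mono)
          have "(t - x)\<^sup>2 \<le> s\<^sup>2" using s t by (intro power_mono) auto
          then show "(t - x)\<^sup>2 / s\<^sup>2 \<le> 1" using s by simp
        qed (use A \<delta> K in auto)
        finally show "cmod ((g t - g x) / k p1 \<delta> t - (g t - g x) / k p2 \<delta> t)
           \<le> A * (e' * (\<delta> / (t - x + \<delta> * c)\<^sup>2) + \<delta> * K)" by (simp add: s_def algebra_simps)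
      qed
      also have "\<dots> = A * (e' * (- \<delta> / (T - x + \<delta> * c) - - \<delta> / (x - x + \<delta> * c)) + \<delta> * K * (T - x))"
        using dom by (rule integral_unique)
      also have "\<dots> \<le> A * (e' * (1 / c) + \<delta> * K * (T - x))"
      proof (intro mult_left_mono add_right_mono)
        have "\<delta> / (T - x + \<delta> * c) \<ge> 0" using xT \<delta> c by (intro divide_nonneg_pos add_pos_pos) auto
        then show "- \<delta> / (T - x + \<delta> * c) - - \<delta> / (x - x + \<delta> * c) \<le> 1 / c" using \<delta> by simp
      qed (use A e' in auto)
      finally show ?thesis by simp
    qed
    have "((\<lambda>\<delta>. A * (e' / c + \<delta> * K * (T - x))) \<longlongrightarrow> A * (e' / c + 0 * K * (T - x))) (at_right 0)"
      by (intro tendsto_intros tendsto_ident_at)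
    moreover have "A * (e' / c + 0 * K * (T - x)) < e" using A c e by (simp add: e'_def)
    ultimately have "\<forall>\<^sub>F \<delta> in at_right 0. A * (e' / c + \<delta> * K * (T - x)) < e"
      by (rule order_tendstoD)
    then show "\<forall>\<^sub>F \<delta> in at_right 0. dist (integral {x..T} (\<lambda>t. (g t - g x) / k p1 \<delta> t)
       - integral {x..T} (\<lambda>t. (g t - g x) / k p2 \<delta> t)) 0 < e"
      using eventually_at_right_less[of 0]
      by eventually_elim (use bnd in \<open>force simp: dist_norm\<close>)
  qed
  have "((\<lambda>\<delta>. g x * (integral {x..T} (\<lambda>t. 1 / k p1 \<delta> t) - integral {x..T} (\<lambda>t. 1 / k p2 \<delta> t))
        + (integral {x..T} (\<lambda>t. (g t - g x) / k p1 \<delta> t) - integral {x..T} (\<lambda>t. (g t - g x) / k p2 \<delta> t)))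
      \<longlongrightarrow> g x * (Ln p2 - Ln p1) + 0) (at_right 0)"
    by (intro tendsto_add tendsto_mult tendsto_const L1 L2)
  then have lim: "((\<lambda>\<delta>. g x * (integral {x..T} (\<lambda>t. 1 / k p1 \<delta> t) - integral {x..T} (\<lambda>t. 1 / k p2 \<delta> t))
        + (integral {x..T} (\<lambda>t. (g t - g x) / k p1 \<delta> t) - integral {x..T} (\<lambda>t. (g t - g x) / k p2 \<delta> t)))
      \<longlongrightarrow> g x * (Ln p2 - Ln p1)) (at_right 0)" by simp
  have int_split: "integral {x..T} (\<lambda>t. g t / k q \<delta> t)
      = g x * integral {x..T} (\<lambda>t. 1 / k q \<delta> t) + integral {x..T} (\<lambda>t. (g t - g x) / k q \<delta> t)"
    if \<delta>: "\<delta> > 0" and q: "q = p1 \<or> q = p2" for \<delta> q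
  proof -
    have "((\<lambda>t. g x * (1 / k q \<delta> t) + (g t - g x) / k q \<delta> t) has_integral
       g x * integral {x..T} (\<lambda>t. 1 / k q \<delta> t) + integral {x..T} (\<lambda>t. (g t - g x) / k q \<delta> t)) {x..T}"
      by (intro has_integral_add has_integral_mult_right integrable_integral int[OF \<delta> q]
          continuous_intros g)
    moreover have "g x * (1 / k q \<delta> t) + (g t - g x) / k q \<delta> t = g t / k q \<delta> t" for t
      by (simp add: diff_divide_distrib)
    ultimately show ?thesis by (simp add: integral_unique)
  qed
  have k_eq: "complex_of_real t - of_real x + of_real \<delta> * q = k q \<delta> t" for q \<delta> t
    by (simp add: k_def)
  show ?thesis
    unfolding k_eq
  proof (rule Lim_transform_eventually[OF lim])
    show "\<forall>\<^sub>F \<delta> in at_right 0. g x * (integral {x..T} (\<lambda>t. 1 / k p1 \<delta> t) - integral {x..T} (\<lambda>t. 1 / k p2 \<delta> t))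
        + (integral {x..T} (\<lambda>t. (g t - g x) / k p1 \<delta> t) - integral {x..T} (\<lambda>t. (g t - g x) / k p2 \<delta> t))
      = integral {x..T} (\<lambda>t. g t / k p1 \<delta> t) - integral {x..T} (\<lambda>t. g t / k p2 \<delta> t)"
      using eventually_at_right_less[of 0]
      by eventually_elim (simp add: int_split algebra_simps)
  qed
qed

text \<open>With \<open>x\<close> the square of \<open>|z - a|\<close>, the denominator is
  \<open>t - x + \<delta> * (u * (z - a))\<close>, so the two directions enter the limit as
  \<open>p1 = u1 * (z - a)\<close> and \<open>p2 = u2 * (z - a)\<close>.\<close>

lemma cauchy_transform_jump:
  assumes f: "f \<in> circle_ext_funs X" and a: "a \<in> X" and T: "(cmod (z - a))\<^sup>2 < T"
    and u: "Re (u1 * (z - a)) > 0" "Re (u2 * (z - a)) > 0"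
  shows "((\<lambda>\<delta>. cauchy_transform a T (circle_ext f a) (\<lambda>w. (cnj w - of_real \<delta> * u1 - cnj a) * (w - a)) z
            - cauchy_transform a T (circle_ext f a) (\<lambda>w. (cnj w - of_real \<delta> * u2 - cnj a) * (w - a)) z)
      \<longlongrightarrow> f z * (Ln (u2 * (z - a)) - Ln (u1 * (z - a)))) (at_right 0)"
proof -
  have za: "z \<noteq> a" using u by auto
  have eq: "of_real t - (cnj z - of_real \<delta> * u - cnj a) * (z - a)
     = of_real t - of_real ((cmod (z - a))\<^sup>2) + of_real \<delta> * (u * (z - a))" for t \<delta> u
    unfolding complex_norm_square by (simp add: algebra_simps)
  show ?thesis
    unfolding cauchy_transform_def eq circle_ext_norm_square[OF f a za, symmetric]
    by (rule cauchy_kernel_difference_tendsto[OF T continuous_on_circle_ext[OF f a za] u])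
qed

section \<open>Integrability along rays\<close>

lemma measure_lborel_cbox_2:
  fixes u v :: "real^2"
  shows "measure lborel (cbox u v) = (if u $ 1 \<le> v $ 1 \<and> u $ 2 \<le> v $ 2 then (v $ 1 - u $ 1) * (v $ 2 - u $ 2) else 0)"
proof -
  have "(\<exists>i::2. P i) \<longleftrightarrow> P 1 \<or> P 2" for P by (metis exhaust_2)
  then show ?thesis
    by (auto simp: content_cbox_if_cart interval_eq_empty_cart UNIV_2 not_less)
qed

lemma measure_lborel_cbox_complex:
  fixes u v :: complex
  shows "measure lborel (cbox u v) = (if Re u \<le> Re v \<and> Im u \<le> Im v then (Re v - Re u) * (Im v - Im u) else 0)"
  by (auto simp: content_cbox_if Basis_complex_def box_eq_empty)

text \<open>The change of variables takes place in \<open>real^2\<close>, whereas iterated integrals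
  live on \<open>real \<times> real\<close> and area integrals on \<open>complex\<close>. The
  coordinate maps send boxes to boxes of the same content and so preserve integrals.\<close>

lemma has_integral_cart_prod:
  fixes f :: "real \<times> real \<Rightarrow> 'b::real_normed_vector"
  assumes "(f has_integral i) (cbox (a, c) (b, d))"
  shows "((\<lambda>y::real^2. f (y $ 1, y $ 2)) has_integral i) (cbox (vector [a, c]) (vector [b, d]))"
proof -
  define g where "g = (\<lambda>y::real^2. (y $ 1, y $ 2))"
  define h where "h = (\<lambda>p. vector [fst p, snd p] :: real^2)"
  have hg: "h (g x) = x" for x by (simp add: h_def g_def vec_eq_iff forall_2)
  have gh: "g (h x) = x" for x by (simp add: h_def g_def)
  have gim: "g ` cbox u v = cbox (g u) (g v)" for u v
  proof -
    have "g ` cbox u v = {x. h x \<in> cbox u v}"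
      by (rule set_eqI) (use hg gh in \<open>force intro: rev_image_eqI\<close>)
    then show ?thesis by (auto simp: g_def h_def mem_box_cart forall_2 cbox_Pair_eq)
  qed
  have him: "h ` cbox u v = cbox (h u) (h v)" for u v
  proof -
    have "h ` cbox u v = h ` g ` cbox (h u) (h v)" by (simp only: gim gh)
    then show ?thesis by (simp add: image_comp comp_def hg)
  qed
  have "((\<lambda>x. f (g x)) has_integral (1 / 1) *\<^sub>R i) (h ` cbox (a, c) (b, d))"
  proof (rule has_integral_twiddle[OF zero_less_one hg gh _ _ _ _ assms])
    show "isCont g x" for x unfolding g_def by (intro continuous_intros)
    show "measure lborel (g ` cbox u v) = 1 * measure lborel (cbox u v)" for u v
      by (simp add: gim) (simp add: g_def content_Pair measure_lborel_cbox_2)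
  qed (use gim him in blast)+
  then show ?thesis by (simp add: him) (simp add: g_def h_def)
qed

lemma has_integral_cart_complex:
  fixes f :: "complex \<Rightarrow> 'b::real_normed_vector"
  assumes "(f has_integral i) (cbox a b)"
  shows "((\<lambda>y::real^2. f (Complex (y $ 1) (y $ 2))) has_integral i)
     (cbox (vector [Re a, Im a]) (vector [Re b, Im b]))"
proof -
  define g where "g = (\<lambda>y::real^2. Complex (y $ 1) (y $ 2))"
  define h where "h = (\<lambda>p. vector [Re p, Im p] :: real^2)"
  have hg: "h (g x) = x" for x by (simp add: h_def g_def vec_eq_iff forall_2)
  have gh: "g (h x) = x" for x by (simp add: h_def g_def)
  have gim: "g ` cbox u v = cbox (g u) (g v)" for u v
  proof -
    have "g ` cbox u v = {x. h x \<in> cbox u v}"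
      by (rule set_eqI) (use hg gh in \<open>force intro: rev_image_eqI\<close>)
    then show ?thesis by (auto simp: g_def h_def mem_box_cart forall_2 in_cbox_complex_iff)
  qed
  have him: "h ` cbox u v = cbox (h u) (h v)" for u v
  proof -
    have "h ` cbox u v = h ` g ` cbox (h u) (h v)" by (simp only: gim gh)
    then show ?thesis by (simp add: image_comp comp_def hg)
  qed
  have "((\<lambda>x. f (g x)) has_integral (1 / 1) *\<^sub>R i) (h ` cbox a b)"
  proof (rule has_integral_twiddle[OF zero_less_one hg gh _ _ _ _ assms])
    show "isCont g x" for x unfolding g_def Complex_eq by (intro continuous_intros)
    show "measure lborel (g ` cbox u v) = 1 * measure lborel (cbox u v)" for u v
      by (simp add: gim) (auto simp: g_def measure_lborel_cbox_complex measure_lborel_cbox_2)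
  qed (use gim him in blast)+
  then show ?thesis by (simp add: him) (simp add: g_def h_def)
qed

text \<open>The radial variable is \<open>t = r\<^sup>2\<close>, which makes the Jacobian the constant \<open>1 / 2\<close>.\<close>

lemma polar_area_integral_le:
  fixes \<psi> :: "complex \<Rightarrow> real"
  assumes \<psi>: "continuous_on UNIV \<psi>" "\<And>z. \<psi> z \<ge> 0" and x: "0 \<le> x"
    and sub: "cball a (sqrt T) \<subseteq> ball z0 R"
  shows "integral {x..T} (\<lambda>t. integral {-pi..pi} (\<lambda>\<theta>. \<psi> (a + of_real (sqrt t) * cis (\<theta> + \<alpha>))))
     \<le> 2 * integral (ball z0 R) \<psi>"
proof -
  define P where "P = (\<lambda>y::real^2. a + of_real (sqrt (y $ 1)) * cis (y $ 2 + \<alpha>))"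
  define C where "C = (\<lambda>y::real^2. Complex (y $ 1) (y $ 2))"
  define g where "g = (\<lambda>y. vector [Re (P y), Im (P y)] :: real^2)"
  have Cg: "C (g y) = P y" for y by (simp add: C_def g_def)
  \<comment> \<open>The open box leaves out radius 0, where \<open>sqrt\<close> is not
    differentiable, and the angles \<open>-pi\<close> and \<open>pi\<close>, which give the same
    point.\<close>
  define S where "S = box (vector [x, -pi]) (vector [T, pi] :: real^2)"
  have S: "y \<in> S \<longleftrightarrow> x < y $ 1 \<and> y $ 1 < T \<and> -pi < y $ 2 \<and> y $ 2 < pi" for y
    by (auto simp: S_def mem_box_cart forall_2)
  define g' where "g' = (\<lambda>(y::real^2) (h::real^2).
     vector [h $ 1 * (cos (y $ 2 + \<alpha>) / (2 * sqrt (y $ 1))) - h $ 2 * (sqrt (y $ 1) * sin (y $ 2 + \<alpha>)),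
             h $ 1 * (sin (y $ 2 + \<alpha>) / (2 * sqrt (y $ 1))) + h $ 2 * (sqrt (y $ 1) * cos (y $ 2 + \<alpha>))] :: real^2)"
  have der: "(g has_derivative g' y) (at y within S)" if y: "y \<in> S" for y
  proof (rule has_derivative_componentwise_within[THEN iffD2], intro ballI)
    fix b :: "real^2" assume "b \<in> Basis"
    then have b: "b = axis 1 1 \<or> b = axis 2 1" by (auto simp: Basis_vec_def exhaust_2) (metis exhaust_2)
    have y1: "y $ 1 > 0" using y x S by auto
    have d: "((\<lambda>y::real^2. y $ i) has_derivative (\<lambda>h. h $ i)) (at y within S)" for i
      by (rule bounded_linear_imp_has_derivative) (rule bounded_linear_vec_nth)
    have "((\<lambda>y. Re a + sqrt (y $ 1) * cos (y $ 2 + \<alpha>)) has_derivative (\<lambda>h. g' y h $ 1)) (at y within S)"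
      using y1 by (auto intro!: derivative_eq_intros d simp: g'_def divide_simps algebra_simps)
    moreover have "((\<lambda>y. Im a + sqrt (y $ 1) * sin (y $ 2 + \<alpha>)) has_derivative (\<lambda>h. g' y h $ 2)) (at y within S)"
      using y1 by (auto intro!: derivative_eq_intros d simp: g'_def divide_simps algebra_simps)
    ultimately show "((\<lambda>y. g y \<bullet> b) has_derivative (\<lambda>h. g' y h \<bullet> b)) (at y within S)"
      using b by (auto simp: inner_axis g_def P_def)
  qed
  have det: "\<bar>det (matrix (g' y))\<bar> = 1 / 2" if y: "y \<in> S" for y
  proof -
    have y1: "sqrt (y $ 1) > 0" using y x S by auto
    have "det (matrix (g' y)) = (cos (y $ 2 + \<alpha>))\<^sup>2 / 2 + (sin (y $ 2 + \<alpha>))\<^sup>2 / 2"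
      using y1 by (simp add: det_2 matrix_def g'_def axis_def power2_eq_square divide_simps)
    also have "\<dots> = 1 / 2" by (simp flip: add_divide_distrib)
    finally show ?thesis by simp
  qed
  have inj: "inj_on g S"
  proof (rule inj_onI)
    fix y w assume y: "y \<in> S" and w: "w \<in> S" and "g y = g w"
    then have "P y = P w" by (metis Cg)
    then have eq: "of_real (sqrt (y $ 1)) * cis (y $ 2 + \<alpha>) = of_real (sqrt (w $ 1)) * cis (w $ 2 + \<alpha>)"
      by (simp add: P_def)
    have pos: "sqrt (y $ 1) > 0" "sqrt (w $ 1) > 0" using y w x S by auto
    from eq have "cmod (of_real (sqrt (y $ 1)) * cis (y $ 2 + \<alpha>)) = cmod (of_real (sqrt (w $ 1)) * cis (w $ 2 + \<alpha>))"
      by simp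
    then have 1: "y $ 1 = w $ 1" using pos by (simp add: norm_mult)
    then have "cis (y $ 2 + \<alpha>) = cis (w $ 2 + \<alpha>)" using eq pos by simp
    then have "cos (y $ 2 + \<alpha>) = cos (w $ 2 + \<alpha>)" "sin (y $ 2 + \<alpha>) = sin (w $ 2 + \<alpha>)"
      by (auto simp: complex_eq_iff)
    then obtain k :: int where k: "y $ 2 + \<alpha> = w $ 2 + \<alpha> + 2 * pi * k"
      using sin_cos_eq_iff by metis
    then have "2 * pi * \<bar>real_of_int k\<bar> = \<bar>y $ 2 - w $ 2\<bar>" by (simp add: abs_mult)
    also have "\<dots> < 2 * pi * 1" using y w S by auto
    finally have "\<bar>real_of_int k\<bar> < 1" by simp
    then have "y $ 2 = w $ 2" using k by simp
    with 1 show "y = w" by (simp add: vec_eq_iff forall_2)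
  qed
  define \<phi> where "\<phi> = (\<lambda>w. \<psi> (C w))"
  have contC: "continuous_on A C" for A unfolding C_def Complex_eq by (intro continuous_intros)
  have cont\<phi>: "continuous_on A \<phi>" for A
    unfolding \<phi>_def by (intro continuous_on_compose2[OF \<psi>(1) contC]) auto
  have contP: "continuous_on A P" for A
    unfolding P_def by (intro continuous_intros)
  have cont\<psi>P: "continuous_on A (\<lambda>y. \<psi> (P y))" for A
    by (intro continuous_on_compose2[OF \<psi>(1) contP]) auto
  have int2: "integral S (\<lambda>y. \<psi> (P y)) = integral {x..T} (\<lambda>t. integral {-pi..pi} (\<lambda>\<theta>. \<psi> (a + of_real (sqrt t) * cis (\<theta> + \<alpha>))))"
  proof -
    let ?f = "\<lambda>p. \<psi> (a + of_real (sqrt (fst p)) * cis (snd p + \<alpha>))"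
    have c: "continuous_on (cbox (x, -pi) (T, pi)) ?f"
      by (intro continuous_on_compose2[OF \<psi>(1)] continuous_intros) auto
    have "(?f has_integral integral (cbox (x, -pi) (T, pi)) ?f) (cbox (x, -pi) (T, pi))"
      using integrable_continuous[OF c] by (rule integrable_integral)
    from has_integral_cart_prod[OF this]
    have "integral (cbox (vector [x, -pi]) (vector [T, pi])) (\<lambda>y. \<psi> (P y)) = integral (cbox (x, -pi) (T, pi)) ?f"
      by (simp add: P_def integral_unique)
    then show ?thesis
      unfolding S_def integral_open_interval integral_prod_continuous[OF c] by simp
  qed
  have Sleb: "S \<in> sets lebesgue" by (simp add: S_def)
  \<comment> \<open>The change of variables acts on vector-valued integrands, hence the wrapping of
    the scalar \<open>\<phi>\<close> by \<open>vec\<close> into \<open>real^1\<close>.\<close>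
  have ai: "(\<lambda>y. \<bar>det (matrix (g' y))\<bar> *\<^sub>R (vec (\<phi> (g y)) :: real^1)) absolutely_integrable_on S"
  proof -
    have "(\<lambda>y. (1/2) * \<psi> (P y)) absolutely_integrable_on cbox (vector [x, -pi]) (vector [T, pi])"
      by (intro absolutely_integrable_continuous continuous_intros cont\<psi>P)
    then have "(\<lambda>y. (1/2) * \<psi> (P y)) absolutely_integrable_on S"
      by (rule set_integrable_subset) (auto simp: S_def box_subset_cbox)
    also have "(\<lambda>y. (1/2) * \<psi> (P y)) absolutely_integrable_on S \<longleftrightarrow>
        (\<lambda>y. (\<bar>det (matrix (g' y))\<bar> *\<^sub>R (vec (\<phi> (g y)) :: real^1)) $ 1) absolutely_integrable_on S"
      by (rule set_integrable_cong) (simp_all add: det \<phi>_def Cg)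
    finally show ?thesis unfolding absolutely_integrable_on_1_iff .
  qed
  have "integral S (\<lambda>y. \<bar>det (matrix (g' y))\<bar> *\<^sub>R (vec (\<phi> (g y)) :: real^1))
      = vec ((1/2) * integral S (\<lambda>y. \<psi> (P y)))"
  proof -
    have "integral S (\<lambda>y. (\<bar>det (matrix (g' y))\<bar> *\<^sub>R (vec (\<phi> (g y)) :: real^1)) $ 1) = integral S (\<lambda>y. (1/2) * \<psi> (P y))"
      by (rule integral_cong) (simp add: det \<phi>_def Cg)
    then show ?thesis unfolding integral_on_1_eq by simp
  qed
  with has_absolute_integral_change_of_variables[OF Sleb der inj, of "\<lambda>w. vec (\<phi> w) :: real^1"] ai
  have im: "(\<lambda>w. vec (\<phi> w) :: real^1) absolutely_integrable_on (g ` S)"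
    "integral (g ` S) (\<lambda>w. vec (\<phi> w) :: real^1) = vec ((1/2) * integral S (\<lambda>y. \<psi> (P y)))"
    by auto
  have im1: "\<phi> integrable_on (g ` S)"
    using im(1) unfolding absolutely_integrable_on_1_iff
    by (simp add: absolutely_integrable_on_def)
  have im2: "integral (g ` S) \<phi> = (1/2) * integral S (\<lambda>y. \<psi> (P y))"
    using im(2) unfolding integral_on_1_eq by (simp add: vec_eq_iff)
  define \<omega> where "\<omega> = (\<lambda>z. if z \<in> ball z0 R then \<psi> z else 0)"
  obtain c d where cd: "ball z0 R \<subseteq> cbox c d"
    using bounded_subset_cbox_symmetric[OF bounded_ball] by metis
  have "\<psi> integrable_on ball z0 R"
  proof -
    have "\<psi> absolutely_integrable_on cbox c d"
      using \<psi>(1) by (intro absolutely_integrable_continuous) (rule continuous_on_subset, auto)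
    then have "\<psi> absolutely_integrable_on ball z0 R"
      by (rule set_integrable_subset) (use cd in auto)
    then show ?thesis by (simp add: absolutely_integrable_on_def)
  qed
  then have "(\<psi> has_integral integral (ball z0 R) \<psi>) (ball z0 R)" by (rule integrable_integral)
  then have "(\<omega> has_integral integral (ball z0 R) \<psi>) (cbox c d)"
    unfolding \<omega>_def by (subst has_integral_restrict[OF cd])
  from has_integral_cart_complex[OF this]
  have \<omega>: "((\<lambda>y. \<omega> (C y)) has_integral integral (ball z0 R) \<psi>) (cbox (vector [Re c, Im c]) (vector [Re d, Im d]))"
    by (simp add: C_def)
  have gball: "C w \<in> ball z0 R" if "w \<in> g ` S" for w
  proof -
    from that obtain y where y: "y \<in> S" "w = g y" by auto
    have "P y \<in> cball a (sqrt T)" using y x S by (auto simp: P_def dist_norm norm_mult)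
    then show ?thesis using sub y Cg by auto
  qed
  have gsub: "g ` S \<subseteq> cbox (vector [Re c, Im c]) (vector [Re d, Im d])"
  proof
    fix w assume "w \<in> g ` S"
    from gball[OF this] cd have "C w \<in> cbox c d" by auto
    then show "w \<in> cbox (vector [Re c, Im c]) (vector [Re d, Im d])"
      by (auto simp: mem_box_cart forall_2 in_cbox_complex_iff C_def)
  qed
  have "integral (g ` S) \<phi> = integral (g ` S) (\<lambda>y. \<omega> (C y))"
    using gball by (intro integral_cong) (simp add: \<phi>_def \<omega>_def)
  also have "\<dots> \<le> integral (cbox (vector [Re c, Im c]) (vector [Re d, Im d])) (\<lambda>y. \<omega> (C y))"
  proof (rule integral_subset_le[OF gsub])
    show "(\<lambda>y. \<omega> (C y)) integrable_on g ` S"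
      using im1 by (rule integrable_eq) (use gball in \<open>simp add: \<phi>_def \<omega>_def\<close>)
  qed (use \<omega> \<psi>(2) in \<open>auto simp: \<omega>_def\<close>)
  also have "\<dots> = integral (ball z0 R) \<psi>" using \<omega> by (rule integral_unique)
  finally show ?thesis unfolding int2[symmetric] using im2 by simp
qed

section \<open>Size of the Cauchy kernel near its singularity\<close>

lemma sin_ge_half:
  assumes "0 \<le> x" "x \<le> pi / 2"
  shows "x / 2 \<le> sin x"
proof (cases "x \<le> pi / 3")
  case True
  have "sin 0 - 0 / 2 \<le> sin x - x / 2"
  proof (rule DERIV_nonneg_imp_nondecreasing[OF assms(1), of "\<lambda>x. sin x - x / 2"])
    fix y assume y: "0 \<le> y" "y \<le> x"
    have "cos (pi / 3) \<le> cos y" using y True by (subst cos_mono_le_eq) auto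
    then have "cos y - 1 / 2 \<ge> 0" by (simp add: cos_60)
    moreover have "((\<lambda>x. sin x - x / 2) has_real_derivative cos y - 1 / 2) (at y)"
      by (auto intro!: derivative_eq_intros)
    ultimately show "\<exists>d. ((\<lambda>x. sin x - x / 2) has_real_derivative d) (at y) \<and> d \<ge> 0" by blast
  qed
  then show ?thesis by simp
next
  case False
  \<comment> \<open>On this range \<open>sin x\<close> is at least \<open>sqrt 3 / 2\<close>, hence
    at least 0.85, while \<open>x / 2\<close> is at most \<open>pi / 4 < 0.8\<close>.\<close>
  have "sqrt 3 / 2 = sin (pi / 3)" by (simp add: sin_60)
  also have "\<dots> \<le> sin x" using False assms by (subst sin_mono_le_eq) auto
  finally have "sqrt 3 / 2 \<le> sin x" .
  moreover have "1.7 \<le> sqrt (3::real)" by (rule real_le_rsqrt) (simp add: power2_eq_square)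
  moreover have "pi < 3.2" using pi_approx by simp
  ultimately show ?thesis using assms by simp
qed

text \<open>By the law of cosines the square is
  \<open>(r - \<rho>)^2 + 2 * r * \<rho> * (1 - cos \<theta>)\<close>, which is at least
  \<open>(r - \<rho>)^2 + (\<rho> * \<theta> / 2)^2\<close>. The arithmetic-geometric mean
  inequality then yields a product, which separates the radial from the angular variable.\<close>

lemma cis_diff_norm_square_ge:
  assumes "r \<ge> \<rho>" "\<rho> \<ge> 0" "\<bar>\<theta>\<bar> \<le> pi"
  shows "(r - \<rho>) * \<rho> * \<bar>\<theta>\<bar> \<le> (cmod (of_real r * cis \<theta> - of_real \<rho>))\<^sup>2"
proof -
  have "\<bar>\<theta>\<bar> / 4 \<le> sin (\<bar>\<theta>\<bar> / 2)" using sin_ge_half[of "\<bar>\<theta>\<bar> / 2"] assms(3) by simp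
  then have "(\<bar>\<theta>\<bar> / 4)\<^sup>2 \<le> (sin (\<bar>\<theta>\<bar> / 2))\<^sup>2" by (intro power_mono) auto
  moreover have "1 - cos \<bar>\<theta>\<bar> = 2 * (sin (\<bar>\<theta>\<bar> / 2))\<^sup>2"
    using cos_double_sin[of "\<bar>\<theta>\<bar> / 2"] by simp
  ultimately have c: "\<theta>\<^sup>2 / 8 \<le> 1 - cos \<theta>" by (simp add: power2_eq_square)
  have cs: "(cos \<theta>)\<^sup>2 + (sin \<theta>)\<^sup>2 = 1" by simp
  have "(cmod (of_real r * cis \<theta> - of_real \<rho>))\<^sup>2 = (r * cos \<theta> - \<rho>)\<^sup>2 + (r * sin \<theta>)\<^sup>2"
    by (simp add: cmod_power2)
  also have "\<dots> = r\<^sup>2 * ((cos \<theta>)\<^sup>2 + (sin \<theta>)\<^sup>2) - 2 * r * \<rho> * cos \<theta> + \<rho>\<^sup>2"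
    by (simp add: power2_eq_square algebra_simps del: sin_cos_squared_add sin_cos_squared_add2 sin_cos_squared_add3)
  also have "\<dots> = (r - \<rho>)\<^sup>2 + 2 * (r * \<rho>) * (1 - cos \<theta>)"
    unfolding cs by (simp add: power2_eq_square algebra_simps)
  finally have eq: "(cmod (of_real r * cis \<theta> - of_real \<rho>))\<^sup>2 = (r - \<rho>)\<^sup>2 + 2 * (r * \<rho>) * (1 - cos \<theta>)" .
  have "(\<rho> * \<bar>\<theta>\<bar> / 2)\<^sup>2 = 2 * (\<rho> * \<rho>) * (\<theta>\<^sup>2 / 8)"
    by (simp add: power2_eq_square)
  also have "\<dots> \<le> 2 * (r * \<rho>) * (1 - cos \<theta>)"
    using assms c by (intro mult_mono) auto
  finally have "(r - \<rho>)\<^sup>2 + (\<rho> * \<bar>\<theta>\<bar> / 2)\<^sup>2 \<le> (cmod (of_real r * cis \<theta> - of_real \<rho>))\<^sup>2"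
    unfolding eq by simp
  moreover have "2 * (r - \<rho>) * (\<rho> * \<bar>\<theta>\<bar> / 2) \<le> (r - \<rho>)\<^sup>2 + (\<rho> * \<bar>\<theta>\<bar> / 2)\<^sup>2"
    by (rule sum_squares_bound)
  moreover have "(r - \<rho>) * \<rho> * \<bar>\<theta>\<bar> = 2 * (r - \<rho>) * (\<rho> * \<bar>\<theta>\<bar> / 2)" by simp
  ultimately show ?thesis by linarith
qed

lemma has_integral_abs_powr:
  fixes \<beta> L :: real
  assumes "\<beta> < 1" "0 \<le> L"
  shows "((\<lambda>\<theta>. \<bar>\<theta>\<bar> powr - \<beta>) has_integral 2 * (L powr (1 - \<beta>) / (1 - \<beta>))) {-L..L}"
proof -
  have 0: "((\<lambda>\<theta>. \<theta> powr - \<beta>) has_integral L powr (1 - \<beta>) / (1 - \<beta>)) {0..L}"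
    using has_integral_powr_from_0[of "- \<beta>" L] assms by (simp add: add.commute)
  have 1: "((\<lambda>\<theta>. \<bar>\<theta>\<bar> powr - \<beta>) has_integral L powr (1 - \<beta>) / (1 - \<beta>)) {0..L}"
    using 0 by (rule has_integral_eq[rotated]) auto
  have "((\<lambda>\<theta>. (- \<theta>) powr - \<beta>) has_integral L powr (1 - \<beta>) / (1 - \<beta>)) {-L..-0}"
    using 0 by (subst has_integral_reflect_real)
  then have 2: "((\<lambda>\<theta>. \<bar>\<theta>\<bar> powr - \<beta>) has_integral L powr (1 - \<beta>) / (1 - \<beta>)) {-L..0}"
    by (simp only: minus_zero) (rule has_integral_eq[rotated], auto)
  show ?thesis
    using has_integral_combine[of "-L" 0 L, OF _ _ 2 1] assms by simp
qed

text \<open>Cauchy's formula for the rescaled extension on the unit disc, with the modulus taken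
  under the integral.\<close>

lemma circle_ext_norm_le:
  assumes f: "f \<in> circle_ext_funs X" and a: "a \<in> X" and z: "z \<noteq> a" and t: "(cmod (z - a))\<^sup>2 < t"
  shows "2 * pi * cmod (circle_ext f a t z) \<le> integral {-pi..pi} (\<lambda>\<theta>.
    cmod (f (a + of_real (sqrt t) * cis (\<theta> + Arg (z - a)))) *
      (sqrt t / cmod (of_real (sqrt t) * cis \<theta> - of_real (cmod (z - a)))))"
proof -
  define r where "r = sqrt t"
  define \<rho> where "\<rho> = cmod (z - a)"
  define \<alpha> where "\<alpha> = Arg (z - a)"
  have \<rho>: "0 < \<rho>" "\<rho> < r" using z t by (auto simp: \<rho>_def r_def real_less_rsqrt)
  have t0: "t > 0" using t by (smt (verit) zero_le_power2)
  have za: "z - a = of_real \<rho> * cis \<alpha>"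
    using rcis_cmod_Arg[of "z - a"] by (simp add: rcis_def \<rho>_def \<alpha>_def)
  \<comment> \<open>The rotation by \<open>- cis \<alpha>\<close> places the evaluation point at
    \<open>w = - \<rho> / r\<close>. The parameter \<open>x\<close> of \<open>circlepath\<close> in
    \<open>{0..1}\<close> then corresponds to \<open>\<theta> = 2 * pi * x - pi\<close>, and the
    nearest boundary point is at the middle \<open>\<theta> = 0\<close> of the angular
    interval.\<close>
  define h where "h = (\<lambda>\<xi>. disc_ext f a r (- cis \<alpha> * \<xi>))"
  note de = disc_ext[OF f a, of r]
  have r0: "r > 0" using \<rho> by simp
  have ch: "continuous_on (cball 0 1) h"
    unfolding h_def by (intro continuous_on_compose2[OF de(1)] continuous_intros)
      (use r0 in \<open>auto simp: norm_mult\<close>)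
  have "disc_ext f a r \<circ> (\<lambda>\<xi>. - cis \<alpha> * \<xi>) holomorphic_on ball 0 1"
    by (rule holomorphic_on_compose_gen[OF _ de(2)[OF r0]])
      (auto intro!: holomorphic_intros simp: norm_mult)
  then have hh: "h holomorphic_on ball 0 1" by (simp add: h_def comp_def)
  define w where "w = - complex_of_real (\<rho> / r)"
  have w: "cmod (w - 0) < 1" using \<rho> by (simp add: w_def norm_divide)
  have hw: "h w = circle_ext f a t z"
  proof -
    have "- cis \<alpha> * w = (z - a) / of_real (sqrt t)"
      using r0 by (simp add: w_def za r_def)
    then show ?thesis unfolding h_def circle_ext_eq_disc_ext[OF t0] r_def by simp
  qed
  define G where "G = (\<lambda>\<theta>. cmod (f (a + of_real r * cis (\<theta> + \<alpha>))) * (r / cmod (of_real r * cis \<theta> - of_real \<rho>)))"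
  have fc: "continuous_on UNIV f" using f by (simp add: circle_ext_funs_def)
  have nz: "of_real r * cis \<theta> - of_real \<rho> \<noteq> 0" for \<theta>
  proof
    assume "of_real r * cis \<theta> - of_real \<rho> = 0"
    then have "cmod (of_real r * cis \<theta>) = cmod (of_real \<rho>)" by simp
    then show False using \<rho> by (simp add: norm_mult)
  qed
  have "continuous_on {-pi..pi} G"
    unfolding G_def using nz
    by (intro continuous_intros continuous_on_compose2[OF fc]) auto
  from integrable_integral[OF integrable_continuous_interval[OF this]]
  have "(G has_integral integral {-pi..pi} G) (cbox (-pi) pi)"
    unfolding cbox_interval .
  from has_integral_affinity'[OF this, of "2 * pi" "-pi"]
  have "((\<lambda>x. G ((2 * pi) *\<^sub>R x + - pi)) has_integral (integral {-pi..pi} G /\<^sub>R (2 * pi) ^ DIM(real)))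
      (cbox ((- pi - - pi) /\<^sub>R (2 * pi)) ((pi - - pi) /\<^sub>R (2 * pi)))"
    using pi_gt_zero by (metis mult_pos_pos zero_less_numeral)
  moreover have "(- pi - - pi) /\<^sub>R (2 * pi) = 0"
    by (simp only: diff_self scaleR_zero_right)
  moreover have "pi - - pi = 2 * pi" by linarith
  then have "(pi - - pi) /\<^sub>R (2 * pi) = 1"
    using pi_gt_zero by (metis left_inverse mult_eq_0_iff pi_neq_zero real_scaleR_def zero_neq_numeral)
  moreover have "integral {-pi..pi} G /\<^sub>R (2 * pi) ^ DIM(real) = integral {-pi..pi} G / (2 * pi)"
    by (simp only: DIM_real power_one_right real_scaleR_def divide_inverse_commute)
  ultimately have GI: "((\<lambda>x. G (2 * pi * x - pi)) has_integral integral {-pi..pi} G / (2 * pi)) {0..1}"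
    by (simp only: cbox_interval real_scaleR_def add_uminus_conv_diff)
  define H where "H = (\<lambda>x. h (exp (2 * of_real pi * \<i> * of_real x)) / (exp (2 * of_real pi * \<i> * of_real x) - w) *
      (2 * of_real pi * \<i> * exp (2 * of_real pi * \<i> * of_real x)))"
  have CI: "(H has_integral 2 * of_real pi * \<i> * h w) {0..1}"
  proof -
    have "((\<lambda>u. h u / (u - w)) has_contour_integral 2 * of_real pi * \<i> * h w) (circlepath 0 1)"
      by (rule Cauchy_integral_circlepath[OF ch hh w])
    then show ?thesis
      unfolding has_contour_integral vector_derivative_circlepath H_def
      by (simp add: circlepath)
  qed
  have GI2: "((\<lambda>x. G (2 * pi * x - pi) * (2 * pi)) has_integral integral {-pi..pi} G) {0..1}"
    using has_integral_mult_left[OF GI, of "2 * pi"] by simp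
  have "norm (integral {0..1} H) \<le> integral {0..1} (\<lambda>x. G (2 * pi * x - pi) * (2 * pi))"
  proof (rule integral_norm_bound_integral)
    fix x :: real
    define u where "u = exp (2 * of_real pi * \<i> * of_real x)"
    have "u = cis (2 * pi * x)" by (simp add: u_def cis_conv_exp mult_ac)
    then have u: "u = - cis (2 * pi * x - pi)" by (simp add: complex_eq_iff)
    have nu: "cmod u = 1" unfolding u by simp
    then have "h u = f (a + of_real r * (- cis \<alpha> * u))"
      unfolding h_def using r0 by (intro de(3)) (auto simp: norm_mult)
    also have "- cis \<alpha> * u = cis ((2 * pi * x - pi) + \<alpha>)"
      unfolding u by (simp add: cis_mult add.commute)
    finally have hu: "h u = f (a + of_real r * cis ((2 * pi * x - pi) + \<alpha>))" .
    have "r * cmod (u - w) = cmod (of_real r * (u - w))" using r0 by (simp add: norm_mult)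
    also have "of_real r * (u - w) = - (of_real r * cis (2 * pi * x - pi) - of_real \<rho>)"
      unfolding u w_def using r0 by (simp add: algebra_simps)
    finally have "r * cmod (u - w) = cmod (of_real r * cis (2 * pi * x - pi) - of_real \<rho>)"
      by (simp only: norm_minus_cancel)
    then have uw: "cmod (u - w) = cmod (of_real r * cis (2 * pi * x - pi) - of_real \<rho>) / r"
      using r0 by (simp add: field_simps)
    have "norm (H x) = cmod (h u) / cmod (u - w) * (2 * pi)"
      unfolding H_def u_def[symmetric] norm_mult norm_divide nu by simp
    also have "\<dots> = G (2 * pi * x - pi) * (2 * pi)"
      unfolding hu uw G_def by simp
    finally show "norm (H x) \<le> G (2 * pi * x - pi) * (2 * pi)" by simp
  qed (use CI GI2 in blast)+
  then have "norm (2 * of_real pi * \<i> * h w) \<le> integral {-pi..pi} G"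
    unfolding integral_unique[OF CI] integral_unique[OF GI2] .
  then show ?thesis unfolding hw G_def r_def \<rho>_def \<alpha>_def by (simp add: norm_mult)
qed

text \<open>Since \<open>t - \<rho>^2 \<le> (sqrt t - \<rho>) * 2 * sqrt T\<close> and
  \<open>\<rho> \<ge> d\<close>, the squared distance is at least
  \<open>d / (2 * sqrt T) * (t - \<rho>^2) * |\<theta>|\<close>. Its power of exponent
  \<open>- \<beta>\<close> has separate singularities of order \<open>\<beta>\<close> in
  \<open>t\<close> and in \<open>\<theta>\<close>, both integrable when
  \<open>\<beta> < 1\<close>.\<close>

lemma cauchy_kernel_powr_le:
  assumes \<beta>: "\<beta> > 0" and d: "0 < d" "d \<le> \<rho>" and t: "\<rho>\<^sup>2 < t" "t \<le> T" and \<theta>: "\<bar>\<theta>\<bar> \<le> pi" "\<theta> \<noteq> 0"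
  shows "(sqrt t / cmod (of_real (sqrt t) * cis \<theta> - of_real \<rho>)) powr (2 * \<beta>)
    \<le> T powr \<beta> * (d / (2 * sqrt T)) powr - \<beta> * (t - \<rho>\<^sup>2) powr - \<beta> * \<bar>\<theta>\<bar> powr - \<beta>"
proof -
  define r where "r = sqrt t"
  define m where "m = cmod (of_real r * cis \<theta> - of_real \<rho>)"
  define c where "c = d / (2 * sqrt T)"
  have \<rho>: "\<rho> > 0" using d by simp
  have t0: "t > 0" "T > 0" using t \<rho> by (smt (verit) zero_less_power)+
  have r: "r > \<rho>" "r\<^sup>2 = t" "r \<le> sqrt T" using t t0 \<rho> by (auto simp: r_def real_less_rsqrt)
  have c: "c > 0" using d t0 by (simp add: c_def)
  define y where "y = c * (t - \<rho>\<^sup>2) * \<bar>\<theta>\<bar>"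
  have y: "y > 0" using c t \<theta> by (simp add: y_def)
  have "t - \<rho>\<^sup>2 = (r - \<rho>) * (r + \<rho>)" using r(2) by (simp add: power2_eq_square algebra_simps)
  also have "\<dots> \<le> (r - \<rho>) * (2 * sqrt T)" using r by (intro mult_left_mono) auto
  finally have "(t - \<rho>\<^sup>2) / (2 * sqrt T) \<le> r - \<rho>" using t0 by (simp add: pos_divide_le_eq)
  then have "(t - \<rho>\<^sup>2) / (2 * sqrt T) * d \<le> (r - \<rho>) * \<rho>" using d r t t0 by (intro mult_mono) auto
  then have "(t - \<rho>\<^sup>2) / (2 * sqrt T) * d * \<bar>\<theta>\<bar> \<le> (r - \<rho>) * \<rho> * \<bar>\<theta>\<bar>" by (intro mult_right_mono) auto
  then have "y \<le> (r - \<rho>) * \<rho> * \<bar>\<theta>\<bar>" by (simp add: y_def c_def mult_ac)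
  also have "\<dots> \<le> m\<^sup>2" unfolding m_def by (rule cis_diff_norm_square_ge) (use r \<rho> \<theta> in auto)
  finally have ym: "y \<le> m\<^sup>2" .
  have m: "m > 0" using ym y by (auto simp: m_def intro: ccontr)
  have "(r / m) powr (2 * \<beta>) = ((r / m) powr 2) powr \<beta>" by (simp add: powr_powr)
  also have "(r / m) powr 2 = t / m\<^sup>2" using m r \<rho> by (simp add: power_divide)
  also have "(t / m\<^sup>2) powr \<beta> \<le> (T / y) powr \<beta>"
    using ym y t t0 m \<beta> by (intro powr_mono2 frac_le) auto
  also have "\<dots> = T powr \<beta> * y powr - \<beta>"
    using y t0 by (simp add: powr_divide powr_minus_divide)
  also have "y powr - \<beta> = c powr - \<beta> * (t - \<rho>\<^sup>2) powr - \<beta> * \<bar>\<theta>\<bar> powr - \<beta>"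
    unfolding y_def using c t by (simp only: powr_mult)
  finally have "(r / m) powr (2 * \<beta>) \<le> T powr \<beta> * c powr - \<beta> * (t - \<rho>\<^sup>2) powr - \<beta> * \<bar>\<theta>\<bar> powr - \<beta>"
    by (simp only: mult.assoc)
  then show ?thesis by (simp add: r_def m_def c_def)
qed

lemma has_integral_shifted_powr:
  fixes x T \<beta> :: real
  assumes "\<beta> < 1" "x \<le> T"
  shows "((\<lambda>t. (t - x) powr - \<beta>) has_integral (T - x) powr (1 - \<beta>) / (1 - \<beta>)) {x..T}"
proof -
  have "((\<lambda>t. (t - x) powr - \<beta>) has_integral
     ((T - x) powr (1 - \<beta>) / (1 - \<beta>) - (x - x) powr (1 - \<beta>) / (1 - \<beta>))) {x..T}"
  proof (rule fundamental_theorem_of_calculus_interior[OF assms(2)])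
    show "continuous_on {x..T} (\<lambda>t. (t - x) powr (1 - \<beta>) / (1 - \<beta>))"
      using assms by (intro continuous_intros continuous_on_powr') auto
    fix t assume t: "t \<in> {x<..<T}"
    then show "((\<lambda>t. (t - x) powr (1 - \<beta>) / (1 - \<beta>)) has_vector_derivative (t - x) powr - \<beta>) (at t)"
      using assms(1) unfolding has_real_derivative_iff_has_vector_derivative[symmetric]
      by (auto intro!: derivative_eq_intros)
  qed
  then show ?thesis by simp
qed

text \<open>Young's inequality splits the product in \<open>circle_ext_norm_le\<close> into the
  \<open>p\<close>-th power of \<open>|f|\<close>, which polar coordinates turn into an area
  integral, and the \<open>q\<close>-th power of the kernel. The scale \<open>s\<close> is any
  positive upper bound for the \<open>L^p\<close> norm; dividing \<open>f\<close> by it bounds both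
  parts by constants and makes the result linear in \<open>s\<close>.\<close>

lemma circle_ext_L1_bound:
  fixes p d T :: real
  assumes p: "p > 2" and d: "d > 0" and T: "T > 0"
  shows "\<exists>K\<ge>0. \<forall>X f a z z0 R s. f \<in> circle_ext_funs X \<longrightarrow> a \<in> X \<longrightarrow> cball a (sqrt T) \<subseteq> ball z0 R \<longrightarrow>
    d \<le> cmod (z - a) \<longrightarrow> (cmod (z - a))\<^sup>2 \<le> T \<longrightarrow> s > 0 \<longrightarrow>
    integral (ball z0 R) (\<lambda>\<zeta>. cmod (f \<zeta>) powr p) \<le> s powr p \<longrightarrow>
    integral {(cmod (z - a))\<^sup>2..T} (\<lambda>t. cmod (circle_ext f a t z)) \<le> K * s"
proof -
  \<comment> \<open>Half of the conjugate exponent \<open>q = p / (p - 1)\<close>; for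
    \<open>p > 1\<close>, \<open>\<beta> < 1\<close> is equivalent to \<open>p > 2\<close>.\<close>
  define \<beta> where "\<beta> = p / (2 * (p - 1))"
  have \<beta>: "\<beta> > 0" "\<beta> < 1" using p by (auto simp: \<beta>_def)
  define q where "q = 2 * \<beta>"
  have q: "q > 1" "1 / p + 1 / q = 1" using p by (auto simp: q_def \<beta>_def field_simps)
  define K3 where "K3 = T powr \<beta> * (d / (2 * sqrt T)) powr - \<beta>"
  have K3: "K3 \<ge> 0" by (simp add: K3_def)
  define J where "J = 2 * (pi powr (1 - \<beta>) / (1 - \<beta>))"
  have J: "J \<ge> 0" using \<beta> by (simp add: J_def)
  \<comment> \<open>The summand 2 comes from the polar integral of \<open>|f|^p\<close>, divided by
    \<open>s powr p\<close>. The other summand bounds the kernel part, and the division by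
    \<open>2 * pi\<close> comes from Cauchy's formula.\<close>
  define K where "K = (2 + K3 * J * (T powr (1 - \<beta>) / (1 - \<beta>))) / (2 * pi)"
  have K: "K \<ge> 0" using K3 J \<beta> by (simp add: K_def)
  have main: "integral {(cmod (z - a))\<^sup>2..T} (\<lambda>t. cmod (circle_ext f a t z)) \<le> K * s"
    if f: "f \<in> circle_ext_funs X" and a: "a \<in> X" and R: "cball a (sqrt T) \<subseteq> ball z0 R"
      and dz: "d \<le> cmod (z - a)" and zT: "(cmod (z - a))\<^sup>2 \<le> T" and s: "s > 0"
      and S: "integral (ball z0 R) (\<lambda>\<zeta>. cmod (f \<zeta>) powr p) \<le> s powr p" for X f a z z0 R s
  proof -
    define \<rho> where "\<rho> = cmod (z - a)"
    define x where "x = \<rho>\<^sup>2"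
    define \<alpha> where "\<alpha> = Arg (z - a)"
    have \<rho>: "\<rho> > 0" "d \<le> \<rho>" using d dz by (auto simp: \<rho>_def)
    have za: "z \<noteq> a" using \<rho> by (auto simp: \<rho>_def)
    have xT: "x \<le> T" "x > 0" using zT \<rho> by (auto simp: x_def \<rho>_def)
    have fc: "continuous_on UNIV f" using f by (simp add: circle_ext_funs_def)
    define \<psi> where "\<psi> = (\<lambda>\<zeta>. cmod (f \<zeta>) powr p)"
    have c\<psi>: "continuous_on UNIV \<psi>"
      unfolding \<psi>_def using p by (intro continuous_on_powr' continuous_intros fc) auto
    define \<Phi> where "\<Phi> = (\<lambda>t. integral {-pi..pi} (\<lambda>\<theta>. \<psi> (a + of_real (sqrt t) * cis (\<theta> + \<alpha>))))"
    have c\<Phi>: "continuous_on {x..T} \<Phi>"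
    proof -
      have "continuous_on ({x..T} \<times> cbox (-pi) pi) (\<lambda>(t, \<theta>). \<psi> (a + of_real (sqrt t) * cis (\<theta> + \<alpha>)))"
        unfolding split_beta by (intro continuous_on_compose2[OF c\<psi>] continuous_intros) auto
      from integral_continuous_on_param[OF this] show ?thesis by (simp add: \<Phi>_def)
    qed
    have I\<Phi>: "integral {x..T} \<Phi> \<le> 2 * s powr p"
    proof -
      have "integral {x..T} \<Phi> \<le> 2 * integral (ball z0 R) \<psi>"
        unfolding \<Phi>_def by (rule polar_area_integral_le[OF c\<psi> _ _ R]) (use xT in \<open>auto simp: \<psi>_def\<close>)
      then show ?thesis using S by (simp add: \<psi>_def)
    qed
    have pt: "cmod (circle_ext f a t z) \<le> s / (2 * pi) * (s powr - p * \<Phi> t + K3 * J * (t - x) powr - \<beta>)"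
      if t: "t \<in> {x<..T}" for t
    proof -
      have t': "\<rho>\<^sup>2 < t" "t \<le> T" using t by (auto simp: x_def)
      have t0: "t > 0" using t xT by auto
      define k where "k = (\<lambda>\<theta>. sqrt t / cmod (of_real (sqrt t) * cis \<theta> - of_real \<rho>))"
      define F where "F = (\<lambda>\<theta>. cmod (f (a + of_real (sqrt t) * cis (\<theta> + \<alpha>))))"
      have k0: "k \<theta> \<ge> 0" for \<theta> using t0 by (simp add: k_def)
      have nz: "of_real (sqrt t) * cis \<theta> - of_real \<rho> \<noteq> 0" for \<theta>
      proof
        assume "of_real (sqrt t) * cis \<theta> - of_real \<rho> = 0"
        then have "cmod (of_real (sqrt t) * cis \<theta>) = cmod (of_real \<rho>)" by simp
        then have "sqrt t = \<rho>" using \<rho> t0 by (simp add: norm_mult)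
        then show False using t' t0 by auto
      qed
      have ck: "continuous_on {-pi..pi} k"
        unfolding k_def using nz by (intro continuous_intros) auto
      have cF: "continuous_on {-pi..pi} F"
        unfolding F_def by (intro continuous_intros continuous_on_compose2[OF fc]) auto
      have ckq: "continuous_on {-pi..pi} (\<lambda>\<theta>. k \<theta> powr q)"
        using q k0 by (intro continuous_on_powr' ck continuous_intros) auto
      have cFp: "continuous_on {-pi..pi} (\<lambda>\<theta>. \<psi> (a + of_real (sqrt t) * cis (\<theta> + \<alpha>)))"
        by (intro continuous_on_compose2[OF c\<psi>] continuous_intros) auto
      note ici = integrable_continuous_interval
      have "2 * pi * cmod (circle_ext f a t z) \<le> integral {-pi..pi} (\<lambda>\<theta>. F \<theta> * k \<theta>)"
        using circle_ext_norm_le[OF f a za] t' unfolding F_def k_def \<rho>_def \<alpha>_def by simp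
      also have "\<dots> \<le> integral {-pi..pi} (\<lambda>\<theta>. s * (s powr - p * \<psi> (a + of_real (sqrt t) * cis (\<theta> + \<alpha>)) + k \<theta> powr q))"
      proof (rule integral_le)
        show "(\<lambda>\<theta>. F \<theta> * k \<theta>) integrable_on {-pi..pi}"
          by (rule ici) (intro continuous_intros cF ck)
        show "(\<lambda>\<theta>. s * (s powr - p * \<psi> (a + of_real (sqrt t) * cis (\<theta> + \<alpha>)) + k \<theta> powr q)) integrable_on {-pi..pi}"
          by (rule ici) (intro continuous_on_mult continuous_on_add continuous_on_const cFp ckq)
        fix \<theta> assume "\<theta> \<in> {-pi..pi}"
        have "(F \<theta> / s) * k \<theta> \<le> (F \<theta> / s) powr p / p + k \<theta> powr q / q"
          using p q k0 s by (intro Youngs_inequality) (auto simp: F_def)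
        also have "\<dots> \<le> (F \<theta> / s) powr p + k \<theta> powr q"
          using p q by (intro add_mono) (auto simp: divide_le_eq mult_le_cancel_left1)
        also have "(F \<theta> / s) powr p = s powr - p * \<psi> (a + of_real (sqrt t) * cis (\<theta> + \<alpha>))"
          using s by (simp add: F_def \<psi>_def powr_divide powr_minus field_simps)
        finally have "s * ((F \<theta> / s) * k \<theta>) \<le> s * (s powr - p * \<psi> (a + of_real (sqrt t) * cis (\<theta> + \<alpha>)) + k \<theta> powr q)"
          using s by (intro mult_left_mono) auto
        then show "F \<theta> * k \<theta> \<le> s * (s powr - p * \<psi> (a + of_real (sqrt t) * cis (\<theta> + \<alpha>)) + k \<theta> powr q)"
          using s by simp
      qed
      also have "\<dots> = s * (s powr - p * \<Phi> t + integral {-pi..pi} (\<lambda>\<theta>. k \<theta> powr q))"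
        unfolding \<Phi>_def integral_mult_right
        by (subst integral_add) (auto intro!: ici cFp ckq continuous_on_mult continuous_on_const)
      also have "integral {-pi..pi} (\<lambda>\<theta>. k \<theta> powr q) \<le> K3 * (t - x) powr - \<beta> * J"
      proof -
        have hJ: "((\<lambda>\<theta>. K3 * (t - x) powr - \<beta> * \<bar>\<theta>\<bar> powr - \<beta>) has_integral K3 * (t - x) powr - \<beta> * J) {-pi..pi}"
          unfolding J_def by (intro has_integral_mult_right has_integral_abs_powr) (use \<beta> in auto)
        have "((\<lambda>\<theta>. k \<theta> powr q) has_integral integral {-pi..pi} (\<lambda>\<theta>. k \<theta> powr q)) {-pi..pi}"
          using integrable_integral[OF ici[OF ckq]] .
        \<comment> \<open>At \<open>\<theta> = 0\<close> the majorant is 0, because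
          \<open>0 powr - \<beta> = 0\<close>, so the integrand is changed to 0 at this one
          point.\<close>
        then have "((\<lambda>\<theta>. if \<theta> = 0 then 0 else k \<theta> powr q) has_integral integral {-pi..pi} (\<lambda>\<theta>. k \<theta> powr q)) {-pi..pi}"
          by (rule has_integral_spike[OF negligible_sing, rotated]) auto
        then show ?thesis
        proof (rule has_integral_le[OF _ hJ])
          fix \<theta> assume \<theta>: "\<theta> \<in> {-pi..pi}"
          have "k \<theta> powr q \<le> K3 * (t - x) powr - \<beta> * \<bar>\<theta>\<bar> powr - \<beta>" if "\<theta> \<noteq> 0"
            using cauchy_kernel_powr_le[OF \<beta>(1) d \<rho>(2) t', of \<theta>] \<theta> that
            unfolding k_def q_def K3_def x_def by auto
          then show "(if \<theta> = 0 then 0 else k \<theta> powr q) \<le> K3 * (t - x) powr - \<beta> * \<bar>\<theta>\<bar> powr - \<beta>"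
            using K3 by auto
        qed
      qed
      finally have "2 * pi * cmod (circle_ext f a t z) \<le> s * (s powr - p * \<Phi> t + K3 * (t - x) powr - \<beta> * J)"
        using s by simp
      then show ?thesis by (simp add: field_simps)
    qed
    define G where "G = (\<lambda>t. s / (2 * pi) * (s powr - p * \<Phi> t + K3 * J * (t - x) powr - \<beta>))"
    have hG: "(G has_integral s / (2 * pi) * (s powr - p * integral {x..T} \<Phi> + K3 * J * ((T - x) powr (1 - \<beta>) / (1 - \<beta>)))) {x..T}"
      unfolding G_def
      using integrable_integral[OF integrable_continuous_interval[OF c\<Phi>]] has_integral_shifted_powr[OF \<beta>(2) xT(1)]
      by (intro has_integral_mult_right has_integral_add) auto
    have "((\<lambda>t. cmod (circle_ext f a t z)) has_integral integral {x..T} (\<lambda>t. cmod (circle_ext f a t z))) {x..T}"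
      using continuous_on_circle_ext[OF f a za, of T] unfolding x_def \<rho>_def
      by (intro integrable_integral[OF integrable_continuous_interval] continuous_on_norm)
    \<comment> \<open>The pointwise bound \<open>pt\<close> is available only for
      \<open>t > x\<close>; the endpoint is negligible.\<close>
    then have "((\<lambda>t. if t = x then 0 else cmod (circle_ext f a t z)) has_integral integral {x..T} (\<lambda>t. cmod (circle_ext f a t z))) {x..T}"
      by (rule has_integral_spike[OF negligible_sing, rotated]) auto
    then have "integral {x..T} (\<lambda>t. cmod (circle_ext f a t z)) \<le> s / (2 * pi) * (s powr - p * integral {x..T} \<Phi> + K3 * J * ((T - x) powr (1 - \<beta>) / (1 - \<beta>)))"
    proof (rule has_integral_le[OF _ hG])
      fix t assume t: "t \<in> {x..T}"
      have "\<Phi> t \<ge> 0" unfolding \<Phi>_def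
        by (rule integral_nonneg, rule integrable_continuous_interval)
          (auto simp: \<psi>_def intro!: continuous_on_compose2[OF c\<psi>[unfolded \<psi>_def]] continuous_intros)
      then have "0 \<le> G t" using s K3 J by (simp add: G_def)
      then show "(if t = x then 0 else cmod (circle_ext f a t z)) \<le> G t" using pt[of t] t by (auto simp: G_def)
    qed
    also have "\<dots> \<le> s / (2 * pi) * (2 + K3 * J * (T powr (1 - \<beta>) / (1 - \<beta>)))"
    proof (intro mult_left_mono add_mono)
      have "s powr - p * integral {x..T} \<Phi> \<le> s powr - p * (2 * s powr p)" using I\<Phi> by (intro mult_left_mono) auto
      also have "\<dots> = 2" using s by (simp add: powr_minus)
      finally show "s powr - p * integral {x..T} \<Phi> \<le> 2" .
      show "(T - x) powr (1 - \<beta>) / (1 - \<beta>) \<le> T powr (1 - \<beta>) / (1 - \<beta>)"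
        using xT \<beta> by (intro divide_right_mono powr_mono2) auto
    qed (use s K3 J in auto)
    also have "\<dots> = K * s" by (simp add: K_def)
    finally show ?thesis by (simp add: x_def \<rho>_def)
  qed
  show ?thesis using K main by blast
qed

section \<open>Three positively spanning rays\<close>

text \<open>\<open>cross d e > 0\<close> means that \<open>e\<close> lies counterclockwise of
  \<open>d\<close> at an angle strictly between 0 and pi.\<close>

definition cross :: "complex \<Rightarrow> complex \<Rightarrow> real" where
  "cross d e = Im (cnj d * e)"

lemma cross_anticommute: "cross e d = - cross d e"
  by (simp add: cross_def)

lemma cross_add_right: "cross d (x + y) = cross d x + cross d y"
  by (simp add: cross_def algebra_simps)

lemma cross_add_left: "cross (x + y) d = cross x d + cross y d"
  by (simp add: cross_def algebra_simps)

lemma cross_scale_right: "cross d (of_real s * e) = s * cross d e"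
  by (simp add: cross_def algebra_simps)

lemma cross_scale_left: "cross (of_real s * d) e = s * cross d e"
  by (simp add: cross_def algebra_simps)

lemma cross_self: "cross d d = 0"
  by (simp add: cross_def)

lemma cross_eq_0_imp_parallel:
  assumes "d \<noteq> 0" "cross d e = 0"
  shows "e = of_real (Re (cnj d * e) / (cmod d)\<^sup>2) * d"
proof -
  have "cnj d * e = of_real (Re (cnj d * e))"
    using assms(2) by (simp add: cross_def complex_eq_iff)
  then have "d * (cnj d * e) = of_real (Re (cnj d * e)) * d" by (metis mult.commute)
  then have "of_real ((cmod d)\<^sup>2) * e = of_real (Re (cnj d * e)) * d"
    by (simp only: complex_norm_square mult.assoc)
  moreover have "complex_of_real ((cmod d)\<^sup>2) \<noteq> 0" using assms(1) by simp
  ultimately show ?thesis by (simp add: field_simps del: of_real_power)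
qed

text \<open>Without a cyclic triple, the ray farthest clockwise from \<open>d k\<close> can only be enclosed with the help of the
  ray opposite to \<open>d k\<close>.  Opposite rays to \<open>d k\<close> and \<open>d j\<close>, together with a ray strictly between
  \<open>d j\<close> and \<open>d k\<close>, form a cyclic triple after all.\<close>

lemma cyclic_triple_exists:
  fixes d :: "'a \<Rightarrow> complex"
  assumes I: "finite I" "I \<noteq> {}"
    and between: "\<And>i. i \<in> I \<Longrightarrow> \<exists>j\<in>I. \<exists>k\<in>I. cross (d j) (d i) > 0 \<and> cross (d i) (d k) > 0 \<and> cross (d j) (d k) > 0"
  shows "\<exists>i\<in>I. \<exists>j\<in>I. \<exists>k\<in>I. cross (d i) (d j) > 0 \<and> cross (d j) (d k) > 0 \<and> cross (d k) (d i) > 0"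
proof (rule ccontr)
  assume "\<not> ?thesis"
  then have N: "\<not> (cross (d i) (d j) > 0 \<and> cross (d j) (d k) > 0 \<and> cross (d k) (d i) > 0)"
    if "i \<in> I" "j \<in> I" "k \<in> I" for i j k using that by blast
  have opposite: "\<exists>j\<in>I. \<exists>l\<in>I. \<exists>m\<in>I. \<exists>s<0. cross (d j) (d k) > 0 \<and> d l = of_real s * d k \<and>
      cross (d j) (d m) > 0 \<and> cross (d m) (d k) > 0" if k: "k \<in> I" for k
  proof -
    define In where "In = {j \<in> I. cross (d j) (d k) > 0}"
    have fin: "finite In" "In \<noteq> {}" using I between[OF k] by (auto simp: In_def)
    \<comment> \<open>The cotangent of the angle from \<open>d j\<close> to \<open>d k\<close>,
      which lies strictly between 0 and pi for \<open>j\<close> in \<open>In\<close>. Its minimum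
      picks the largest angle, hence the ray farthest clockwise.\<close>
    define cot where "cot = (\<lambda>j. Re (cnj (d j) * d k) / cross (d j) (d k))"
    obtain j where j: "j \<in> In" "\<And>l. l \<in> In \<Longrightarrow> cot j \<le> cot l"
      using ex_is_arg_min_if_finite[OF fin, of cot] by (auto simp: is_arg_min_linorder)
    have jI: "j \<in> I" and jk: "cross (d j) (d k) > 0" using j by (auto simp: In_def)
    obtain l m where lm: "l \<in> I" "m \<in> I" "cross (d l) (d j) > 0" "cross (d j) (d m) > 0" "cross (d l) (d m) > 0"
      using between[OF jI] by blast
    have k0: "d k \<noteq> 0" using jk by (auto simp: cross_def)
    \<comment> \<open>The ray \<open>l\<close> is clockwise of \<open>j\<close>. It cannot belong to
      \<open>In\<close>, being farther from \<open>k\<close> than \<open>j\<close>, and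
      \<open>cross (d k) (d l) > 0\<close> would make \<open>l\<close>, \<open>j\<close>,
      \<open>k\<close> a cyclic triple. So \<open>d l\<close> is parallel to \<open>d k\<close>, and
      the sign of \<open>cross (d l) (d j)\<close> makes it opposite.\<close>
    have "\<not> cross (d l) (d k) > 0"
    proof
      assume lk: "cross (d l) (d k) > 0"
      have "Re (cnj (d j) * d k) * cross (d l) (d k) - Re (cnj (d l) * d k) * cross (d j) (d k)
          = (cmod (d k))\<^sup>2 * cross (d l) (d j)"
        unfolding cmod_power2 by (simp add: cross_def power2_eq_square algebra_simps)
      also have "\<dots> > 0" using k0 lm(3) by simp
      finally have "cot l < cot j" using lk jk by (simp add: cot_def field_simps)
      moreover have "cot j \<le> cot l" using lk lm(1) by (intro j(2)) (simp add: In_def)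
      ultimately show False by simp
    qed
    moreover have "\<not> cross (d k) (d l) > 0" using N[OF lm(1) jI k] lm(3) jk by blast
    ultimately have kl: "cross (d k) (d l) = 0" using cross_anticommute[of "d l" "d k"] by linarith
    define s where "s = Re (cnj (d k) * d l) / (cmod (d k))\<^sup>2"
    have dl: "d l = of_real s * d k" unfolding s_def by (rule cross_eq_0_imp_parallel[OF k0 kl])
    have "s * cross (d k) (d j) > 0" using lm(3) unfolding dl cross_scale_left .
    then have s: "s < 0" using jk cross_anticommute[of "d k" "d j"] by (simp add: mult_less_0_iff)
    have "s * cross (d k) (d m) > 0" using lm(5) unfolding dl cross_scale_left .
    then have "cross (d m) (d k) > 0" using s cross_anticommute[of "d k" "d m"] by (simp add: mult_less_0_iff)
    then show ?thesis using jI lm jk dl s by blast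
  qed
  obtain k where k: "k \<in> I" using I by blast
  obtain j l m s where 1: "j \<in> I" "l \<in> I" "m \<in> I" "s < 0" "cross (d j) (d k) > 0" "d l = of_real s * d k"
      "cross (d j) (d m) > 0" "cross (d m) (d k) > 0" using opposite[OF k] by blast
  obtain r s' where 2: "r \<in> I" "s' < 0" "d r = of_real s' * d j" using opposite[OF 1(1)] by blast
  have "cross (d r) (d l) > 0"
    using 1 2 by (simp add: cross_scale_left cross_scale_right mult_neg_neg mult_neg_pos)
  moreover have "cross (d l) (d m) > 0"
    using 1 cross_anticommute[of "d k" "d m"] by (simp add: cross_scale_left mult_neg_pos)
  moreover have "cross (d m) (d r) > 0"
    using 1 2 cross_anticommute[of "d m" "d j"] by (simp add: cross_scale_right mult_neg_pos)
  ultimately show False using N[OF 2(1) 1(2,3)] by blast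
qed

section \<open>The ray condition in terms of directions\<close>

lemma closed_ray_eq_imp_same_direction:
  assumes "closed_ray c u = closed_ray c d" "u \<noteq> 0"
  shows "\<exists>s>0. u = of_real s * d"
proof -
  have "c + of_real 1 * u \<in> closed_ray c u"
    unfolding closed_ray_def using zero_le_one by blast
  then have "c + of_real 1 * u \<in> closed_ray c d" using assms(1) by simp
  then obtain s where s: "s \<ge> 0" "c + of_real 1 * u = c + of_real s * d"
    unfolding closed_ray_def by blast
  then have "u = of_real s * d" by simp
  moreover from this have "s > 0" using s(1) assms(2) by (cases "s = 0") auto
  ultimately show ?thesis by blast
qed

lemma fiber_over_M_surf_self: "fiber_over z (M_surf z) = {}"
  by (simp add: fiber_over_def M_surf_def)

text \<open>A direction in the sector is \<open>u = s * v + t * w\<close> with positive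
  \<open>s\<close> and \<open>t\<close>, so \<open>cross v u\<close> and \<open>cross u w\<close>
  are positive multiples of \<open>cross v w\<close>. The two alternatives are the two orientations
  of the bounding rays.\<close>

lemma ray_between_fibers_cross:
  assumes "ray_between (cnj z) (fiber_over z (M_surf a)) (fiber_over z (M_surf b)) (fiber_over z (M_surf c))"
  defines "d \<equiv> \<lambda>a. cnj (z - a)"
  shows "cross (d b) (d a) > 0 \<and> cross (d a) (d c) > 0 \<and> cross (d b) (d c) > 0 \<or>
         cross (d c) (d a) > 0 \<and> cross (d a) (d b) > 0 \<and> cross (d c) (d b) > 0"
proof -
  obtain u v w where u: "u \<noteq> 0" "fiber_over z (M_surf a) = closed_ray (cnj z) u"
    and v: "fiber_over z (M_surf b) = closed_ray (cnj z) v"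
    and w: "fiber_over z (M_surf c) = closed_ray (cnj z) w"
    and vw: "\<not> collinear {0, v, w}"
    and sec: "fiber_over z (M_surf a) - {cnj z} \<subseteq> open_sector (cnj z) v w"
    using assms(1) unfolding ray_between_def by blast
  \<comment> \<open>A fiber over its own centre is empty and a ray is not, so each of the three
    centres differs from \<open>z\<close>.\<close>
  have ne: "closed_ray p q \<noteq> {}" for p q unfolding closed_ray_def by force
  have za: "z \<noteq> a" using u(2) ne fiber_over_M_surf_self by metis
  have zb: "z \<noteq> b" using v ne fiber_over_M_surf_self by metis
  have zc: "z \<noteq> c" using w ne fiber_over_M_surf_self by metis
  have vw0: "v \<noteq> 0" "w \<noteq> 0" using vw by (auto simp: collinear_lemma)
  obtain su where su: "su > 0" "u = of_real su * d a"
    using closed_ray_eq_imp_same_direction[OF _ u(1)] u(2) fiber_over_M_surf[OF za] unfolding d_def by metis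
  obtain sv where sv: "sv > 0" "v = of_real sv * d b"
    using closed_ray_eq_imp_same_direction[OF _ vw0(1)] v fiber_over_M_surf[OF zb] unfolding d_def by metis
  obtain sw where sw: "sw > 0" "w = of_real sw * d c"
    using closed_ray_eq_imp_same_direction[OF _ vw0(2)] w fiber_over_M_surf[OF zc] unfolding d_def by metis
  have "cnj z + of_real 1 * u \<in> closed_ray (cnj z) u" unfolding closed_ray_def by fastforce
  then have "cnj z + u \<in> open_sector (cnj z) v w" using sec u by auto
  then obtain s t where st: "s > 0" "t > 0" "u = of_real s * v + of_real t * w"
    unfolding open_sector_def by (auto simp: add.assoc)
  have "cross v w \<noteq> 0"
  proof
    assume "cross v w = 0"
    from cross_eq_0_imp_parallel[OF vw0(1) this] vw show False
      unfolding collinear_lemma scaleR_conv_of_real by blast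
  qed
  then consider "cross v w > 0" | "cross w v > 0" using cross_anticommute[of v w] by linarith
  then show ?thesis
  proof cases
    case 1
    have "cross v u = t * cross v w" "cross u w = s * cross v w"
      unfolding st(3) by (simp_all add: cross_add_left cross_add_right cross_scale_left cross_scale_right cross_self)
    then have "cross v u > 0" "cross u w > 0" using 1 st by simp_all
    with 1 show ?thesis
      unfolding su(2) sv(2) sw(2) cross_scale_left cross_scale_right
      using su(1) sv(1) sw(1) by (simp add: zero_less_mult_iff)
  next
    case 2
    have "cross w u = s * cross w v" "cross u v = t * cross w v"
      unfolding st(3) by (simp_all add: cross_add_left cross_add_right cross_scale_left cross_scale_right cross_self)
    then have "cross w u > 0" "cross u v > 0" using 2 st by simp_all
    with 2 show ?thesis
      unfolding su(2) sv(2) sw(2) cross_scale_left cross_scale_right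
      using su(1) sv(1) sw(1) by (simp add: zero_less_mult_iff)
  qed
qed

text \<open>The witness is the normalized bisector \<open>cmod e * d + cmod d * e\<close>. The angle
  from \<open>d\<close> to \<open>e\<close> is less than pi, so the bisector makes an acute angle
  with both; the signs of the imaginary parts place it counterclockwise of \<open>d\<close> and
  clockwise of \<open>e\<close>.\<close>

lemma bisecting_direction_exists:
  assumes "cross d e > 0"
  shows "\<exists>u. cmod u = 1 \<and> Re (u * cnj d) > 0 \<and> Im (u * cnj d) > 0 \<and> Re (u * cnj e) > 0 \<and> Im (u * cnj e) < 0"
proof -
  have d: "d \<noteq> 0" and e: "e \<noteq> 0" using assms by (auto simp: cross_def)
  define u where "u = of_real (cmod e) * d + of_real (cmod d) * e"
  define R where "R = Re (cnj d * e)"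
  have Rlt: "- (cmod d * cmod e) < R"
  proof -
    have "R\<^sup>2 + (cross d e)\<^sup>2 = (cmod d * cmod e)\<^sup>2"
      using cmod_power2[of "cnj d * e"] by (simp add: R_def cross_def norm_mult)
    then have "R\<^sup>2 < (cmod d * cmod e)\<^sup>2" using assms by (smt (verit) zero_less_power)
    then have "\<bar>R\<bar> < cmod d * cmod e" by (metis abs_mult abs_norm_cancel abs_power2 power2_abs power2_less_imp_less mult_nonneg_nonneg norm_ge_zero)
    then show ?thesis by linarith
  qed
  have ud: "u * cnj d = of_real (cmod d) * (of_real (cmod d * cmod e) + cnj d * e)"
  proof -
    have "u * cnj d = of_real (cmod e) * (d * cnj d) + of_real (cmod d) * (cnj d * e)"
      by (simp add: u_def algebra_simps)
    then show ?thesis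
      unfolding complex_norm_square[symmetric] by (simp add: power2_eq_square algebra_simps)
  qed
  have ue: "u * cnj e = of_real (cmod e) * (of_real (cmod d * cmod e) + cnj (cnj d * e))"
  proof -
    have "u * cnj e = of_real (cmod e) * (d * cnj e) + of_real (cmod d) * (e * cnj e)"
      by (simp add: u_def algebra_simps)
    then show ?thesis
      unfolding complex_norm_square[symmetric] by (simp add: power2_eq_square algebra_simps)
  qed
  have pos: "Re (u * cnj d) > 0" "Im (u * cnj d) > 0" "Re (u * cnj e) > 0" "Im (u * cnj e) < 0"
  proof -
    have R: "Re (of_real r * w) = r * Re w" "Im (of_real r * w) = r * Im w" for r w by simp_all
    have "Re (u * cnj d) = cmod d * (cmod d * cmod e + R)" "Im (u * cnj d) = cmod d * cross d e"
      unfolding ud R by (simp_all add: R_def cross_def)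
    moreover have "Re (u * cnj e) = cmod e * (cmod d * cmod e + R)" "Im (u * cnj e) = - (cmod e * cross d e)"
      unfolding ue R by (simp_all add: R_def cross_def algebra_simps)
    ultimately show "Re (u * cnj d) > 0" "Im (u * cnj d) > 0" "Re (u * cnj e) > 0" "Im (u * cnj e) < 0"
      using Rlt assms d e by auto
  qed
  then have u0: "u \<noteq> 0" by auto
  have sg: "sgn u * x = of_real (1 / cmod u) * (u * x)" for x
    by (simp add: sgn_eq)
  show ?thesis
    using pos u0 by (intro exI[of _ "sgn u"]) (simp add: norm_sgn sg divide_neg_pos del: of_real_divide)
qed

section \<open>The estimate\<close>

lemma Im_Ln_neg:
  assumes "Im z < 0"
  shows "Im (Ln z) < 0"
proof -
  have "z \<noteq> 0" using assms by auto
  then show ?thesis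
    using Im_Ln_pos_le[of z] Im_Ln_le_pi[of z] assms by auto
qed

text \<open>The exponential of the sum is \<open>1\<close>, and its imaginary part is negative.\<close>

lemma Ln_cycle_sum:
  assumes sg: "Im (u1 * v1) > 0" "Im (u1 * v2) < 0" "Im (u2 * v2) > 0" "Im (u2 * v3) < 0"
     "Im (u3 * v3) > 0" "Im (u3 * v1) < 0"
  shows "2 * pi \<le> cmod ((Ln (u3 * v1) - Ln (u1 * v1)) + (Ln (u1 * v2) - Ln (u2 * v2)) + (Ln (u2 * v3) - Ln (u3 * v3)))"
    (is "_ \<le> cmod ?S")
proof -
  have nz: "u1 \<noteq> 0" "u2 \<noteq> 0" "u3 \<noteq> 0" "v1 \<noteq> 0" "v2 \<noteq> 0" "v3 \<noteq> 0" using sg by auto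
  \<comment> \<open>In the product of the three quotients every \<open>u\<close> and every
    \<open>v\<close> occurs once above and once below.\<close>
  have "exp ?S = 1"
    using nz by (simp add: exp_add exp_diff divide_simps)
  then obtain n :: int where n: "Im ?S = of_int (2 * n) * pi"
    unfolding exp_eq_1 by blast
  have pos: "Im (Ln w) > 0" if "Im w > 0" for w
  proof -
    have "w \<noteq> 0" using that by auto
    then show ?thesis using Im_Ln_pos_lt[of w] that by blast
  qed
  have "Im ?S < 0"
    using Im_Ln_neg[OF sg(2)] Im_Ln_neg[OF sg(4)] Im_Ln_neg[OF sg(6)]
      pos[OF sg(1)] pos[OF sg(3)] pos[OF sg(5)] by simp
  then have "n \<noteq> 0" using n by auto
  then have "1 \<le> \<bar>real_of_int n\<bar>" by linarith
  then have "2 * pi * 1 \<le> 2 * pi * \<bar>real_of_int n\<bar>" by (intro mult_left_mono) auto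
  also have "\<dots> = \<bar>Im ?S\<bar>" unfolding n by (simp add: abs_mult)
  also have "\<dots> \<le> cmod ?S" by (rule abs_Im_le_cmod)
  finally show ?thesis by simp
qed

lemma set_lebesgue_integral_ball_eq_integral:
  fixes \<psi> :: "complex \<Rightarrow> real"
  assumes "continuous_on UNIV \<psi>"
  shows "(LINT \<zeta>:ball z0 R|lborel. \<psi> \<zeta>) = integral (ball z0 R) \<psi>"
proof -
  have "continuous_on (cball z0 R) \<psi>" using assms by (rule continuous_on_subset) auto
  from borel_integrable_compact[OF compact_cball this]
  have "set_integrable lborel (cball z0 R) \<psi>" by (simp add: set_integrable_def)
  then have "set_integrable lborel (ball z0 R) \<psi>"
    by (rule set_integrable_subset) auto
  then show ?thesis by (rule set_borel_integral_eq_integral)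
qed

text \<open>The differences of consecutive transforms around the cycle are bounded uniformly in
  \<open>\<delta>\<close>. Their sum is also the sum of the jumps at the three origins, which tends
  to \<open>f z\<close> times a sum of logarithms of modulus at least \<open>2 * pi\<close>.\<close>

lemma cyclic_centres_bound:
  fixes p :: real and z0 a1 a2 a3 :: complex and X :: "complex set"
  assumes p: "p > 2" and X: "a1 \<in> X" "a2 \<in> X" "a3 \<in> X"
    and cyc: "cross (cnj (z0 - a1)) (cnj (z0 - a2)) > 0" "cross (cnj (z0 - a2)) (cnj (z0 - a3)) > 0"
      "cross (cnj (z0 - a3)) (cnj (z0 - a1)) > 0"
  shows "\<exists>\<epsilon>>0. \<exists>R>0. \<exists>C\<ge>0. \<forall>f\<in>circle_ext_funs X. \<forall>z\<in>ball z0 \<epsilon>.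
           cmod (f z) \<le> C * (LINT \<zeta>:ball z0 R|lborel. cmod (f \<zeta>) powr p) powr (1 / p)"
proof -
  define \<rho> where "\<rho> = (\<lambda>a. cmod (z0 - a))"
  \<comment> \<open>The cut-off circle about \<open>a\<close> has radius
    \<open>\<rho> a + 1\<close>, so it surrounds \<open>z0\<close>; \<open>R\<close> is large enough
    for \<open>ball z0 R\<close> to contain the discs about all three centres.\<close>
  define T where "T = (\<lambda>a. (\<rho> a + 1)\<^sup>2)"
  define R where "R = 2 * (\<rho> a1 + \<rho> a2 + \<rho> a3) + 2"
  have \<rho>0: "\<rho> a \<ge> 0" for a by (simp add: \<rho>_def)
  have R: "R > 0" using \<rho>0[of a1] \<rho>0[of a2] \<rho>0[of a3] by (simp add: R_def)
  have \<rho>: "\<rho> a1 > 0" "\<rho> a2 > 0" "\<rho> a3 > 0" using cyc by (auto simp: \<rho>_def cross_def)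
  have sqT: "sqrt (T a) = \<rho> a + 1" and T0: "T a > 0" for a
    using \<rho>0[of a] by (simp_all add: T_def)
  have T: "(cmod (z0 - a))\<^sup>2 < T a" for a
    unfolding T_def \<rho>_def by (intro power_strict_mono) auto
  have sub: "cball a (sqrt (T a)) \<subseteq> ball z0 R" if "a \<in> {a1, a2, a3}" for a
  proof
    fix w assume "w \<in> cball a (sqrt (T a))"
    then have "dist z0 w \<le> \<rho> a + (\<rho> a + 1)"
      using dist_triangle[of z0 w a] sqT[of a] by (simp add: \<rho>_def dist_norm)
    also have "\<dots> < R" using that \<rho> by (auto simp: R_def)
    finally show "w \<in> ball z0 R" by simp
  qed
  \<comment> \<open>Each of the three directions lies between two consecutive rays of the cycle. The
    signs of the imaginary parts are those required by \<open>Ln_cycle_sum\<close>.\<close>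
  obtain u1 where u1: "cmod u1 = 1" "Re (u1 * (z0 - a1)) > 0" "Im (u1 * (z0 - a1)) > 0"
      "Re (u1 * (z0 - a2)) > 0" "Im (u1 * (z0 - a2)) < 0"
    using bisecting_direction_exists[OF cyc(1)] by auto
  obtain u2 where u2: "cmod u2 = 1" "Re (u2 * (z0 - a2)) > 0" "Im (u2 * (z0 - a2)) > 0"
      "Re (u2 * (z0 - a3)) > 0" "Im (u2 * (z0 - a3)) < 0"
    using bisecting_direction_exists[OF cyc(2)] by auto
  obtain u3 where u3: "cmod u3 = 1" "Re (u3 * (z0 - a3)) > 0" "Im (u3 * (z0 - a3)) > 0"
      "Re (u3 * (z0 - a1)) > 0" "Im (u3 * (z0 - a1)) < 0"
    using bisecting_direction_exists[OF cyc(3)] by auto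
  define A where "A = (\<lambda>f a u z \<delta>. cauchy_transform a (T a) (circle_ext f a)
      (\<lambda>w. (cnj w - of_real \<delta> * u - cnj a) * (w - a)) z)"
  define L1 where "L1 = (\<lambda>f a M. \<forall>z. \<rho> a / 2 \<le> cmod (z - a) \<longrightarrow> (cmod (z - a))\<^sup>2 \<le> T a \<longrightarrow>
      integral {(cmod (z - a))\<^sup>2..T a} (\<lambda>t. cmod (circle_ext f a t z)) \<le> M)"
  have pair: "\<exists>\<epsilon>>0. \<exists>\<kappa>>0. \<exists>C\<ge>0. \<forall>f z \<delta> M. f \<in> circle_ext_funs X \<longrightarrow> z \<in> ball z0 \<epsilon> \<longrightarrow>
      0 < \<delta> \<longrightarrow> \<delta> < \<kappa> \<longrightarrow> L1 f a M \<longrightarrow> L1 f b M \<longrightarrow> cmod (A f a u z \<delta> - A f b u z \<delta>) \<le> C * M"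
    if u: "cmod u = 1" "Re (u * (z0 - a)) > 0" "Re (u * (z0 - b)) > 0" and ab: "a \<in> X" "b \<in> X" for u a b
  proof -
    from cauchy_transform_pair_bound[OF u T T] obtain \<epsilon> \<kappa> C where *: "\<epsilon> > 0" "\<kappa> > 0" "C \<ge> 0" and
      b: "\<forall>X f z \<delta> M. f \<in> circle_ext_funs X \<longrightarrow> a \<in> X \<longrightarrow> b \<in> X \<longrightarrow> z \<in> ball z0 \<epsilon> \<longrightarrow>
        0 < \<delta> \<longrightarrow> \<delta> < \<kappa> \<longrightarrow> L1 f a M \<longrightarrow> L1 f b M \<longrightarrow> cmod (A f a u z \<delta> - A f b u z \<delta>) \<le> C * M"
      unfolding A_def L1_def \<rho>_def by (elim exE conjE)
    show ?thesis
      by (rule exI[of _ \<epsilon>], rule conjI[OF *(1)], rule exI[of _ \<kappa>], rule conjI[OF *(2)],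
          rule exI[of _ C], rule conjI[OF *(3)]) (use b ab in simp)
  qed
  obtain \<epsilon>1 \<kappa>1 C1 where 1: "\<epsilon>1 > 0" "\<kappa>1 > 0" "C1 \<ge> 0"
    "\<And>f z \<delta> M. f \<in> circle_ext_funs X \<Longrightarrow> z \<in> ball z0 \<epsilon>1 \<Longrightarrow> 0 < \<delta> \<Longrightarrow> \<delta> < \<kappa>1 \<Longrightarrow>
       L1 f a1 M \<Longrightarrow> L1 f a2 M \<Longrightarrow> cmod (A f a1 u1 z \<delta> - A f a2 u1 z \<delta>) \<le> C1 * M"
    using pair[OF u1(1,2,4)] X by blast
  obtain \<epsilon>2 \<kappa>2 C2 where 2: "\<epsilon>2 > 0" "\<kappa>2 > 0" "C2 \<ge> 0"
    "\<And>f z \<delta> M. f \<in> circle_ext_funs X \<Longrightarrow> z \<in> ball z0 \<epsilon>2 \<Longrightarrow> 0 < \<delta> \<Longrightarrow> \<delta> < \<kappa>2 \<Longrightarrow>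
       L1 f a2 M \<Longrightarrow> L1 f a3 M \<Longrightarrow> cmod (A f a2 u2 z \<delta> - A f a3 u2 z \<delta>) \<le> C2 * M"
    using pair[OF u2(1,2,4)] X by blast
  obtain \<epsilon>3 \<kappa>3 C3 where 3: "\<epsilon>3 > 0" "\<kappa>3 > 0" "C3 \<ge> 0"
    "\<And>f z \<delta> M. f \<in> circle_ext_funs X \<Longrightarrow> z \<in> ball z0 \<epsilon>3 \<Longrightarrow> 0 < \<delta> \<Longrightarrow> \<delta> < \<kappa>3 \<Longrightarrow>
       L1 f a3 M \<Longrightarrow> L1 f a1 M \<Longrightarrow> cmod (A f a3 u3 z \<delta> - A f a1 u3 z \<delta>) \<le> C3 * M"
    using pair[OF u3(1,2,4)] X by blast
  have "\<exists>K\<ge>0. \<forall>f\<in>circle_ext_funs X. \<forall>s>0. integral (ball z0 R) (\<lambda>\<zeta>. cmod (f \<zeta>) powr p) \<le> s powr p \<longrightarrow> L1 f a (K * s)"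
    if "a \<in> {a1, a2, a3}" for a
  proof -
    have "\<rho> a / 2 > 0" "a \<in> X" using that \<rho> X by auto
    with circle_ext_L1_bound[OF p, of "\<rho> a / 2" "T a"] T0[of a] sub[OF that]
    show ?thesis unfolding L1_def by meson
  qed
  then obtain K where K: "\<And>a. a \<in> {a1, a2, a3} \<Longrightarrow> K a \<ge> 0"
    "\<And>a f s. a \<in> {a1, a2, a3} \<Longrightarrow> f \<in> circle_ext_funs X \<Longrightarrow> s > 0 \<Longrightarrow>
       integral (ball z0 R) (\<lambda>\<zeta>. cmod (f \<zeta>) powr p) \<le> s powr p \<Longrightarrow> L1 f a (K a * s)"
    by metis
  define K' where "K' = K a1 + K a2 + K a3"
  have K': "K' \<ge> 0" "\<And>a. a \<in> {a1, a2, a3} \<Longrightarrow> K a \<le> K'" using K(1) by (auto simp: K'_def)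
  have L1K: "L1 f a (K' * s)" if "a \<in> {a1, a2, a3}" "f \<in> circle_ext_funs X" "s > 0"
     "integral (ball z0 R) (\<lambda>\<zeta>. cmod (f \<zeta>) powr p) \<le> s powr p" for f a s
  proof -
    have "K a * s \<le> K' * s" using K'(2)[OF that(1)] that(3) by simp
    with K(2)[OF that] show ?thesis unfolding L1_def by (meson order_trans)
  qed
  define V where "V = {z. Re (u1 * (z - a1)) > 0} \<inter> {z. Im (u1 * (z - a1)) > 0} \<inter> {z. Re (u1 * (z - a2)) > 0} \<inter> {z. Im (u1 * (z - a2)) < 0}
    \<inter> ({z. Re (u2 * (z - a2)) > 0} \<inter> {z. Im (u2 * (z - a2)) > 0} \<inter> {z. Re (u2 * (z - a3)) > 0} \<inter> {z. Im (u2 * (z - a3)) < 0})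
    \<inter> ({z. Re (u3 * (z - a3)) > 0} \<inter> {z. Im (u3 * (z - a3)) > 0} \<inter> {z. Re (u3 * (z - a1)) > 0} \<inter> {z. Im (u3 * (z - a1)) < 0})
    \<inter> ({z. (cmod (z - a1))\<^sup>2 < T a1} \<inter> {z. (cmod (z - a2))\<^sup>2 < T a2} \<inter> {z. (cmod (z - a3))\<^sup>2 < T a3})"
  have "open V" unfolding V_def by (intro open_Int open_Collect_less continuous_intros)
  moreover have "z0 \<in> V" using u1 u2 u3 T by (auto simp: V_def)
  ultimately obtain \<epsilon>4 where \<epsilon>4: "\<epsilon>4 > 0" "ball z0 \<epsilon>4 \<subseteq> V" by (meson open_contains_ball)
  define \<epsilon> where "\<epsilon> = min (min \<epsilon>1 \<epsilon>2) (min \<epsilon>3 \<epsilon>4)"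
  have \<epsilon>: "\<epsilon> > 0" using 1 2 3 \<epsilon>4 by (simp add: \<epsilon>_def)
  define C where "C = (C1 + C2 + C3) * K' / (2 * pi)"
  have C: "C \<ge> 0" using 1 2 3 K' by (simp add: C_def)
  have bound: "cmod (f z) \<le> C * s"
    if f: "f \<in> circle_ext_funs X" and z: "z \<in> ball z0 \<epsilon>" and s: "s > 0"
      and S: "integral (ball z0 R) (\<lambda>\<zeta>. cmod (f \<zeta>) powr p) \<le> s powr p" for f z s
  proof -
    have zb: "z \<in> ball z0 \<epsilon>1" "z \<in> ball z0 \<epsilon>2" "z \<in> ball z0 \<epsilon>3" and zV: "z \<in> V"
      using z \<epsilon>4 by (auto simp: \<epsilon>_def)
    define S1 where "S1 = Ln (u3 * (z - a1)) - Ln (u1 * (z - a1))"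
    define S2 where "S2 = Ln (u1 * (z - a2)) - Ln (u2 * (z - a2))"
    define S3 where "S3 = Ln (u2 * (z - a3)) - Ln (u3 * (z - a3))"
    have "((\<lambda>\<delta>. (A f a1 u1 z \<delta> - A f a1 u3 z \<delta>) + (A f a2 u2 z \<delta> - A f a2 u1 z \<delta>) + (A f a3 u3 z \<delta> - A f a3 u2 z \<delta>))
       \<longlongrightarrow> f z * S1 + f z * S2 + f z * S3) (at_right 0)"
      unfolding A_def S1_def S2_def S3_def
      by (intro tendsto_add cauchy_transform_jump[OF f]) (use zV X in \<open>auto simp: V_def\<close>)
    then have lim: "((\<lambda>\<delta>. cmod ((A f a1 u1 z \<delta> - A f a1 u3 z \<delta>) + (A f a2 u2 z \<delta> - A f a2 u1 z \<delta>) + (A f a3 u3 z \<delta> - A f a3 u2 z \<delta>)))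
       \<longlongrightarrow> cmod (f z * S1 + f z * S2 + f z * S3)) (at_right 0)"
      by (rule tendsto_norm)
    define \<kappa> where "\<kappa> = min \<kappa>1 (min \<kappa>2 \<kappa>3)"
    have \<kappa>: "\<kappa> > 0" using 1 2 3 by (simp add: \<kappa>_def)
    have "\<forall>\<^sub>F \<delta> in at_right 0. \<delta> \<in> {0<..<\<kappa>}" using \<kappa> by (rule eventually_at_right_real)
    then have "\<forall>\<^sub>F \<delta> in at_right 0. cmod ((A f a1 u1 z \<delta> - A f a1 u3 z \<delta>) + (A f a2 u2 z \<delta> - A f a2 u1 z \<delta>) + (A f a3 u3 z \<delta> - A f a3 u2 z \<delta>))
       \<le> (C1 + C2 + C3) * (K' * s)"
    proof eventually_elim
      case (elim \<delta>)
      then have \<delta>: "0 < \<delta>" "\<delta> < \<kappa>1" "\<delta> < \<kappa>2" "\<delta> < \<kappa>3" by (auto simp: \<kappa>_def)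
      have L: "L1 f a1 (K' * s)" "L1 f a2 (K' * s)" "L1 f a3 (K' * s)" using L1K[OF _ f s S] by auto
      \<comment> \<open>Regrouping from jumps, with one centre and two directions, to pairs with one
        direction and two centres, where the uniform bounds apply.\<close>
      have "(A f a1 u1 z \<delta> - A f a1 u3 z \<delta>) + (A f a2 u2 z \<delta> - A f a2 u1 z \<delta>) + (A f a3 u3 z \<delta> - A f a3 u2 z \<delta>)
         = (A f a1 u1 z \<delta> - A f a2 u1 z \<delta>) + (A f a2 u2 z \<delta> - A f a3 u2 z \<delta>) + (A f a3 u3 z \<delta> - A f a1 u3 z \<delta>)"
        by simp
      also have "cmod \<dots> \<le> C1 * (K' * s) + C2 * (K' * s) + C3 * (K' * s)"
        using 1(4)[OF f zb(1) \<delta>(1,2) L(1,2)] 2(4)[OF f zb(2) \<delta>(1,3) L(2,3)] 3(4)[OF f zb(3) \<delta>(1,4) L(3,1)]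
        by (intro order_trans[OF norm_triangle_ineq] add_mono)
      finally show ?case by (simp add: algebra_simps)
    qed
    from tendsto_upperbound[OF lim this] have "cmod (f z * S1 + f z * S2 + f z * S3) \<le> (C1 + C2 + C3) * (K' * s)"
      by simp
    then have "cmod (f z) * cmod (S1 + S2 + S3) \<le> (C1 + C2 + C3) * (K' * s)"
      by (simp only: norm_mult[symmetric] distrib_left)
    moreover have "2 * pi \<le> cmod (S1 + S2 + S3)"
      unfolding S1_def S2_def S3_def by (rule Ln_cycle_sum) (use zV in \<open>auto simp: V_def\<close>)
    then have "cmod (f z) * (2 * pi) \<le> cmod (f z) * cmod (S1 + S2 + S3)" by (intro mult_left_mono) auto
    ultimately have "cmod (f z) * (2 * pi) \<le> (C1 + C2 + C3) * (K' * s)" by linarith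
    then show ?thesis by (simp add: C_def pos_le_divide_eq mult_ac)
  qed
  have final: "cmod (f z) \<le> C * (LINT \<zeta>:ball z0 R|lborel. cmod (f \<zeta>) powr p) powr (1 / p)"
    if f: "f \<in> circle_ext_funs X" and z: "z \<in> ball z0 \<epsilon>" for f z
  proof -
    define I where "I = integral (ball z0 R) (\<lambda>\<zeta>. cmod (f \<zeta>) powr p)"
    have fc: "continuous_on UNIV f" using f by (simp add: circle_ext_funs_def)
    have "continuous_on UNIV (\<lambda>\<zeta>. cmod (f \<zeta>) powr p)"
      using p by (intro continuous_on_powr' continuous_intros fc) auto
    then have I: "(LINT \<zeta>:ball z0 R|lborel. cmod (f \<zeta>) powr p) = I"
      unfolding I_def by (rule set_lebesgue_integral_ball_eq_integral)
    have I0: "I \<ge> 0" unfolding I[symmetric] set_lebesgue_integral_def by (rule Bochner_Integration.integral_nonneg) auto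
    have "cmod (f z) \<le> C * (I powr (1 / p))"
    proof (rule field_le_epsilon)
      fix e :: real assume e: "e > 0"
      \<comment> \<open>\<open>bound\<close> requires a positive \<open>s\<close>, whereas
        \<open>I\<close> may be 0. The increment costs \<open>C * e / (C + 1) \<le> e\<close>, and
        the denominator is positive even for \<open>C = 0\<close>.\<close>
      define s where "s = I powr (1 / p) + e / (C + 1)"
      have eC: "e / (C + 1) > 0" using e C by simp
      have s: "s > 0" using eC by (auto simp: s_def intro!: add_nonneg_pos)
      have "I = (I powr (1 / p)) powr p" using I0 p by (simp add: powr_powr)
      also have "\<dots> \<le> s powr p" using eC p by (intro powr_mono2) (auto simp: s_def)
      finally have "cmod (f z) \<le> C * s" using bound[OF f z s] by (simp add: I_def)
      also have "\<dots> = C * I powr (1 / p) + e * (C / (C + 1))" by (simp add: s_def algebra_simps)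
      also have "e * (C / (C + 1)) \<le> e * 1" using e C by (intro mult_left_mono) auto
      finally show "cmod (f z) \<le> C * I powr (1 / p) + e" by simp
    qed
    then show ?thesis using I by simp
  qed
  show ?thesis using \<epsilon> R C final by blast
qed

theorem theorem1:
  fixes p :: real and X :: "complex set" and z0 :: complex and a :: "nat \<Rightarrow> complex"
  assumes "p > 2"
    and "discrete X"
    and "inj_on a {1..5}"
    and "a ` {1..5} \<subseteq> X"
    and "\<forall>i\<in>{1..5}. \<exists>j\<in>{1..5}. \<exists>k\<in>{1..5}. i \<noteq> j \<and> i \<noteq> k \<and> j \<noteq> k \<and>
           ray_between (cnj z0) (fiber_over z0 (M_surf (a i)))
             (fiber_over z0 (M_surf (a j))) (fiber_over z0 (M_surf (a k)))"
  shows "\<exists>\<epsilon>>0. \<exists>R>0. \<exists>C :: complex \<Rightarrow> real. continuous_on (ball z0 \<epsilon>) C \<and>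
           (\<forall>f\<in>circle_ext_funs X. \<forall>z\<in>ball z0 \<epsilon>.
              cmod (f z) \<le> C z * (LINT \<zeta>:ball z0 R|lborel. cmod (f \<zeta>) powr p) powr (1 / p))"
proof -
  define d where "d = (\<lambda>i. cnj (z0 - a i))"
  have "\<exists>j\<in>{1..5}. \<exists>k\<in>{1..5}. cross (d j) (d i) > 0 \<and> cross (d i) (d k) > 0 \<and> cross (d j) (d k) > 0"
    if i: "i \<in> {1..5}" for i
  proof -
    obtain j k where jk: "j \<in> {1..5}" "k \<in> {1..5}"
      "ray_between (cnj z0) (fiber_over z0 (M_surf (a i)))
             (fiber_over z0 (M_surf (a j))) (fiber_over z0 (M_surf (a k)))"
      using assms(5) i by blast
    from ray_between_fibers_cross[OF jk(3)] jk(1,2) show ?thesis unfolding d_def by blast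
  qed
  from cyclic_triple_exists[OF _ _ this] obtain i j k where
    ijk: "i \<in> {1..5}" "j \<in> {1..5}" "k \<in> {1..5}"
      "cross (d i) (d j) > 0" "cross (d j) (d k) > 0" "cross (d k) (d i) > 0"
    by auto
  have "a i \<in> X" "a j \<in> X" "a k \<in> X" using ijk assms(4) by auto
  from cyclic_centres_bound[OF assms(1) this ijk(4-6)[unfolded d_def]]
  obtain \<epsilon> R C where "\<epsilon> > 0" "R > 0" "\<forall>f\<in>circle_ext_funs X. \<forall>z\<in>ball z0 \<epsilon>.
           cmod (f z) \<le> C * (LINT \<zeta>:ball z0 R|lborel. cmod (f \<zeta>) powr p) powr (1 / p)" by blast
  \<comment> \<open>One constant serves the whole ball, so the continuous bound is taken to be
    constant in \<open>z\<close>.\<close>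
  then show ?thesis
    by (intro exI[of _ \<epsilon>] conjI exI[of _ R] exI[of _ "\<lambda>_. C"]) auto
qed

end
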